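(* For every $d \geq 3$ there exist positive reals $(\epsilon_n)_{n \geq 3}$ with $\epsilon_n = (1/2)^{o(n)}$ (that is, $\log_2(1/\epsilon_n) = o(n)$ as $n \to \infty$) such that for every $n \geq 3$ the following holds: every finite set $\mathcal{X} \subset \mathbb{R}^d$ in general position with $|\mathcal{X}| \geq ES_3(8n)$ contains a collection of $n$ subsets $X_1, \ldots, X_n \subset \mathcal{X}$ which is in convex position and satisfies $|X_i| \geq \epsilon_n |\mathcal{X}|$ for all $i = 1, \ldots, n$.
   Context: A set $X \subset \mathbb{R}^d$ with $|X| \geq d+1$ is in general position if no $d+1$ points of $X$ lie on a common affine hyperplane. A finite point set is in convex position if its points are the vertices of a convex polytope. $ES_d(n)$ denotes the smallest integer $N$ such that every set of $N$ points in general position in $\mathbb{R}^d$ contains $n$ points in convex position. A collection of sets $X_1, \ldots, X_n \subset \mathbb{R}^d$ is in convex position if for every $i = 1, \ldots, n$ the convex hulls $\mathrm{conv}(X_i)$ and $\mathrm{conv}(\bigcup_{j \neq i} X_j)$ are disjoint. *)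

theory Defs
  imports "HOL-Analysis.Analysis" "HOL-Library.Landau_Symbols"
begin

(* The size condition belongs to the notion: without it every set of at most DIM('a) points
   (three collinear points in dimension 3, say) would vacuously be in general position. *)
definition general_position :: "'a::euclidean_space set \<Rightarrow> bool" where
  "general_position X \<longleftrightarrow>
     (finite X \<longrightarrow> card X \<ge> DIM('a) + 1) \<and>
     \<not> (\<exists>S a b. S \<subseteq> X \<and> card S = DIM('a) + 1 \<and> a \<noteq> 0 \<and> S \<subseteq> {x. a \<bullet> x = b})"

definition convex_position :: "'a::euclidean_space set \<Rightarrow> bool" where
  "convex_position P \<longleftrightarrow> (\<exists>K. polytope K \<and> P = {v. v extreme_point_of K})"

(* The dimension d is the dimension of the type 'a.  Since sets of at most d points are never
   in general position, N ranges over N >= d + 1; otherwise N = 0 would qualify vacuously. *)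
definition ES :: "'a::euclidean_space itself \<Rightarrow> nat \<Rightarrow> nat" where
  "ES _ n = (LEAST N. N \<ge> DIM('a) + 1 \<and>
     (\<forall>X::'a set. finite X \<and> card X = N \<and> general_position X \<longrightarrow>
        (\<exists>P\<subseteq>X. card P = n \<and> convex_position P)))"

definition family_convex_position :: "'i set \<Rightarrow> ('i \<Rightarrow> 'a::euclidean_space set) \<Rightarrow> bool" where
  "family_convex_position I X \<longleftrightarrow>
     (\<forall>i\<in>I. convex hull (X i) \<inter> convex hull (\<Union>j\<in>I - {i}. X j) = {})"

end

theory Submission
  imports "HOL-Library.Ramsey" "HOL-Real_Asymp.Real_Asymp" Defs
begin

text \<open>
  A generic projection reduces everything to \<open>\<real>\<^sup>3\<close>. There, the main point is that for every
  \<open>\<delta> > 0\<close> and large \<open>n\<close>, any \<open>2\<^bsup>\<delta>n\<^esup>\<close> points in general position contain \<open>n\<close> points each of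
  which is cut off from the others by a plane through three points of the set.

  By Ramsey's theorem and a counting argument there are boundedly many clusters, each of them a
  constant fraction of the set, which lie like points on the moment curve with respect to boundedly
  many single points between them. If, in a projection from a single point \<open>q\<close>, the lines through
  two points of a cluster leave all other clusters on one side, then by the cups-caps theorem this
  cluster contributes a convex chain of linear length bulging away from the others (or already \<open>n\<close>
  points bulging towards them), and the chains of different clusters combine. As boundedly many
  clusters, independent of \<open>n\<close>, suffice, it remains to find enough clusters with such a \<open>q\<close>. For a pair
  of points in a cluster, \<open>q\<close> exists unless the direction of the pair lies in the cone spanned by the
  clusters under consideration; whether it does depends only on the signs of the pair with respect
  to two axes through single points, one joining the first point to the right neighbour and one
  joining the left neighbour to the last point. Each such sign is a total order on the cluster, so
  it can be made to agree with another one, or to disagree, on a large part of the cluster. Asking for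
  agreement with unbalanced sizes, either enough clusters succeed at once, or a whole group of
  clusters fails at almost no cost; iterating inside such groups leaves a chain of clusters which
  succeed for the opposite reason.

  The positive fraction version follows by counting: fixing the points that span the planes, the cut
  off points may vary independently within large sets.
\<close>

section \<open>Combinatorial tools\<close>

lemma totalp_on_extend_below:
  assumes "finite C" "C \<noteq> {}" "C \<subseteq> Z" "totalp_on C P" "transp_on Z P" "asymp_on Z P"
    and below: "\<And>c. c \<in> C \<Longrightarrow> \<exists>y\<in>Z. P y c"
  shows "\<exists>y\<in>Z - C. totalp_on (insert y C) P"
proof -
  have "transp_on C P" "asymp_on C P"
    using assms(3,5,6) by (auto intro: transp_on_subset asymp_on_subset)
  then obtain c where "c \<in> C" and min: "\<And>x. x \<in> C \<Longrightarrow> x \<noteq> c \<Longrightarrow> \<not> P x c"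
    using Finite_Set.bex_min_element[OF assms(1) _ _ assms(2)] by blast
  obtain y where "y \<in> Z" "P y c"
    using below \<open>c \<in> C\<close> by blast
  have "P y x" if "x \<in> C" for x
  proof (cases "x = c")
    case False
    then have "P c x"
      using min that \<open>c \<in> C\<close> assms(4) by (metis totalp_onD)
    then show ?thesis
      using \<open>P y c\<close> \<open>y \<in> Z\<close> \<open>c \<in> C\<close> that assms(3,5) by (meson subsetD transp_onD)
  qed (use \<open>P y c\<close> in simp)
  moreover have "y \<notin> C"
    using calculation \<open>y \<in> Z\<close> assms(6) by (metis asymp_onD)
  ultimately show ?thesis
    using \<open>y \<in> Z\<close> assms(4) by (intro bexI[of _ y]) (auto simp: totalp_on_def)
qed

lemma chain_or_antichain:
  assumes "finite Z" "s * t \<le> card Z" "transp_on Z P" "asymp_on Z P"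
  shows "(\<exists>C\<subseteq>Z. card C = s \<and> totalp_on C P) \<or> (\<exists>C\<subseteq>Z. card C = t \<and> (\<forall>x\<in>C. \<forall>y\<in>C. \<not> P x y))"
  using assms
proof (induction s arbitrary: Z)
  case 0
  then show ?case by (intro disjI1 exI[of _ "{}"]) auto
next
  case (Suc s)
  define A where "A = {z\<in>Z. \<forall>y\<in>Z. \<not> P y z}"
  show ?case
  proof (cases "t \<le> card A")
    case True
    then obtain C where "C \<subseteq> A" "card C = t"
      by (meson obtain_subset_with_card_n)
    then show ?thesis
      by (intro disjI2 exI[of _ C]) (auto simp: A_def)
  next
    case False
    have "s * t \<le> card (Z - A)"
      using Suc.prems(1,2) False by (subst card_Diff_subset) (auto simp: A_def)
    then consider (chain) C where "C \<subseteq> Z - A" "card C = s" "totalp_on C P"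
      | (antichain) "\<exists>C\<subseteq>Z. card C = t \<and> (\<forall>x\<in>C. \<forall>y\<in>C. \<not> P x y)"
      using Suc.IH[of "Z - A"] Suc.prems
      by (metis Diff_subset asymp_on_subset finite_Diff order_trans transp_on_subset)
    then show ?thesis
    proof cases
      case (chain C)
      show ?thesis
      proof (cases "C = {}")
        case True
        obtain z where "z \<in> Z"
          using False Suc.prems(2) by (cases "Z = {}") auto
        then show ?thesis
          using True chain(2) by (intro disjI1 exI[of _ "{z}"]) (auto simp: totalp_on_def)
      next
        case False
        have "finite C"
          using chain(1) Suc.prems(1) finite_subset by blast
        moreover obtain y where "y \<in> Z - C" "totalp_on (insert y C) P"
          using totalp_on_extend_below[OF \<open>finite C\<close> False _ chain(3) Suc.prems(3,4)] chain(1)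
          by (auto simp: A_def)
        ultimately show ?thesis
          using chain(1,2) by (intro disjI1 exI[of _ "insert y C"]) auto
      qed
    qed blast
  qed
qed

fun successive_triples :: "('a \<Rightarrow> 'a \<Rightarrow> 'a \<Rightarrow> bool) \<Rightarrow> 'a list \<Rightarrow> bool" where
  "successive_triples P (x # y # z # zs) \<longleftrightarrow> P x y z \<and> successive_triples P (y # z # zs)"
| "successive_triples P _ \<longleftrightarrow> True"

lemma successive_triples_snoc:
  "successive_triples P (xs @ [a, b, c]) \<longleftrightarrow> successive_triples P (xs @ [a, b]) \<and> P a b c"
proof (induction xs)
  case (Cons x xs)
  then show ?case
    by (cases xs; cases "tl xs") auto
qed simp

lemma successive_triples_imp_triples:
  assumes "successive_triples P xs" "sorted_wrt R xs"
    and trans: "\<And>a b c d. {a, b, c, d} \<subseteq> set xs \<Longrightarrow> R a b \<Longrightarrow> R b c \<Longrightarrow> R c d \<Longrightarrow> P a b c \<Longrightarrow> P b c d \<Longrightarrow>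
      P a b d \<and> P a c d"
    and "i < j" "j < k" "k < length xs"
  shows "P (xs ! i) (xs ! j) (xs ! k)"
  using assms
proof (induction xs arbitrary: i j k)
  case (Cons x xs)
  have "successive_triples P xs"
    using Cons.prems(1) by (cases xs; cases "tl xs") auto
  then have tail: "P (xs ! i) (xs ! j) (xs ! k)" if "i < j" "j < k" "k < length xs" for i j k
    using Cons.prems(2,3) that by (intro Cons.IH) auto
  have R: "R x (xs ! i)" "R (xs ! i) (xs ! j)" "xs ! i \<in> set xs" if "i < j" "j < length xs" for i j
    using Cons.prems(2) that by (auto simp: sorted_wrt_nth_less)
  have first: "P x (xs ! 0) (xs ! k)" if k: "0 < k" "k < length xs" for k
  proof (cases "k = 1")
    case True
    then show ?thesis
      using Cons.prems(1) k by (cases xs; cases "tl xs") auto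
  next
    case False
    have "P x (xs ! 0) (xs ! 1)"
      using Cons.prems(1) k False by (cases xs; cases "tl xs") auto
    moreover have "P (xs ! 0) (xs ! 1) (xs ! k)"
      using tail k False by simp
    ultimately show ?thesis
      using Cons.prems(3)[of x "xs ! 0" "xs ! 1" "xs ! k"] R[of 0 1] R[of 1 k] k False by simp
  qed
  have "P x (xs ! j) (xs ! k)" if jk: "j < k" "k < length xs" for j k
  proof (cases "j = 0")
    case False
    have "P x (xs ! 0) (xs ! j)" "P (xs ! 0) (xs ! j) (xs ! k)"
      using first tail jk False by auto
    then show ?thesis
      using Cons.prems(3)[of x "xs ! 0" "xs ! j" "xs ! k"] R[of 0 j] R[of j k] jk False by simp
  qed (use first jk in simp)
  then show ?case
    using tail Cons.prems(4-6) by (cases i; cases j; cases k) auto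
qed simp

definition triple_path :: "('a \<Rightarrow> 'a \<Rightarrow> bool) \<Rightarrow> ('a \<Rightarrow> 'a \<Rightarrow> 'a \<Rightarrow> bool) \<Rightarrow> 'a set \<Rightarrow> 'a list \<Rightarrow> bool" where
  "triple_path R P S xs \<longleftrightarrow> set xs \<subseteq> S \<and> successively R xs \<and> successive_triples P xs"

lemma triple_path_mono: "triple_path R P S xs \<Longrightarrow> S \<subseteq> T \<Longrightarrow> triple_path R P T xs"
  by (auto simp: triple_path_def)

lemma triple_path_extend:
  assumes xs: "triple_path R P S xs" "2 \<le> length xs" and ys: "triple_path R Q S ys" "2 \<le> length ys"
    and meet: "last xs = hd ys" and PQ: "\<And>a b c. P a b c \<or> Q a b c"
  shows "(\<exists>zs. triple_path R P S zs \<and> length zs = Suc (length xs)) \<or>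
         (\<exists>zs. triple_path R Q S zs \<and> length zs = Suc (length ys))"
proof -
  obtain xs' a b where xs': "xs = xs' @ [a, b]"
    using xs(2) by (cases xs rule: rev_cases; cases "butlast xs" rule: rev_cases) auto
  moreover obtain c ys' where ys': "ys = b # c # ys'"
    using ys(2) meet xs' by (cases ys; cases "tl ys") auto
  consider (first) "P a b c" | (second) "Q a b c"
    using PQ by blast
  then show ?thesis
  proof cases
    case first
    then have "triple_path R P S (xs' @ [a, b, c])"
      using xs(1) ys(1)
      by (simp add: triple_path_def xs' ys' successive_triples_snoc successively_append_iff)
    then show ?thesis
      by (intro disjI1 exI[of _ "xs' @ [a, b, c]"]) (simp add: xs')
  next
    case second
    then have "triple_path R Q S (a # ys)"
      using xs(1) ys(1) by (simp add: triple_path_def xs' ys' successively_append_iff)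
    then show ?thesis
      by (intro disjI2 exI[of _ "a # ys"]) simp
  qed
qed

lemma triple_path_2_exists:
  assumes "totalp_on S R" "2 \<le> card S"
  shows "\<exists>xs. triple_path R P S xs \<and> length xs = 2"
proof -
  obtain T where "T \<subseteq> S" "card T = 2"
    using assms(2) by (meson obtain_subset_with_card_n)
  then obtain x y where "x \<in> S" "y \<in> S" "x \<noteq> y"
    by (auto simp: card_2_iff)
  then obtain x y where "x \<in> S" "y \<in> S" "R x y"
    using assms(1) by (metis totalp_onD)
  then show ?thesis
    by (intro exI[of _ "[x, y]"]) (simp add: triple_path_def)
qed

text \<open>The argument of Erdos and Szekeres: in the induction step, either a short \<open>P\<close>-path avoids the
  set \<open>A\<close> of last points of such paths, or \<open>A\<close> contains the first point of a path of the other kind.\<close>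
lemma cups_caps:
  assumes "finite S" "totalp_on S R" "(k + l) choose k < card S"
  shows "(\<exists>xs. triple_path R P S xs \<and> length xs = k + 2) \<or>
         (\<exists>xs. triple_path R (\<lambda>a b c. \<not> P a b c) S xs \<and> length xs = l + 2)"
  using assms
proof (induction "k + l" arbitrary: k l S rule: less_induct)
  case less
  let ?Q = "\<lambda>a b c. \<not> P a b c"
  have IH: "(\<exists>xs. triple_path R P T xs \<and> length xs = k' + 2) \<or>
      (\<exists>xs. triple_path R ?Q T xs \<and> length xs = l' + 2)"
    if "k' + l' < k + l" "T \<subseteq> S" "(k' + l') choose k' < card T" for k' l' T
    using less.hyps[OF that(1) _ _ that(3)] less.prems(1,2) that(2)
    by (meson finite_subset totalp_on_subset)
  show ?case
  proof (cases "k = 0 \<or> l = 0")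
    case True
    moreover from True have "2 \<le> card S"
      using less.prems(3) by auto
    ultimately show ?thesis
      using triple_path_2_exists[OF less.prems(2)] by (auto simp: numeral_2_eq_2)
  next
    case False
    then obtain k' l' where kl: "k = Suc k'" "l = Suc l'"
      by (meson not0_implies_Suc)
    define A where "A = last ` {xs. triple_path R P S xs \<and> length xs = k' + 2}"
    have last: "last xs \<in> T" if "triple_path R P T xs" "length xs = k' + 2" for T xs
      using that by (cases xs rule: rev_cases) (auto simp: triple_path_def)
    then have "A \<subseteq> S"
      by (auto simp: A_def)
    then have "card S = card (S - A) + card A"
      using less.prems(1) by (metis card_Diff_subset card_mono finite_subset le_add_diff_inverse2)
    moreover have "(k + l) choose k = (k' + l choose k') + (k + l' choose k)"
      using kl by simp
    ultimately consider (avoiding) "(k' + l) choose k' < card (S - A)"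
      | (within) "(k + l') choose k < card A"
      using less.prems(3) by linarith
    then show ?thesis
    proof cases
      case avoiding
      have "\<not> (triple_path R P (S - A) xs \<and> length xs = k' + 2)" for xs
        using last[of "S - A" xs] triple_path_mono[of R P "S - A" xs S] unfolding A_def by blast
      then show ?thesis
        using IH[of k' l "S - A"] avoiding kl triple_path_mono[of R ?Q "S - A" _ S] by auto
    next
      case within
      then consider (long) xs where "triple_path R P A xs" "length xs = k + 2"
        | (short) ys where "triple_path R ?Q A ys" "length ys = l' + 2"
        using IH[of k l' A] kl \<open>A \<subseteq> S\<close> by auto
      then show ?thesis
      proof cases
        case (short ys)
        then have "hd ys \<in> A"
          by (cases ys) (auto simp: triple_path_def)
        then obtain xs where "triple_path R P S xs" "length xs = k' + 2" "last xs = hd ys"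
          by (auto simp: A_def)
        then show ?thesis
          using triple_path_extend[of R P S xs ?Q ys] triple_path_mono[OF short(1) \<open>A \<subseteq> S\<close>] short(2) kl
          by simp
      qed (use triple_path_mono \<open>A \<subseteq> S\<close> in blast)
    qed
  qed
qed

lemma disjoint_parts_exist:
  assumes "finite X" "R * s \<le> card X"
  obtains A where "\<And>i. i < R \<Longrightarrow> A i \<subseteq> X \<and> card (A i) = s" "disjoint_family_on A {..<R}"
proof -
  obtain h where h: "bij_betw h {0..<card X} X"
    using ex_bij_betw_nat_finite assms(1) by blast
  let ?J = "\<lambda>i. {i * s..<Suc i * s}" and ?A = "\<lambda>i. h ` {i * s..<Suc i * s}"
  have J: "?J i \<subseteq> {0..<card X}" if "i < R" for i
    using mult_le_mono1[of "Suc i" R s] that assms(2) by auto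
  then have inj: "inj_on h (\<Union>i\<in>{..<R}. ?J i)"
    using h unfolding bij_betw_def by (meson UN_least inj_on_subset lessThan_iff)
  have "?A i \<subseteq> X \<and> card (?A i) = s" if "i < R" for i
  proof
    show "?A i \<subseteq> X"
      using image_mono[OF J[OF that], of h] h unfolding bij_betw_def by blast
    have "inj_on h (?J i)"
      using inj that by (meson UN_upper inj_on_subset lessThan_iff)
    then show "card (?A i) = s"
      by (simp add: card_image)
  qed
  moreover have "x div s = i" if "x \<in> ?J i" for i x
    using that by (intro div_nat_eqI) (auto simp: mult.commute)
  then have disj: "disjoint_family_on ?J {..<R}"
    unfolding disjoint_family_on_def by blast
  have "?A i \<inter> ?A j = {}" if "i < R" "j < R" "i \<noteq> j" for i j
  proof -
    have "?J i \<inter> ?J j = {}"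
      using disj that by (simp add: disjoint_family_on_def)
    moreover have "?A i \<inter> ?A j = h ` (?J i \<inter> ?J j)"
      by (rule inj_on_image_Int[OF inj, symmetric]) (use that in blast)+
    ultimately show ?thesis
      by (simp only: image_empty)
  qed
  then have "disjoint_family_on ?A {..<R}"
    by (simp add: disjoint_family_on_def)
  ultimately show ?thesis by (rule that)
qed

lemma card_le_prod_coordinates:
  fixes F :: "('i \<Rightarrow> 'a) set"
  assumes "finite V" "\<And>v. v \<in> V \<Longrightarrow> finite (B v)"
    and coordinates: "\<And>f v. f \<in> F \<Longrightarrow> v \<in> V \<Longrightarrow> f v \<in> B v"
    and determined: "\<And>f g. f \<in> F \<Longrightarrow> g \<in> F \<Longrightarrow> (\<And>v. v \<in> V \<Longrightarrow> f v = g v) \<Longrightarrow> f = g"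
  shows "card F \<le> (\<Prod>v\<in>V. card (B v))"
proof -
  have "card F \<le> card (PiE V B)"
  proof (rule card_inj_on_le[where f = "\<lambda>f. restrict f V"])
    show "inj_on (\<lambda>f. restrict f V) F"
    proof (intro inj_onI determined)
      show "f v = g v" if "restrict f V = restrict g V" "v \<in> V" for f g :: "'i \<Rightarrow> 'a" and v
        using that by (metis restrict_apply')
    qed
    show "(\<lambda>f. restrict f V) ` F \<subseteq> PiE V B"
      using coordinates by auto
    show "finite (PiE V B)"
      using assms(1,2) by (intro finite_PiE) auto
  qed
  then show ?thesis
    using assms(1) by (simp add: card_PiE)
qed

lemma fix_coordinates:
  fixes A :: "'i \<Rightarrow> 'a set"
  assumes "finite I" "\<And>i. i \<in> I \<Longrightarrow> finite (A i)" "V \<subseteq> I" "F \<subseteq> PiE I A" "F \<noteq> {}"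
  shows "\<exists>g\<in>PiE (I - V) A. card F \<le> (\<Prod>i\<in>I - V. card (A i)) *
    (\<Prod>v\<in>V. card {f v |f. f \<in> F \<and> (\<forall>i\<in>I - V. f i = g i)})"
proof -
  let ?r = "\<lambda>f. restrict f (I - V)"
  have r: "?r \<in> F \<rightarrow> PiE (I - V) A"
    by (rule Pi_I, drule subsetD[OF assms(4)]) auto
  moreover have "finite F"
    using assms(1,2,4) by (meson finite_PiE finite_subset)
  moreover have "finite (PiE (I - V) A)"
    using assms(1,2) by (intro finite_PiE) auto
  moreover have "PiE (I - V) A \<noteq> {}"
    using r assms(5) by blast
  ultimately obtain g where g: "g \<in> PiE (I - V) A"
    "card F \<le> card (?r -` {g} \<inter> F) * card (PiE (I - V) A)"
    using pigeonhole_card[of ?r F "PiE (I - V) A"] by blast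
  define B where "B v = {f v |f. f \<in> F \<and> (\<forall>i\<in>I - V. f i = g i)}" for v
  have eq_g: "f i = g i" if "f \<in> ?r -` {g} \<inter> F" "i \<in> I - V" for f i
    using that by (metis IntD1 restrict_apply' vimage_singleton_eq)
  have "card (?r -` {g} \<inter> F) \<le> (\<Prod>v\<in>V. card (B v))"
  proof (rule card_le_prod_coordinates)
    show "finite V"
      using assms(1,3) finite_subset by blast
    show "finite (B v)" if "v \<in> V" for v
    proof (rule finite_subset)
      show "B v \<subseteq> A v"
        using that assms(3,4) unfolding B_def by blast
    qed (use that assms(2,3) in blast)
    show "f v \<in> B v" if "f \<in> ?r -` {g} \<inter> F" for f v
      using eq_g[OF that] that unfolding B_def by blast
    show "f = f'" if ff: "f \<in> ?r -` {g} \<inter> F" "f' \<in> ?r -` {g} \<inter> F" "\<And>v. v \<in> V \<Longrightarrow> f v = f' v" for f f'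
    proof (rule PiE_ext)
      show "f \<in> PiE I A" "f' \<in> PiE I A"
        using ff(1,2) assms(4) by auto
      show "f i = f' i" if "i \<in> I" for i
        using that eq_g[OF ff(1)] eq_g[OF ff(2)] ff(3) by (metis DiffI)
    qed
  qed
  then have "card F \<le> (\<Prod>v\<in>V. card (B v)) * card (PiE (I - V) A)"
    using g(2) by (meson le_trans mult_le_mono1)
  then show ?thesis
    using g(1) assms(1) unfolding B_def by (intro bexI[of _ g]) (auto simp: card_PiE mult.commute)
qed

lemma disjoint_family_inj_on_PiE:
  assumes "disjoint_family_on A I" "f \<in> PiE I A"
  shows "inj_on f I"
proof (rule inj_onI, rule ccontr)
  fix i j assume "i \<in> I" "j \<in> I" "f i = f j" "i \<noteq> j"
  moreover from this have "f i \<in> A i \<inter> A j"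
    using assms(2) by (metis IntI PiE_mem)
  ultimately show False
    using assms(1) by (auto simp: disjoint_family_on_def)
qed

lemma popular_type:
  assumes "finite \<Omega>" "\<Omega> \<noteq> {}" "finite T" "\<And>f. f \<in> \<Omega> \<Longrightarrow> \<exists>t\<in>T. P t f"
  obtains t F where "t \<in> T" "F \<subseteq> \<Omega>" "F \<noteq> {}" "\<And>f. f \<in> F \<Longrightarrow> P t f" "card \<Omega> \<le> card F * card T"
proof -
  obtain \<tau> where \<tau>: "\<And>f. f \<in> \<Omega> \<Longrightarrow> \<tau> f \<in> T \<and> P (\<tau> f) f"
    using assms(4) by metis
  then have "T \<noteq> {}" "\<tau> \<in> \<Omega> \<rightarrow> T"
    using assms(2) by auto
  then obtain t where t: "t \<in> T" "card \<Omega> \<le> card (\<tau> -` {t} \<inter> \<Omega>) * card T"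
    using pigeonhole_card assms(1,3) by metis
  moreover have "\<tau> -` {t} \<inter> \<Omega> \<noteq> {}"
    using t(2) assms(1,2) by (metis card.empty card_gt_0_iff mult_0 not_less)
  moreover have "P t f" if "f \<in> \<tau> -` {t} \<inter> \<Omega>" for f
    using \<tau>[of f] that by auto
  ultimately show ?thesis
    by (intro that[of t "\<tau> -` {t} \<inter> \<Omega>"]) auto
qed

text \<open>The counting argument behind positive fraction theorems: every injective choice of points has
  one of boundedly many types, so for some type \<open>t\<close> the points with index in \<open>V t\<close> vary
  independently in large sets while all other points stay fixed.\<close>
lemma positive_fraction_selection:
  fixes X :: "'a set" and V :: "'t \<Rightarrow> nat set"
  assumes X: "finite X" "R * s \<le> card X" "0 < s" and T: "finite T"
    and type: "\<And>f. inj_on f {..<R} \<Longrightarrow> f ` {..<R} \<subseteq> X \<Longrightarrow> \<exists>t\<in>T. P t f"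
    and V: "\<And>t. t \<in> T \<Longrightarrow> V t \<subseteq> {..<R} \<and> card (V t) = m"
  obtains t g B where "t \<in> T" "g ` ({..<R} - V t) \<subseteq> X"
    "\<forall>v\<in>V t. B v \<subseteq> X \<and> card (B v) \<le> s"
    "\<forall>v\<in>V t. \<forall>x\<in>B v. \<exists>f. P t f \<and> f v = x \<and> (\<forall>i\<in>{..<R} - V t. f i = g i)"
    "s ^ m \<le> card T * (\<Prod>v\<in>V t. card (B v))"
proof -
  let ?I = "{..<R}"
  obtain A where A: "\<And>i. i < R \<Longrightarrow> A i \<subseteq> X \<and> card (A i) = s" and disj: "disjoint_family_on A ?I"
    using disjoint_parts_exist[OF X(1,2)] by blast
  have finA: "finite (A i)" if "i < R" for i
    using A that X(1) finite_subset by blast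
  have fin: "finite (PiE ?I A)" and card: "card (PiE ?I A) = s ^ R"
    using A finA by (auto simp: card_PiE intro!: finite_PiE)
  moreover have "PiE ?I A \<noteq> {}"
    using card X(3) by (metis card.empty less_irrefl zero_less_power)
  moreover have "\<exists>t\<in>T. P t f" if "f \<in> PiE ?I A" for f
    using that A by (intro type disjoint_family_inj_on_PiE[OF disj that]) blast
  ultimately obtain t F where t: "t \<in> T" and F: "F \<subseteq> PiE ?I A" "F \<noteq> {}" "\<And>f. f \<in> F \<Longrightarrow> P t f"
    "s ^ R \<le> card F * card T"
    using popular_type[OF _ _ T, of "PiE ?I A" P] by metis
  have VR: "V t \<subseteq> ?I" "card (V t) = m" "finite (V t)" "m \<le> R"
    using V[OF t] finite_subset card_mono[of ?I "V t"] by auto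
  obtain g where g: "g \<in> PiE (?I - V t) A"
    "card F \<le> (\<Prod>i\<in>?I - V t. card (A i)) * (\<Prod>v\<in>V t. card {f v |f. f \<in> F \<and> (\<forall>i\<in>?I - V t. f i = g i)})"
    using fix_coordinates[OF _ _ VR(1) F(1,2)] finA by auto
  define B where "B v = {f v |f. f \<in> F \<and> (\<forall>i\<in>?I - V t. f i = g i)}" for v
  have "B v \<subseteq> A v" if "v \<in> V t" for v
    using that F(1) VR(1) unfolding B_def by blast
  then have "\<forall>v\<in>V t. B v \<subseteq> X \<and> card (B v) \<le> s"
    using A finA VR(1) by (metis card_mono lessThan_iff order_trans subsetD)
  moreover have "g ` (?I - V t) \<subseteq> X"
    using g(1) A by (fastforce simp: PiE_iff)
  moreover have "\<forall>v\<in>V t. \<forall>x\<in>B v. \<exists>f. P t f \<and> f v = x \<and> (\<forall>i\<in>?I - V t. f i = g i)"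
    using F(3) by (auto simp: B_def)
  moreover have "s ^ m \<le> card T * (\<Prod>v\<in>V t. card (B v))"
  proof -
    have "s ^ (R - m) * s ^ m \<le> card F * card T"
      using F(4) VR(4) by (simp flip: power_add)
    also have "card F \<le> s ^ (R - m) * (\<Prod>v\<in>V t. card (B v))"
      using g(2) A VR unfolding B_def[symmetric] by (simp add: card_Diff_subset)
    finally have "s ^ (R - m) * s ^ m \<le> s ^ (R - m) * (card T * (\<Prod>v\<in>V t. card (B v)))"
      by (simp add: mult_ac)
    then show ?thesis
      using X(3) by simp
  qed
  ultimately show ?thesis
    using that t by blast
qed

lemma each_factor_large:
  fixes b :: "'i \<Rightarrow> nat"
  assumes "finite I" "\<And>i. i \<in> I \<Longrightarrow> b i \<le> s" "0 < s" "i \<in> I"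
    and prod: "s ^ card I \<le> D * (\<Prod>i\<in>I. b i)"
  shows "s \<le> D * b i"
proof -
  have "(\<Prod>i\<in>I. b i) = b i * (\<Prod>j\<in>I - {i}. b j)"
    using assms(1,4) by (simp add: prod.remove)
  also have "\<dots> \<le> b i * (\<Prod>j\<in>I - {i}. s)"
    using assms(2) by (intro mult_le_mono2 prod_mono) auto
  finally have "(\<Prod>i\<in>I. b i) \<le> b i * s ^ (card I - 1)"
    using assms(1,4) by simp
  then have "s ^ card I \<le> D * (b i * s ^ (card I - 1))"
    using prod by (meson le_trans mult_le_mono2)
  moreover have "s ^ card I = s * s ^ (card I - 1)"
    using assms(1,4) by (metis card_gt_0_iff empty_iff power_minus_mult mult.commute)
  ultimately have "s * s ^ (card I - 1) \<le> D * b i * s ^ (card I - 1)"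
    by (simp add: mult.assoc)
  then show ?thesis
    using assms(3) by simp
qed

lemma half_of_factors_large:
  fixes b :: "'i \<Rightarrow> nat"
  assumes "finite I" "\<And>i. i \<in> I \<Longrightarrow> b i \<le> s" "0 < s" "0 < D"
    and prod: "s ^ card I \<le> D ^ card I * (\<Prod>i\<in>I. b i)"
  shows "card I \<le> 2 * card {i \<in> I. s \<le> D\<^sup>2 * b i}"
proof (rule ccontr)
  let ?G = "{i \<in> I. s \<le> D\<^sup>2 * b i}" and ?N = "{i \<in> I. D\<^sup>2 * b i < s}"
  assume few: "\<not> card I \<le> 2 * card ?G"
  have I: "I = ?N \<union> ?G" "?N \<inter> ?G = {}"
    by auto
  have fin: "finite ?N" "finite ?G"
    using assms(1) by auto
  have card: "card I = card ?N + card ?G"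
    using I fin card_Un_disjoint by metis
  then obtain i where "i \<in> ?N"
    using few by (cases "?N = {}") auto
  have "D ^ card I \<le> D ^ (2 * card ?N)"
    using card few assms(4) by (intro power_increasing) auto
  then have "s ^ card I \<le> D ^ (2 * card ?N) * (\<Prod>i\<in>I. b i)"
    using prod by (meson le_trans mult_le_mono1)
  also have "(\<Prod>i\<in>I. b i) = (\<Prod>i\<in>?N. b i) * (\<Prod>i\<in>?G. b i)"
    using prod.union_disjoint[OF fin I(2), of b] I(1) by simp
  also have "D ^ (2 * card ?N) * ((\<Prod>i\<in>?N. b i) * (\<Prod>i\<in>?G. b i)) =
      (\<Prod>i\<in>?N. D\<^sup>2 * b i) * (\<Prod>i\<in>?G. b i)"
    by (simp add: prod.distrib power_mult)
  also have "\<dots> \<le> (\<Prod>i\<in>?N. D\<^sup>2 * b i) * s ^ card ?G"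
    using assms(2) by (intro mult_le_mono2 order_trans[OF prod_mono[of _ b "\<lambda>_. s"]]) auto
  also have "(\<Prod>i\<in>?N. D\<^sup>2 * b i) < (\<Prod>i\<in>?N. s)"
    using \<open>i \<in> ?N\<close> assms(3) fin(1) by (intro prod_mono_strict[of i]) auto
  finally show False
    using assms(3) card by (simp add: power_add)
qed

definition on_sorted_quadruples :: "nat set \<Rightarrow> (nat \<Rightarrow> nat \<Rightarrow> nat \<Rightarrow> nat \<Rightarrow> bool) \<Rightarrow> bool" where
  "on_sorted_quadruples H P \<longleftrightarrow>
     (\<forall>a\<in>H. \<forall>b\<in>H. \<forall>c\<in>H. \<forall>d\<in>H. a < b \<longrightarrow> b < c \<longrightarrow> c < d \<longrightarrow> P a b c d)"

lemma ramsey_sorted_quadruples: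
  "\<exists>R. \<forall>P :: nat \<Rightarrow> nat \<Rightarrow> nat \<Rightarrow> nat \<Rightarrow> bool. \<exists>H \<sigma>. H \<subseteq> {..<R} \<and> card H = L \<and>
     on_sorted_quadruples H (\<lambda>a b c d. P a b c d = \<sigma>)"
proof -
  obtain R :: nat where R: "partn_lst {..<R} [L, L] 4"
    using ramsey_full by blast
  have "\<exists>H \<sigma>. H \<subseteq> {..<R} \<and> card H = L \<and> on_sorted_quadruples H (\<lambda>a b c d. P a b c d = \<sigma>)"
    for P :: "nat \<Rightarrow> nat \<Rightarrow> nat \<Rightarrow> nat \<Rightarrow> bool"
  proof -
    define colour where "colour S =
      (let l = sorted_list_of_set S in if P (l ! 0) (l ! 1) (l ! 2) (l ! 3) then 0 else 1 :: nat)" for S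
    have "colour \<in> nsets {..<R} 4 \<rightarrow> {..<length [L, L]}"
      by (auto simp: colour_def Let_def)
    then obtain i H where H: "i < length [L, L]" "H \<in> nsets {..<R} ([L, L] ! i)"
      "colour ` nsets H 4 \<subseteq> {i}"
      using partn_lstE[OF R] by metis
    have "P a b c d = (i = 0)" if "{a, b, c, d} \<subseteq> H" "a < b" "b < c" "c < d" for a b c d
    proof -
      have "sorted_list_of_set (set [a, b, c, d]) = [a, b, c, d]"
        using that by (intro sorted_list_of_set.idem_if_sorted_distinct) auto
      then have "colour {a, b, c, d} = (if P a b c d then 0 else 1)"
        by (simp add: colour_def)
      moreover have "{a, b, c, d} \<in> nsets H 4"
        using that by (auto simp: nsets_def)
      ultimately show ?thesis
        using H(3) by (auto split: if_splits)
    qed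
    then show ?thesis
      using H(1,2) unfolding on_sorted_quadruples_def
      by (intro exI[of _ H] exI[of _ "i = 0"]) (auto simp: nsets_def less_Suc_eq)
  qed
  then show ?thesis by blast
qed

definition separated_by :: "(nat \<Rightarrow> nat \<Rightarrow> bool) \<Rightarrow> nat \<Rightarrow> nat set \<Rightarrow> bool" where
  "separated_by Q K F \<longleftrightarrow> (\<forall>j\<in>F. \<exists>b>j. b \<le> K \<and> (\<forall>i\<in>F. j < i \<longrightarrow> b \<le> i) \<and> Q j b)"

lemma separated_by_mono: "separated_by Q K F \<Longrightarrow> K \<le> K' \<Longrightarrow> separated_by Q K' F"
  unfolding separated_by_def by (meson order_trans)

lemma separated_by_insert:
  assumes "separated_by Q K F" "Q j b" "j < b" "b \<le> K" "\<And>i. i \<in> F \<Longrightarrow> b \<le> i"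
  shows "separated_by Q K (insert j F)"
  unfolding separated_by_def
proof
  fix x assume "x \<in> insert j F"
  then consider (new) "x = j" | (old) "x \<in> F" "j < x"
    using assms(3,5) by force
  then show "\<exists>b>x. b \<le> K \<and> (\<forall>i\<in>insert j F. x < i \<longrightarrow> b \<le> i) \<and> Q x b"
  proof cases
    case new
    then show ?thesis
      using assms(2-5) by (intro exI[of _ b]) auto
  next
    case old
    then obtain b' where "x < b'" "b' \<le> K" "\<forall>i\<in>F. x < i \<longrightarrow> b' \<le> i" "Q x b'"
      using assms(1) unfolding separated_by_def by blast
    then show ?thesis
      using old(2) by (intro exI[of _ b']) auto
  qed
qed

text \<open>Among \<open>k\<close> consecutive blocks of length \<open>c\<close>, either each block contributes an element or
  some block contributes none.\<close>
lemma separated_set_or_block: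
  "(\<exists>F\<subseteq>{\<alpha>..<\<alpha> + k * c}. card F = k \<and> separated_by Q (\<alpha> + k * c) F) \<or>
   (\<exists>\<beta>\<ge>\<alpha>. \<beta> + c \<le> \<alpha> + k * c \<and> (\<forall>j\<in>{\<beta>..<\<beta> + c}. \<not> Q j (\<beta> + c)))"
proof (induction k arbitrary: \<alpha>)
  case 0
  show ?case
    by (intro disjI1 exI[of _ "{}"]) (auto simp: separated_by_def)
next
  case (Suc k)
  show ?case
  proof (cases "\<exists>j\<in>{\<alpha>..<\<alpha> + c}. Q j (\<alpha> + c)")
    case False
    then show ?thesis
      by (intro disjI2 exI[of _ \<alpha>]) auto
  next
    case True
    then obtain j where j: "j \<in> {\<alpha>..<\<alpha> + c}" "Q j (\<alpha> + c)" by blast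
    have "\<alpha> + c + k * c = \<alpha> + Suc k * c"
      by simp
    then consider (set) F where "F \<subseteq> {\<alpha> + c..<\<alpha> + Suc k * c}" "card F = k"
        "separated_by Q (\<alpha> + Suc k * c) F"
      | (block) \<beta> where "\<alpha> + c \<le> \<beta>" "\<beta> + c \<le> \<alpha> + Suc k * c"
        "\<forall>j\<in>{\<beta>..<\<beta> + c}. \<not> Q j (\<beta> + c)"
      using Suc.IH[of "\<alpha> + c"] by metis
    then show ?thesis
    proof cases
      case set
      have "finite F"
        using set(1) finite_subset by blast
      moreover have "j \<notin> F"
        using set(1) j(1) by auto
      ultimately have "card (insert j F) = Suc k"
        using set(2) by simp
      moreover have "insert j F \<subseteq> {\<alpha>..<\<alpha> + Suc k * c}"
        using set(1) j(1) by auto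
      moreover have "separated_by Q (\<alpha> + Suc k * c) (insert j F)"
        using set(1) j by (intro separated_by_insert[OF set(3), of j "\<alpha> + c"]) auto
      ultimately show ?thesis by blast
    qed (meson add_leD1)
  qed
qed

definition nested_by :: "(nat \<Rightarrow> nat \<Rightarrow> nat \<Rightarrow> bool) \<Rightarrow> nat \<Rightarrow> nat \<Rightarrow> nat set \<Rightarrow> bool" where
  "nested_by Q \<alpha> K F \<longleftrightarrow>
     (\<forall>j\<in>F. \<exists>u b. \<alpha> < u \<and> u \<le> j \<and> b \<le> K \<and> (\<forall>i\<in>F. i < b \<and> (i < j \<longrightarrow> i < u)) \<and> Q j u b)"

lemma nested_by_extend:
  assumes "nested_by Q' \<beta> K F" "F \<subseteq> {\<beta><..<b}" "\<beta> < b" "b \<le> K" "b \<le> b'" "\<alpha> < \<beta>" "Q \<beta> (Suc \<alpha>) b"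
    and Q: "\<And>j u b. j \<in> F \<Longrightarrow> Q' j u b \<Longrightarrow> Q j u b"
  shows "\<exists>F'\<subseteq>{\<alpha><..<b'}. card F' = Suc (card F) \<and> nested_by Q \<alpha> K F'"
proof (intro exI conjI)
  have "finite F" "\<beta> \<notin> F"
    using assms(2) finite_subset by (blast, auto)
  then show "card (insert \<beta> F) = Suc (card F)"
    by simp
  show "insert \<beta> F \<subseteq> {\<alpha><..<b'}"
    using assms(2,3,5,6) by auto
  show "nested_by Q \<alpha> K (insert \<beta> F)"
    unfolding nested_by_def
  proof
    fix j assume "j \<in> insert \<beta> F"
    then consider (new) "j = \<beta>" | (old) "j \<in> F" by blast
    then show "\<exists>u b. \<alpha> < u \<and> u \<le> j \<and> b \<le> K \<and> (\<forall>i\<in>insert \<beta> F. i < b \<and> (i < j \<longrightarrow> i < u)) \<and> Q j u b"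
    proof cases
      case new
      have "\<forall>i\<in>insert \<beta> F. i < b \<and> (i < j \<longrightarrow> i < Suc \<alpha>)"
        using new assms(2,3) by auto
      then show ?thesis
        using new assms(4,6,7) by (intro exI[of _ "Suc \<alpha>"] exI[of _ b]) auto
    next
      case old
      then obtain u b' where u: "\<beta> < u" "u \<le> j" and b': "b' \<le> K"
        and F: "\<forall>i\<in>F. i < b' \<and> (i < j \<longrightarrow> i < u)" and "Q' j u b'"
        using assms(1) unfolding nested_by_def by blast
      have "\<beta> < b'"
        using u F old by fastforce
      moreover have "\<alpha> < u"
        using u(1) assms(6) by simp
      ultimately show ?thesis
        using u b' F Q[OF old \<open>Q' j u b'\<close>] by blast
    qed
  qed
qed

fun stage_size :: "nat \<Rightarrow> nat \<Rightarrow> nat" where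
  "stage_size k 0 = 1"
| "stage_size k (Suc s) = Suc (k * stage_size k s)"

lemma query_round:
  fixes plus minus :: "nat \<Rightarrow> nat \<Rightarrow> nat \<Rightarrow> 'p set \<Rightarrow> bool"
  assumes split: "\<And>j b. \<alpha> \<le> j \<Longrightarrow> j < b \<Longrightarrow> b \<le> \<alpha> + k * l \<Longrightarrow>
      (\<exists>W\<subseteq>Z j. card W = c \<and> minus j \<alpha> b W) \<or> (\<exists>W\<subseteq>Z j. card W = t \<and> plus j \<alpha> b W)"
    and sub: "\<And>j. j \<in> {\<alpha>..<\<alpha> + k * l} \<Longrightarrow> Z j \<subseteq> Z0 j"
  obtains (minus) F where "F \<subseteq> {\<alpha>..<\<alpha> + k * l}" "card F = k"
      "separated_by (\<lambda>j b. \<exists>W\<subseteq>Z0 j. card W = c \<and> minus j \<alpha> b W) (\<alpha> + k * l) F"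
    | (plus) \<beta> Z' where "\<alpha> \<le> \<beta>" "\<beta> + l \<le> \<alpha> + k * l"
      "\<forall>j\<in>{\<beta>..<\<beta> + l}. Z' j \<subseteq> Z j \<and> card (Z' j) = t \<and> plus j \<alpha> (\<beta> + l) (Z' j)"
proof -
  let ?Q = "\<lambda>j b. \<exists>W\<subseteq>Z0 j. card W = c \<and> minus j \<alpha> b W"
  consider (set) F where "F \<subseteq> {\<alpha>..<\<alpha> + k * l}" "card F = k" "separated_by ?Q (\<alpha> + k * l) F"
    | (block) \<beta> where "\<alpha> \<le> \<beta>" "\<beta> + l \<le> \<alpha> + k * l"
      "\<And>j. j \<in> {\<beta>..<\<beta> + l} \<Longrightarrow> \<not> ?Q j (\<beta> + l)"
    using separated_set_or_block[of \<alpha> k l ?Q] by blast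
  then show ?thesis
  proof cases
    case set
    then show ?thesis by (rule minus)
  next
    case block
    have "\<exists>W. W \<subseteq> Z j \<and> card W = t \<and> plus j \<alpha> (\<beta> + l) W" if "j \<in> {\<beta>..<\<beta> + l}" for j
    proof -
      have "\<alpha> \<le> j" "j < \<beta> + l" "j \<in> {\<alpha>..<\<alpha> + k * l}"
        using block(1,2) that by auto
      then show ?thesis
        using split[of j "\<beta> + l"] block(2) block(3)[OF that] sub[of j] by blast
    qed
    then obtain Z' where "\<forall>j\<in>{\<beta>..<\<beta> + l}. Z' j \<subseteq> Z j \<and> card (Z' j) = t \<and> plus j \<alpha> (\<beta> + l) (Z' j)"
      by metis
    then show ?thesis
      by (rule plus[OF block(1,2)])
  qed
qed

text \<open>A query splits a cluster into a small part answering \<open>minus\<close> or a large part answering \<open>plus\<close>,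
  so that a cluster survives \<open>s\<close> answers \<open>plus\<close> at the cost of a factor \<open>c ^ s\<close> only.\<close>
lemma query_game:
  fixes plus minus :: "nat \<Rightarrow> nat \<Rightarrow> nat \<Rightarrow> 'p set \<Rightarrow> bool"
  assumes "0 < c"
    and split: "\<And>j a b Z t. a \<le> j \<Longrightarrow> j < b \<Longrightarrow> b \<le> K \<Longrightarrow> Z \<subseteq> Z0 j \<Longrightarrow> c * t \<le> card Z \<Longrightarrow>
      (\<exists>Z'\<subseteq>Z. card Z' = c \<and> minus j a b Z') \<or> (\<exists>Z'\<subseteq>Z. card Z' = t \<and> plus j a b Z')"
    and "\<alpha> + stage_size k s \<le> K"
    and "\<And>j. j \<in> {\<alpha>..<\<alpha> + stage_size k s} \<Longrightarrow> Z j \<subseteq> Z0 j \<and> c ^ s * e \<le> card (Z j)"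
  shows "(\<exists>a F. F \<subseteq> {a..<K} \<and> card F = k \<and>
      separated_by (\<lambda>j b. \<exists>W\<subseteq>Z0 j. card W = c \<and> minus j a b W) K F) \<or>
    (\<exists>F\<subseteq>{\<alpha><..<\<alpha> + stage_size k s}. card F = s \<and>
      nested_by (\<lambda>j u b. \<exists>W\<subseteq>Z j. e \<le> card W \<and> plus j u b W) \<alpha> K F)" (is "?minus_family \<or> _")
  using assms(3,4)
proof (induction s arbitrary: \<alpha> Z)
  case 0
  show ?case
    by (intro disjI2 exI[of _ "{}"]) (auto simp: nested_by_def)
next
  case (Suc s)
  let ?Q = "\<lambda>j b. \<exists>W\<subseteq>Z0 j. card W = c \<and> minus j (Suc \<alpha>) b W"
  have bound: "Suc \<alpha> + k * stage_size k s = \<alpha> + stage_size k (Suc s)"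
    by simp
  have Z: "Z j \<subseteq> Z0 j" "c * (c ^ s * e) \<le> card (Z j)"
    if "j \<in> {Suc \<alpha>..<\<alpha> + stage_size k (Suc s)}" for j
    using Suc.prems(2)[of j] that by (auto simp: mult.assoc)
  have "(\<exists>W\<subseteq>Z j. card W = c \<and> minus j (Suc \<alpha>) b W) \<or> (\<exists>W\<subseteq>Z j. card W = c ^ s * e \<and> plus j (Suc \<alpha>) b W)"
    if "Suc \<alpha> \<le> j" "j < b" "b \<le> \<alpha> + stage_size k (Suc s)" for j b
    using that Z[of j] Suc.prems(1) by (intro split) auto
  then consider (minus) F where "F \<subseteq> {Suc \<alpha>..<\<alpha> + stage_size k (Suc s)}" "card F = k"
      "separated_by ?Q (\<alpha> + stage_size k (Suc s)) F"
    | (plus) \<beta> Z' where "Suc \<alpha> \<le> \<beta>" "\<beta> + stage_size k s \<le> \<alpha> + stage_size k (Suc s)"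
      "\<forall>j\<in>{\<beta>..<\<beta> + stage_size k s}.
        Z' j \<subseteq> Z j \<and> card (Z' j) = c ^ s * e \<and> plus j (Suc \<alpha>) (\<beta> + stage_size k s) (Z' j)"
    by (rule query_round[of "Suc \<alpha>" k "stage_size k s" Z c minus "c ^ s * e" plus Z0, unfolded bound])
      (assumption | rule Z that)+
  then show ?case
  proof cases
    case minus
    then have "F \<subseteq> {Suc \<alpha>..<K}" "separated_by ?Q K F"
      using Suc.prems(1) separated_by_mono by auto
    then have ?minus_family
      using minus(2) by blast
    then show ?thesis by (rule disjI1)
  next
    case plus
    let ?B = "{\<beta>..<\<beta> + stage_size k s}" and ?b = "\<beta> + stage_size k s"
    have "?b \<le> K"
      using plus(2) Suc.prems(1) by simp
    moreover have "Z' j \<subseteq> Z0 j \<and> c ^ s * e \<le> card (Z' j)" if "j \<in> ?B" for j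
      using bspec[OF plus(3) that] Z(1)[of j] plus(1,2) that by auto
    ultimately consider (minus_family) ?minus_family
      | (plus_family) F where "F \<subseteq> {\<beta><..<?b}" "card F = s"
        "nested_by (\<lambda>j u b. \<exists>W\<subseteq>Z' j. e \<le> card W \<and> plus j u b W) \<beta> K F"
      using Suc.IH[of \<beta> Z'] by blast
    then show ?thesis
    proof cases
      case plus_family
      have \<beta>: "\<beta> \<in> ?B"
        by (cases s) auto
      have "\<exists>F'\<subseteq>{\<alpha><..<\<alpha> + stage_size k (Suc s)}. card F' = Suc (card F) \<and>
          nested_by (\<lambda>j u b. \<exists>W\<subseteq>Z j. e \<le> card W \<and> plus j u b W) \<alpha> K F'"
      proof (rule nested_by_extend[OF plus_family(3,1)])
        show "\<exists>W\<subseteq>Z \<beta>. e \<le> card W \<and> plus \<beta> (Suc \<alpha>) ?b W"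
          using bspec[OF plus(3) \<beta>] \<open>0 < c\<close> by (intro exI[of _ "Z' \<beta>"]) auto
        show "\<exists>W\<subseteq>Z j. e \<le> card W \<and> plus j u b W"
          if "j \<in> F" "\<exists>W\<subseteq>Z' j. e \<le> card W \<and> plus j u b W" for j u b
          using bspec[OF plus(3), of j] subsetD[OF plus_family(1) that(1)] that(2) by auto
      qed (use \<beta> plus(1,2) \<open>?b \<le> K\<close> in auto)
      then show ?thesis
        using plus_family(2) by simp
    qed (rule disjI1)
  qed
qed

section \<open>Abstract orientations of points in space\<close>

text \<open>The sign of \<open>ori a b c d\<close> tells on which side of the plane through \<open>a\<close>, \<open>b\<close>, \<open>c\<close>
  the point \<open>d\<close> lies.\<close>
locale chirotope =
  fixes ori :: "'p \<Rightarrow> 'p \<Rightarrow> 'p \<Rightarrow> 'p \<Rightarrow> real"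
  assumes swap12: "ori b a c d = - ori a b c d"
    and swap23: "ori a c b d = - ori a b c d"
    and swap34: "ori a b d c = - ori a b c d"
    and grassmann_pluecker:
      "ori a b c d * ori a b e f - ori a b c e * ori a b d f + ori a b c f * ori a b d e = 0"
begin

lemma chirotope_uminus: "chirotope (\<lambda>a b c d. - ori a b c d)"
proof
  show "- ori b a c d = - (- ori a b c d)" for a b c d
    by (simp add: swap12[of b a c d])
  show "- ori a c b d = - (- ori a b c d)" for a b c d
    by (simp add: swap23[of a c b d])
  show "- ori a b d c = - (- ori a b c d)" for a b c d
    by (simp add: swap34[of a b d c])
qed (simp add: grassmann_pluecker)

lemma cycle234: "ori a b c d = ori a c d b"
  using swap34[of a c b d] swap23[of a b c d] by simp

lemma cycle234': "ori a b c d = ori a d b c"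
  using cycle234[of a d b c] by simp

lemma ori_repeated [simp]: "ori a b c c = 0" "ori a b c b = 0" "ori a b c a = 0"
proof -
  show eq34: "ori a b c c = 0" for a b c
    using swap34[of a b c c] by simp
  show eq24: "ori a b c b = 0" for a b c
    using swap23[of a b c b] eq34 by simp
  show "ori a b c a = 0"
    using swap12[of a b c a] eq24 by simp
qed

definition nondegenerate :: "'p set \<Rightarrow> bool" where
  "nondegenerate X \<longleftrightarrow> (\<forall>a b c d. {a, b, c, d} \<subseteq> X \<longrightarrow> distinct [a, b, c, d] \<longrightarrow> ori a b c d \<noteq> 0)"

lemma nondegenerate_subset: "nondegenerate X \<Longrightarrow> Y \<subseteq> X \<Longrightarrow> nondegenerate Y"
  unfolding nondegenerate_def by (meson order_trans)

definition axis_less :: "'p \<Rightarrow> 'p \<Rightarrow> 'p \<Rightarrow> 'p \<Rightarrow> bool" where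
  "axis_less a b y z \<longleftrightarrow> ori a b y z > 0"

definition strict_axis_order :: "'p \<Rightarrow> 'p \<Rightarrow> 'p set \<Rightarrow> bool" where
  "strict_axis_order a b Z \<longleftrightarrow> transp_on Z (axis_less a b) \<and> totalp_on Z (axis_less a b)"

lemma strict_axis_order_subset:
  "strict_axis_order a b Z \<Longrightarrow> Z' \<subseteq> Z \<Longrightarrow> strict_axis_order a b Z'"
  unfolding strict_axis_order_def using transp_on_subset totalp_on_subset by blast

lemma asymp_on_axis_less: "asymp_on Z (axis_less a b)"
proof (rule asymp_onI)
  show "\<not> axis_less a b z y" if "axis_less a b y z" for y z
    using that swap34[of a b z y] by (simp add: axis_less_def)
qed

lemma axis_less_trans:
  assumes same_side: "ori a b r y * ori a b r z > 0" "ori a b r z * ori a b r w > 0"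
    and less: "axis_less a b y z" "axis_less a b z w"
  shows "axis_less a b y w"
proof -
  have "(ori a b r z)\<^sup>2 * ori a b y w =
      ori a b r y * ori a b r z * ori a b z w + ori a b r z * ori a b r w * ori a b y z"
    using grassmann_pluecker[of a b r y z w] by algebra
  also have "\<dots> > 0"
    using same_side less unfolding axis_less_def by (intro add_pos_pos mult_pos_pos[of "_ * _"])
  finally show ?thesis
    using zero_less_mult_pos by (auto simp: axis_less_def zero_less_mult_iff)
qed

lemma strict_axis_orderI:
  assumes "\<And>y z. y \<in> Z \<Longrightarrow> z \<in> Z \<Longrightarrow> ori a b r y * ori a b r z > 0"
    and "\<And>y z. y \<in> Z \<Longrightarrow> z \<in> Z \<Longrightarrow> y \<noteq> z \<Longrightarrow> ori a b y z \<noteq> 0"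
  shows "strict_axis_order a b Z"
proof -
  have "transp_on Z (axis_less a b)"
    using axis_less_trans assms(1) unfolding transp_on_def by metis
  moreover have "totalp_on Z (axis_less a b)"
  proof (rule totalp_onI)
    show "axis_less a b y z \<or> axis_less a b z y" if "y \<in> Z" "z \<in> Z" "y \<noteq> z" for y z
      using swap34[of a b z y] assms(2)[OF that] by (auto simp: axis_less_def)
  qed
  ultimately show ?thesis
    by (simp add: strict_axis_order_def)
qed

definition concordant :: "'p \<Rightarrow> 'p \<Rightarrow> 'p \<Rightarrow> 'p \<Rightarrow> 'p set \<Rightarrow> bool" where
  "concordant a b c d Z \<longleftrightarrow> (\<forall>y\<in>Z. \<forall>z\<in>Z. y \<noteq> z \<longrightarrow> ori a b y z * ori c d y z > 0)"

definition discordant :: "'p \<Rightarrow> 'p \<Rightarrow> 'p \<Rightarrow> 'p \<Rightarrow> 'p set \<Rightarrow> bool" where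
  "discordant a b c d Z \<longleftrightarrow> (\<forall>y\<in>Z. \<forall>z\<in>Z. y \<noteq> z \<longrightarrow> ori a b y z * ori c d y z < 0)"

lemma discordant_subset: "discordant a b c d Z \<Longrightarrow> Z' \<subseteq> Z \<Longrightarrow> discordant a b c d Z'"
  unfolding discordant_def by blast

lemma concordant_commute: "concordant a b c d Z \<longleftrightarrow> concordant c d a b Z"
  by (simp add: concordant_def mult.commute)

lemma discordant_trans:
  assumes "discordant a b c d Z" "discordant c d e f Z"
  shows "concordant a b e f Z"
  unfolding concordant_def
proof (intro ballI impI)
  fix y z assume "y \<in> Z" "z \<in> Z" "y \<noteq> z"
  then have "ori a b y z * ori c d y z < 0" "ori c d y z * ori e f y z < 0"
    using assms unfolding discordant_def by blast+
  then show "ori a b y z * ori e f y z > 0"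
    by (auto simp: zero_less_mult_iff mult_less_0_iff)
qed

lemma concordant_or_discordant_part:
  assumes "finite Z" "s * t \<le> card Z" "strict_axis_order a b Z" "strict_axis_order c d Z"
  shows "(\<exists>Z'\<subseteq>Z. card Z' = s \<and> concordant a b c d Z') \<or> (\<exists>Z'\<subseteq>Z. card Z' = t \<and> discordant a b c d Z')"
proof -
  let ?P = "\<lambda>y z. axis_less a b y z \<and> axis_less c d y z"
  have trans: "transp_on Z ?P"
    using assms(3,4) unfolding strict_axis_order_def transp_on_def by blast
  have asym: "asymp_on Z ?P"
    using asymp_on_axis_less[of Z a b] unfolding asymp_on_def by blast
  consider (chain) Z' where "Z' \<subseteq> Z" "card Z' = s" "totalp_on Z' ?P"
    | (antichain) Z' where "Z' \<subseteq> Z" "card Z' = t" "\<forall>x\<in>Z'. \<forall>y\<in>Z'. \<not> ?P x y"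
    using chain_or_antichain[OF assms(1,2) trans asym] by blast
  then show ?thesis
  proof cases
    case chain
    have "concordant a b c d Z'"
      unfolding concordant_def
    proof (intro ballI impI)
      fix y z assume "y \<in> Z'" "z \<in> Z'" "y \<noteq> z"
      then have "?P y z \<or> ?P z y"
        using chain(3) unfolding totalp_on_def by blast
      then show "ori a b y z * ori c d y z > 0"
        using swap34[of a b y z] swap34[of c d y z] by (auto simp: axis_less_def zero_less_mult_iff)
    qed
    then show ?thesis using chain by blast
  next
    case antichain
    have "discordant a b c d Z'"
      unfolding discordant_def
    proof (intro ballI impI)
      fix y z assume yz: "y \<in> Z'" "z \<in> Z'" "y \<noteq> z"
      then have "axis_less a b y z \<or> axis_less a b z y" "axis_less c d y z \<or> axis_less c d z y"
        using antichain(1) assms(3,4) unfolding strict_axis_order_def totalp_on_def by (meson subsetD)+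
      moreover have "\<not> ?P y z" "\<not> ?P z y"
        using antichain(3) yz by blast+
      ultimately show "ori a b y z * ori c d y z < 0"
        using swap34[of a b y z] swap34[of c d y z] by (auto simp: axis_less_def mult_less_0_iff)
    qed
    then show ?thesis using antichain by blast
  qed
qed

lemma triples_transitive:
  assumes less: "axis_less q r a b" "axis_less q r b c" "axis_less q r c d"
      "axis_less q r a c" "axis_less q r b d"
    and pos: "s * ori q a b c > 0" "s * ori q b c d > 0"
  shows "s * ori q a b d > 0" "s * ori q a c d > 0"
proof -
  have swaps: "ori q b r a = ori q r a b" "ori q b r c = - ori q r b c" "ori q b r d = - ori q r b d"
    "ori q b a d = - ori q a b d" "ori q b a c = - ori q a b c" "ori q c r a = ori q r a c"
    "ori q c r b = ori q r b c" "ori q c r d = - ori q r c d" "ori q c b d = - ori q b c d"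
    "ori q c a d = - ori q a c d" "ori q c a b = ori q a b c"
    by (rule cycle234'[symmetric] swap23)+
  have "ori q r b c * (s * ori q a b d) =
      ori q r a b * (s * ori q b c d) + ori q r b d * (s * ori q a b c)"
    using grassmann_pluecker[of q b r a c d] unfolding swaps by algebra
  also have "\<dots> > 0"
    using less pos by (auto simp: axis_less_def intro!: add_pos_pos mult_pos_pos)
  finally show "s * ori q a b d > 0"
    using less(2) by (simp add: axis_less_def zero_less_mult_iff)
  have "ori q r b c * (s * ori q a c d) =
      ori q r a c * (s * ori q b c d) + ori q r c d * (s * ori q a b c)"
    using grassmann_pluecker[of q c r a b d] unfolding swaps by algebra
  also have "\<dots> > 0"
    using less pos by (auto simp: axis_less_def intro!: add_pos_pos mult_pos_pos)
  finally show "s * ori q a c d > 0"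
    using less(2) by (simp add: axis_less_def zero_less_mult_iff)
qed

text \<open>In the projection from \<open>q\<close>, the points \<open>y 0, \<dots>, y (N - 1)\<close> form a convex chain bulging away
  from \<open>r\<close> if \<open>s = 1\<close>, and towards \<open>r\<close> if \<open>s = -1\<close>.\<close>
definition bulge :: "real \<Rightarrow> 'p \<Rightarrow> 'p \<Rightarrow> 'p set \<Rightarrow> (nat \<Rightarrow> 'p) \<Rightarrow> nat \<Rightarrow> bool" where
  "bulge s q r Z y N \<longleftrightarrow> (\<forall>i<N. y i \<in> Z) \<and> (\<forall>i j. i < j \<longrightarrow> j < N \<longrightarrow> axis_less q r (y i) (y j)) \<and>
     (\<forall>i j k. i < j \<longrightarrow> j < k \<longrightarrow> k < N \<longrightarrow> s * ori q (y i) (y j) (y k) > 0)"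

lemma bulge_of_path:
  assumes "strict_axis_order q r Z" "triple_path (axis_less q r) P Z xs"
    and P: "\<And>x y z. x \<in> Z \<Longrightarrow> y \<in> Z \<Longrightarrow> z \<in> Z \<Longrightarrow> axis_less q r x y \<Longrightarrow> axis_less q r y z \<Longrightarrow>
      P x y z \<longleftrightarrow> s * ori q x y z > 0"
  shows "bulge s q r Z ((!) xs) (length xs)"
proof -
  have xs: "set xs \<subseteq> Z" "successively (axis_less q r) xs" "successive_triples P xs"
    using assms(2) by (simp_all add: triple_path_def)
  have trans: "axis_less q r x z" if "axis_less q r x y" "axis_less q r y z" "{x, y, z} \<subseteq> Z" for x y z
    using assms(1) that by (auto simp: strict_axis_order_def dest: transp_onD)
  then have sorted: "sorted_wrt (axis_less q r) xs"
    using xs(1,2) successively_iff_sorted_wrt_strong[of xs "axis_less q r"] by blast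
  have "P a b d \<and> P a c d"
    if "{a, b, c, d} \<subseteq> set xs" and less: "axis_less q r a b" "axis_less q r b c" "axis_less q r c d"
      and "P a b c" "P b c d" for a b c d
  proof -
    have Z: "a \<in> Z" "b \<in> Z" "c \<in> Z" "d \<in> Z"
      using that(1) xs(1) by auto
    then have less': "axis_less q r a c" "axis_less q r b d"
      using trans less by blast+
    have "s * ori q a b c > 0" "s * ori q b c d > 0"
      using that P Z by blast+
    then have "s * ori q a b d > 0" "s * ori q a c d > 0"
      using triples_transitive less less' by blast+
    then show ?thesis
      using P Z less less' by blast
  qed
  then have "P (xs ! i) (xs ! j) (xs ! k)" if "i < j" "j < k" "k < length xs" for i j k
    using successive_triples_imp_triples[OF xs(3) sorted _ that] by blast
  moreover have less: "axis_less q r (xs ! i) (xs ! j)" if "i < j" "j < length xs" for i j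
    using sorted that by (simp add: sorted_wrt_nth_less)
  moreover have "xs ! i \<in> Z" if "i < length xs" for i
    using xs(1) that nth_mem by blast
  ultimately show ?thesis
    using P unfolding bulge_def by auto
qed

lemma bulge_exists:
  assumes "finite Z" and order: "strict_axis_order q r Z"
    and nonzero: "\<And>x y z. x \<in> Z \<Longrightarrow> y \<in> Z \<Longrightarrow> z \<in> Z \<Longrightarrow> distinct [x, y, z] \<Longrightarrow> ori q x y z \<noteq> 0"
    and "(k + l) choose k < card Z"
  shows "(\<exists>y. bulge (-1) q r Z y (k + 2)) \<or> (\<exists>y. bulge 1 q r Z y (l + 2))"
proof -
  let ?P = "\<lambda>x y z. ori q x y z < 0"
  have distinct: "distinct [x, y, z]"
    if "x \<in> Z" "y \<in> Z" "z \<in> Z" "axis_less q r x y" "axis_less q r y z" for x y z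
  proof -
    have "axis_less q r x z"
      using that order unfolding strict_axis_order_def by (meson transp_onD)
    then show ?thesis
      using that asymp_on_axis_less[of Z q r] by (auto dest: asymp_onD)
  qed
  have total: "totalp_on Z (axis_less q r)"
    using order by (simp add: strict_axis_order_def)
  consider (inward) xs where "triple_path (axis_less q r) ?P Z xs" "length xs = k + 2"
    | (outward) xs where "triple_path (axis_less q r) (\<lambda>x y z. \<not> ?P x y z) Z xs" "length xs = l + 2"
    using cups_caps[OF assms(1) total assms(4), of ?P] by blast
  then show ?thesis
  proof cases
    case inward
    then have "bulge (-1) q r Z ((!) xs) (length xs)"
      by (intro bulge_of_path[OF order]) auto
    then show ?thesis using inward(2) by auto
  next
    case outward
    then have "bulge 1 q r Z ((!) xs) (length xs)"
      using nonzero[OF _ _ _ distinct] by (intro bulge_of_path[OF order outward(1)]) force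
    then show ?thesis using outward(2) by auto
  qed
qed

fun side :: "'p \<times> 'p \<times> 'p \<Rightarrow> 'p \<Rightarrow> real" where
  "side (a, b, c) x = ori a b c x"

definition cuts_off :: "'i set \<Rightarrow> ('i \<Rightarrow> 'p set) \<Rightarrow> ('i \<Rightarrow> 'p \<times> 'p \<times> 'p) \<Rightarrow> bool" where
  "cuts_off I B h \<longleftrightarrow> (\<forall>i\<in>I. (\<forall>x\<in>B i. side (h i) x > 0) \<and> (\<forall>j\<in>I - {i}. \<forall>x\<in>B j. side (h i) x < 0))"

lemma cuts_off_reindex:
  assumes "cuts_off I B h" "inj_on f J" "f ` J \<subseteq> I"
  shows "cuts_off J (B \<circ> f) (h \<circ> f)"
  unfolding cuts_off_def
proof (intro ballI conjI)
  fix i assume i: "i \<in> J"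
  show "side ((h \<circ> f) i) x > 0" if "x \<in> (B \<circ> f) i" for x
    using assms(1,3) i that unfolding cuts_off_def by auto
  show "side ((h \<circ> f) i) x < 0" if "j \<in> J - {i}" "x \<in> (B \<circ> f) j" for j x
  proof -
    have "f i \<in> I" "f j \<in> I - {f i}"
      using assms(2,3) i that(1) by (auto dest: inj_onD)
    then show ?thesis
      using assms(1) that(2) unfolding cuts_off_def comp_def by blast
  qed
qed

definition cut_off_points :: "'p set \<Rightarrow> nat \<Rightarrow> bool" where
  "cut_off_points X n \<longleftrightarrow>
     (\<exists>v h. v ` {..<n} \<subseteq> X \<and> h ` {..<n} \<subseteq> X \<times> X \<times> X \<and> cuts_off {..<n} (\<lambda>i. {v i}) h)"

lemma cut_off_pointsI:
  assumes "finite I" "n \<le> card I" "v ` I \<subseteq> X" "h ` I \<subseteq> X \<times> X \<times> X" "cuts_off I (\<lambda>i. {v i}) h"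
  shows "cut_off_points X n"
proof -
  have "\<exists>f. inj_on f {..<n} \<and> f ` {..<n} \<subseteq> I"
    using card_le_inj[of "{..<n}" I] assms(1,2) by auto
  then obtain f where f: "inj_on f {..<n}" "f ` {..<n} \<subseteq> I" by blast
  have "cuts_off {..<n} (\<lambda>i. {(v \<circ> f) i}) (h \<circ> f)"
    using cuts_off_reindex[OF assms(5) f] by (simp add: comp_def)
  moreover have "(v \<circ> f) ` {..<n} \<subseteq> X" "(h \<circ> f) ` {..<n} \<subseteq> X \<times> X \<times> X"
    using f(2) assms(3,4) by (auto simp flip: image_image)
  ultimately show ?thesis
    unfolding cut_off_points_def by blast
qed

lemma cut_off_points_uminus:
  assumes "chirotope.cut_off_points (\<lambda>a b c d. - ori a b c d) X n"
  shows "cut_off_points X n"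
proof -
  interpret neg: chirotope "\<lambda>a b c d. - ori a b c d" by (rule chirotope_uminus)
  obtain v h where vh: "v ` {..<n} \<subseteq> X" "h ` {..<n} \<subseteq> X \<times> X \<times> X" "neg.cuts_off {..<n} (\<lambda>i. {v i}) h"
    using assms unfolding neg.cut_off_points_def by blast
  define flip :: "'p \<times> 'p \<times> 'p \<Rightarrow> 'p \<times> 'p \<times> 'p" where "flip = (\<lambda>(a, b, c). (b, a, c))"
  have "side (flip t) x = neg.side t x" for t x
    using swap12[of "fst (snd t)" "fst t" "snd (snd t)" x] by (cases t) (simp add: flip_def)
  then have "cuts_off {..<n} (\<lambda>i. {v i}) (flip \<circ> h)"
    using vh(3) by (simp add: cuts_off_def neg.cuts_off_def)
  moreover have "(flip \<circ> h) ` {..<n} \<subseteq> X \<times> X \<times> X"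
    using vh(2) by (fastforce simp: flip_def)
  ultimately show ?thesis
    unfolding cut_off_points_def using vh(1) by blast
qed

lemma bulge_cuts:
  assumes b: "bulge s q r Z y N" and i: "2 * i + 2 < N"
  shows "s * ori q (y (2 * i + 2)) (y (2 * i)) (y (2 * i + 1)) > 0"
    and "2 * j + 2 < N \<Longrightarrow> j \<noteq> i \<Longrightarrow> s * ori q (y (2 * i + 2)) (y (2 * i)) (y (2 * j + 1)) < 0"
proof -
  have triple: "s * ori q (y i) (y j) (y k) > 0" if "i < j" "j < k" "k < N" for i j k
    using b that by (auto simp: bulge_def)
  show "s * ori q (y (2 * i + 2)) (y (2 * i)) (y (2 * i + 1)) > 0"
    using triple[of "2 * i" "2 * i + 1" "2 * i + 2"] i
      cycle234'[of q "y (2 * i)" "y (2 * i + 1)" "y (2 * i + 2)"] by simp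
  assume j: "2 * j + 2 < N" "j \<noteq> i"
  have "s * ori q (y (2 * i)) (y (2 * i + 2)) (y (2 * j + 1)) > 0"
  proof (cases "j < i")
    case True
    then show ?thesis
      using triple[of "2 * j + 1" "2 * i" "2 * i + 2"] i
        cycle234[of q "y (2 * j + 1)" "y (2 * i)" "y (2 * i + 2)"] by simp
  next
    case False
    then show ?thesis
      using triple[of "2 * i" "2 * i + 2" "2 * j + 1"] j by simp
  qed
  then show "s * ori q (y (2 * i + 2)) (y (2 * i)) (y (2 * j + 1)) < 0"
    using swap23[of q "y (2 * i)" "y (2 * i + 2)" "y (2 * j + 1)"] by simp
qed

lemma cut_off_points_of_inward_bulge:
  assumes bulge: "bulge (-1) q r Z y (2 * n + 1)" and "Z \<subseteq> X" "q \<in> X"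
  shows "cut_off_points X n"
proof (rule cut_off_pointsI)
  let ?v = "\<lambda>i. y (2 * i + 1)" and ?h = "\<lambda>i. (q, y (2 * i), y (2 * i + 2))"
  have "y i \<in> X" if "i < 2 * n + 1" for i
    using bulge that assms(2) by (auto simp: bulge_def)
  then show "?v ` {..<n} \<subseteq> X" "?h ` {..<n} \<subseteq> X \<times> X \<times> X"
    using assms(3) by auto
  have swap: "side (?h i) z = - ori q (y (2 * i + 2)) (y (2 * i)) z" for i z
    unfolding side.simps by (rule swap23)
  show "cuts_off {..<n} (\<lambda>i. {?v i}) ?h"
    unfolding cuts_off_def swap
    using bulge_cuts(1)[OF bulge] bulge_cuts(2)[OF bulge] by simp
qed auto

text \<open>Seen from \<open>q\<close>, every line through two points of \<open>Z\<close> leaves \<open>r\<close> and all of \<open>U\<close> on the same side.\<close>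
definition sees_one_sided :: "'p set \<Rightarrow> 'p \<Rightarrow> 'p \<Rightarrow> 'p set \<Rightarrow> 'p set \<Rightarrow> bool" where
  "sees_one_sided X q r Z U \<longleftrightarrow> q \<in> X \<and> strict_axis_order q r Z \<and>
     (\<forall>x\<in>Z. \<forall>y\<in>Z. \<forall>z\<in>Z. distinct [x, y, z] \<longrightarrow> ori q x y z \<noteq> 0) \<and>
     (\<forall>y\<in>Z. \<forall>z\<in>Z. axis_less q r y z \<longrightarrow> (\<forall>x\<in>U. ori q x y z > 0))"

lemma sees_one_sidedD:
  "sees_one_sided X q r Z U \<Longrightarrow> y \<in> Z \<Longrightarrow> z \<in> Z \<Longrightarrow> axis_less q r y z \<Longrightarrow> x \<in> U \<Longrightarrow> ori q x y z > 0"
  by (simp add: sees_one_sided_def)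

lemma sees_one_sided_mono: "sees_one_sided X q r Z U \<Longrightarrow> V \<subseteq> U \<Longrightarrow> sees_one_sided X q r Z V"
  unfolding sees_one_sided_def by blast

lemma outward_bulges_combine:
  assumes "finite F" "n \<le> card F * l"
    and Z: "\<And>j. j \<in> F \<Longrightarrow> Z j \<subseteq> X"
    and sees: "\<And>j. j \<in> F \<Longrightarrow> sees_one_sided X (q j) (r j) (Z j) (\<Union>i\<in>F - {j}. Z i)"
    and bulge: "\<And>j. j \<in> F \<Longrightarrow> bulge 1 (q j) (r j) (Z j) (y j) (2 * l + 2)"
  shows "cut_off_points X n"
proof (rule cut_off_pointsI)
  let ?I = "F \<times> {..<l}"
  let ?v = "\<lambda>(j, i). y j (2 * i + 1)" and ?h = "\<lambda>(j, i). (q j, y j (2 * i + 2), y j (2 * i))"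
  show "finite ?I" "n \<le> card ?I"
    using assms(1,2) by auto
  have y: "y j i \<in> Z j" if "j \<in> F" "i < 2 * l + 2" for j i
    using bulge[OF that(1)] that(2) by (auto simp: bulge_def)
  have "y j i \<in> X" if "j \<in> F" "i < 2 * l + 2" for j i
    using y Z that by blast
  moreover have "q j \<in> X" if "j \<in> F" for j
    using sees[OF that] by (simp add: sees_one_sided_def)
  ultimately show "?v ` ?I \<subseteq> X" "?h ` ?I \<subseteq> X \<times> X \<times> X"
    by auto
  have pos: "ori (q j) (y j (2 * i + 2)) (y j (2 * i)) (y j (2 * i + 1)) > 0" if "j \<in> F" "i < l" for j i
    using bulge_cuts(1)[OF bulge[OF that(1)], of i] that(2) by simp
  have neg: "ori (q j) (y j (2 * i + 2)) (y j (2 * i)) (y j' (2 * i' + 1)) < 0"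
    if ji: "j \<in> F" "i < l" "j' \<in> F" "i' < l" "(j', i') \<noteq> (j, i)" for j i j' i'
  proof (cases "j' = j")
    case True
    then show ?thesis
      using bulge_cuts(2)[OF bulge[OF ji(1)], of i i'] ji by auto
  next
    case False
    let ?x = "y j' (2 * i' + 1)"
    have "?x \<in> (\<Union>i\<in>F - {j}. Z i)"
      using y[OF ji(3), of "2 * i' + 1"] ji(3,4) False by auto
    moreover have "axis_less (q j) (r j) (y j (2 * i)) (y j (2 * i + 2))"
      using bulge[OF ji(1)] ji(2) by (simp add: bulge_def)
    ultimately have "ori (q j) ?x (y j (2 * i)) (y j (2 * i + 2)) > 0"
      using sees_one_sidedD[OF sees[OF ji(1)]] y[OF ji(1)] ji(2) by simp
    then show ?thesis
      using swap23[of "q j" "y j (2 * i)" "y j (2 * i + 2)" ?x]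
        cycle234'[of "q j" "y j (2 * i)" "y j (2 * i + 2)" ?x] by simp
  qed
  have "side (?h p) (?v p) > 0" if "p \<in> ?I" for p
    using that pos by auto
  moreover have "side (?h p) (?v p') < 0" if "p \<in> ?I" "p' \<in> ?I - {p}" for p p'
    using that by (cases p; cases p'; simp only: prod.case side.simps) (rule neg; auto)
  ultimately show "cuts_off ?I (\<lambda>p. {?v p}) ?h"
    unfolding cuts_off_def by blast
qed

definition has_one_sided_part :: "'p set \<Rightarrow> nat \<Rightarrow> 'p set \<Rightarrow> 'p set \<Rightarrow> bool" where
  "has_one_sided_part X s Z U \<longleftrightarrow> (\<exists>Z'\<subseteq>Z. card Z' = s \<and> (\<exists>q r. sees_one_sided X q r Z' U))"

lemma has_one_sided_part_mono:
  assumes "has_one_sided_part X s Z U" "Z \<subseteq> Z'" "U' \<subseteq> U"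
  shows "has_one_sided_part X s Z' U'"
proof -
  obtain W q r where "W \<subseteq> Z" "card W = s" "sees_one_sided X q r W U"
    using assms(1) unfolding has_one_sided_part_def by blast
  moreover from this have "sees_one_sided X q r W U'"
    using sees_one_sided_mono assms(3) by blast
  ultimately show ?thesis
    using assms(2) unfolding has_one_sided_part_def by (intro exI[of _ W]) auto
qed

lemma one_sided_parts_combine:
  assumes F: "finite F" "n \<le> card F * l" and X: "finite X" "\<And>j. j \<in> F \<Longrightarrow> C j \<subseteq> X"
    and s: "(2 * n + 2 * l) choose (2 * l) < s"
    and part: "\<And>j. j \<in> F \<Longrightarrow> has_one_sided_part X s (C j) (\<Union>i\<in>F - {j}. C i)"
  shows "cut_off_points X n"
proof -
  have "\<exists>Z q r. Z \<subseteq> C j \<and> card Z = s \<and> sees_one_sided X q r Z (\<Union>i\<in>F - {j}. C i)" if "j \<in> F" for j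
    using part[OF that] unfolding has_one_sided_part_def by blast
  then obtain Z q r where Z: "\<And>j. j \<in> F \<Longrightarrow> Z j \<subseteq> C j" "\<And>j. j \<in> F \<Longrightarrow> card (Z j) = s"
    and sees_C: "\<And>j. j \<in> F \<Longrightarrow> sees_one_sided X (q j) (r j) (Z j) (\<Union>i\<in>F - {j}. C i)"
    by metis
  have ZX: "Z j \<subseteq> X" if "j \<in> F" for j
    using Z(1) X(2) that by blast
  have sees: "sees_one_sided X (q j) (r j) (Z j) (\<Union>i\<in>F - {j}. Z i)" if "j \<in> F" for j
    by (rule sees_one_sided_mono[OF sees_C[OF that]]) (use Z(1) in blast)
  have "(2 * n + 2 * l) choose (2 * n) < s"
    using s binomial_symmetric[of "2 * n" "2 * n + 2 * l"] by simp
  then have "(\<exists>y. bulge (-1) (q j) (r j) (Z j) y (2 * n + 2)) \<or>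
      (\<exists>y. bulge 1 (q j) (r j) (Z j) y (2 * l + 2))"
    if "j \<in> F" for j
    using sees[OF that] Z(2)[OF that] finite_subset[OF ZX[OF that] X(1)]
    unfolding sees_one_sided_def by (intro bulge_exists) blast+
  then consider (inward) j y where "j \<in> F" "bulge (-1) (q j) (r j) (Z j) y (2 * n + 2)"
    | (outward) y where "\<And>j. j \<in> F \<Longrightarrow> bulge 1 (q j) (r j) (Z j) (y j) (2 * l + 2)"
    by metis
  then show ?thesis
  proof cases
    case inward
    have "bulge (-1) (q j) (r j) (Z j) y (2 * n + 1)"
      using inward(2) by (auto simp: bulge_def)
    then show ?thesis
      using cut_off_points_of_inward_bulge ZX sees inward(1) by (metis sees_one_sided_def)
  next
    case outward
    then show ?thesis
      using outward_bulges_combine[OF F ZX sees] by blast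
  qed
qed

end

section \<open>Clusters along the moment curve\<close>

definition order_sign :: "nat \<Rightarrow> nat \<Rightarrow> real" where
  "order_sign a b = sgn (real b - real a)"

lemma order_sign_less [simp]: "a < b \<Longrightarrow> order_sign a b = 1" "b < a \<Longrightarrow> order_sign a b = -1"
  by (simp_all add: order_sign_def)

lemma order_sign_commute: "order_sign b a = - order_sign a b"
  by (simp add: order_sign_def flip: sgn_minus)

lemma order_sign_eq_0_iff: "order_sign a b = 0 \<longleftrightarrow> a = b"
  by (auto simp: order_sign_def sgn_zero_iff)

text \<open>The orientation of four points with parameters \<open>a\<close>, \<open>b\<close>, \<open>c\<close>, \<open>d\<close> on the moment curve.\<close>
definition position_sign :: "nat \<Rightarrow> nat \<Rightarrow> nat \<Rightarrow> nat \<Rightarrow> real" where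
  "position_sign a b c d = order_sign a b * order_sign a c * order_sign a d *
     order_sign b c * order_sign b d * order_sign c d"

lemma position_sign_swap:
  "position_sign b a c d = - position_sign a b c d"
  "position_sign a c b d = - position_sign a b c d"
  "position_sign a b d c = - position_sign a b c d"
  by (simp_all add: position_sign_def order_sign_commute[of b a] order_sign_commute[of c b]
      order_sign_commute[of d c])

lemma position_sign_cycle234: "position_sign a b c d = position_sign a c d b"
  using position_sign_swap(3)[of a c b d] position_sign_swap(2)[of a b c d] by simp

lemma position_sign_sorted: "a < b \<Longrightarrow> b < c \<Longrightarrow> c < d \<Longrightarrow> position_sign a b c d = 1"
  by (simp add: position_sign_def)

lemma position_sign_nonzero: "distinct [a, b, c, d] \<Longrightarrow> position_sign a b c d \<noteq> 0"
  by (simp add: position_sign_def order_sign_eq_0_iff)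

lemma distinct_quadruple_wlog [consumes 2, case_names sorted first_two middle_two last_two]:
  fixes a b c d :: "'a::linorder"
  assumes "{a, b, c, d} \<subseteq> S" "distinct [a, b, c, d]"
    and sorted: "\<And>a b c d. {a, b, c, d} \<subseteq> S \<Longrightarrow> a < b \<Longrightarrow> b < c \<Longrightarrow> c < d \<Longrightarrow> P a b c d"
    and swap12: "\<And>a b c d. P b a c d \<Longrightarrow> P a b c d"
    and swap23: "\<And>a b c d. P a c b d \<Longrightarrow> P a b c d"
    and swap34: "\<And>a b c d. P a b d c \<Longrightarrow> P a b c d"
  shows "P a b c d"
proof -
  have three_sorted: "P a b c d" if S: "{a, b, c, d} \<subseteq> S" "a < b" "b < c" "d \<notin> {a, b, c}" for a b c d
  proof -
    consider (d_first) "d < a" | (d_second) "a < d" "d < b"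
      | (d_third) "b < d" "d < c" | (d_last) "c < d"
      using S(4) by fastforce
    then show ?thesis
    proof cases
      case d_first
      then have "P d a b c"
        using S by (intro sorted) auto
      then show ?thesis by (rule swap34[OF swap23[OF swap12]])
    next
      case d_second
      then have "P a d b c"
        using S by (intro sorted) auto
      then show ?thesis by (rule swap34[OF swap23])
    next
      case d_third
      then have "P a b d c"
        using S by (intro sorted) auto
      then show ?thesis by (rule swap34)
    qed (use S sorted in blast)
  qed
  have two_sorted: "P a b c d" if S: "{a, b, c, d} \<subseteq> S" "a < b" "c \<notin> {a, b}" "d \<notin> {a, b, c}" for a b c d
  proof -
    consider (c_first) "c < a" | (c_second) "a < c" "c < b" | (c_last) "b < c"
      using S(3) by fastforce
    then show ?thesis
    proof cases
      case c_first
      then have "P c a b d"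
        using S by (intro three_sorted) auto
      then show ?thesis by (rule swap23[OF swap12])
    next
      case c_second
      then have "P a c b d"
        using S by (intro three_sorted) auto
      then show ?thesis by (rule swap23)
    next
      case c_last
      then show ?thesis
        using S by (intro three_sorted) auto
    qed
  qed
  show ?thesis
  proof (cases "a < b")
    case True
    then show ?thesis
      using assms(1,2) by (intro two_sorted) auto
  next
    case False
    then have "P b a c d"
      using assms(1,2) by (intro two_sorted) auto
    then show ?thesis by (rule swap12)
  qed
qed

lemma pluecker_sign:
  fixes lr :: real
  assumes "lr * xy = lx * ry + ly * xr" "lr \<noteq> 0" "sgn lx = sgn lr" "sgn xr = sgn lr" "sgn ry = sgn ly"
  shows "sgn xy = sgn ly"
proof -
  have pos: "lx / lr > 0" "xr / lr > 0"
    using assms(2-4) by (auto simp: sgn_if zero_less_divide_iff split: if_splits)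
  have xy: "xy = (lx / lr) * ry + (xr / lr) * ly"
    using assms(1,2) by (simp add: field_simps)
  consider (positive) "ly > 0" "ry > 0" | (negative) "ly < 0" "ry < 0" | (zero) "ly = 0" "ry = 0"
    using assms(5) by (auto simp: sgn_if split: if_splits)
  then show ?thesis
  proof cases
    case positive
    then have "xy > 0"
      unfolding xy using pos by (intro add_pos_pos mult_pos_pos)
    then show ?thesis using positive by simp
  next
    case negative
    then have "xy < 0"
      unfolding xy using pos by (intro add_neg_neg mult_pos_neg)
    then show ?thesis using negative by simp
  qed (simp add: xy)
qed

text \<open>Seen along the line through the positions \<open>q\<close> and \<open>s\<close> on the moment curve, position \<open>t\<close> lies
  in the cone spanned by \<open>l\<close> and \<open>r\<close>.\<close>
definition in_cone :: "nat \<Rightarrow> nat \<Rightarrow> nat \<Rightarrow> nat \<Rightarrow> nat \<Rightarrow> bool" where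
  "in_cone q s l r t \<longleftrightarrow> position_sign q s l t = position_sign q s l r \<and>
     position_sign q s t r = position_sign q s l r"

text \<open>Among the positions \<open>0, \<dots>, 4 * K\<close>, position \<open>4 * j + 2\<close> carries all points of the cluster \<open>C j\<close>,
  any other position \<open>t\<close> the single point \<open>p t\<close>.\<close>
definition points_at :: "(nat \<Rightarrow> 'p) \<Rightarrow> (nat \<Rightarrow> 'p set) \<Rightarrow> nat \<Rightarrow> 'p set" where
  "points_at p C t = (if t mod 4 = 2 then C (t div 4) else {p t})"

lemma points_at_cluster [simp]:
  "points_at p C (4 * j + 2) = C j" "points_at p C (Suc (Suc (4 * j))) = C j"
proof -
  have "Suc (Suc (4 * j)) mod 4 = 2" "Suc (Suc (4 * j)) div 4 = j"
    by presburger+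
  then show "points_at p C (4 * j + 2) = C j" "points_at p C (Suc (Suc (4 * j))) = C j"
    by (simp_all add: points_at_def)
qed

definition at_most_one_cluster :: "nat set \<Rightarrow> bool" where
  "at_most_one_cluster T \<longleftrightarrow> (\<forall>s\<in>T. \<forall>t\<in>T. s mod 4 = 2 \<longrightarrow> t mod 4 = 2 \<longrightarrow> s = t)"

lemma at_most_one_cluster_subset: "at_most_one_cluster T \<Longrightarrow> T' \<subseteq> T \<Longrightarrow> at_most_one_cluster T'"
  unfolding at_most_one_cluster_def by blast

locale moment_clusters = chirotope ori
  for ori :: "'p \<Rightarrow> 'p \<Rightarrow> 'p \<Rightarrow> 'p \<Rightarrow> real" +
  fixes X :: "'p set" and K :: nat and p :: "nat \<Rightarrow> 'p" and C :: "nat \<Rightarrow> 'p set"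
  assumes finite_X: "finite X"
    and nondegenerate_X: "nondegenerate X"
    and points_at_subset_X: "t \<le> 4 * K \<Longrightarrow> points_at p C t \<subseteq> X"
    and positive: "a < b \<Longrightarrow> b < c \<Longrightarrow> c < d \<Longrightarrow> d \<le> 4 * K \<Longrightarrow> at_most_one_cluster {a, b, c, d} \<Longrightarrow>
      x \<in> points_at p C a \<Longrightarrow> y \<in> points_at p C b \<Longrightarrow> z \<in> points_at p C c \<Longrightarrow> w \<in> points_at p C d \<Longrightarrow>
      ori x y z w > 0"
begin

definition single :: "nat \<Rightarrow> bool" where
  "single t \<longleftrightarrow> t \<le> 4 * K \<and> t mod 4 \<noteq> 2"

lemma points_at_single [simp]: "single t \<Longrightarrow> points_at p C t = {p t}"
  by (simp add: points_at_def single_def)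

lemma single_neq_cluster: "single t \<Longrightarrow> t \<noteq> 4 * j + 2"
  unfolding single_def by presburger

lemma single_multiple: "t \<le> K \<Longrightarrow> single (4 * t)"
  by (simp add: single_def)

lemma single_neighbours: "j < K \<Longrightarrow> single (4 * j + 1)" "j < K \<Longrightarrow> single (4 * j + 3)"
  by (simp_all add: single_def)

lemma ex_fresh_single:
  assumes "finite T" "card T < 4" "0 < K"
  shows "\<exists>t. single t \<and> t \<notin> T"
proof -
  have "\<not> {0, 1, 3, 4} \<subseteq> T"
  proof
    assume "{0, 1, 3, 4} \<subseteq> T"
    then have "card {0, 1, 3, 4 :: nat} \<le> card T"
      using card_mono assms(1) by blast
    then show False
      using assms(2) by simp
  qed
  moreover have "single t" if "t \<in> {0, 1, 3, 4}" for t
    using that assms(3) by (auto simp: single_def)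
  ultimately show ?thesis by blast
qed

lemma p_in_X: "single t \<Longrightarrow> p t \<in> X"
  using points_at_subset_X[of t] by (auto simp: single_def points_at_def)

lemma C_subset_X: "j < K \<Longrightarrow> C j \<subseteq> X"
  using points_at_subset_X[of "4 * j + 2"] by simp

lemma finite_C: "j < K \<Longrightarrow> finite (C j)"
  using C_subset_X finite_X finite_subset by blast

lemma sgn_points_at:
  assumes "{a, b, c, d} \<subseteq> {..4 * K}" "distinct [a, b, c, d]" "at_most_one_cluster {a, b, c, d}"
    and "x \<in> points_at p C a" "y \<in> points_at p C b" "z \<in> points_at p C c" "w \<in> points_at p C d"
  shows "sgn (ori x y z w) = position_sign a b c d"
proof -
  define f where "f = ((\<lambda>_. w)(a := x, b := y, c := z))"
  have f: "f t \<in> points_at p C t" if "t \<in> {a, b, c, d}" for t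
    using that assms(2,4-7) by (auto simp: f_def)
  have "sgn (ori (f a) (f b) (f c) (f d)) = position_sign a b c d"
    using order_refl assms(2)
  proof (induction rule: distinct_quadruple_wlog)
    case (sorted a' b' c' d')
    have "ori (f a') (f b') (f c') (f d') > 0"
      using sorted assms(1) at_most_one_cluster_subset[OF assms(3) sorted(1)] f
      by (intro positive[of a' b' c' d']) auto
    then show ?case
      using sorted by (simp add: position_sign_sorted)
  next
    case (first_two a b c d)
    then show ?case
      using swap12[of "f b" "f a" "f c" "f d"] position_sign_swap(1)[of b a c d] by (simp add: sgn_minus)
  next
    case (middle_two a b c d)
    then show ?case
      using swap23[of "f a" "f c" "f b" "f d"] position_sign_swap(2)[of a c b d] by (simp add: sgn_minus)
  next
    case (last_two a b c d)
    then show ?case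
      using swap34[of "f a" "f b" "f d" "f c"] position_sign_swap(3)[of a b d c] by (simp add: sgn_minus)
  qed
  then show ?thesis
    using assms(2) by (auto simp: f_def)
qed

lemma sgn_three_singles:
  assumes "single a" "single b" "single c" "t \<le> 4 * K" "distinct [a, b, c, t]" "x \<in> points_at p C t"
  shows "sgn (ori (p a) (p b) (p c) x) = position_sign a b c t"
  using assms by (intro sgn_points_at) (auto simp: single_def points_at_def at_most_one_cluster_def)

lemma points_at_distinct:
  assumes "x \<in> points_at p C a" "y \<in> points_at p C b" "a \<noteq> b" "a \<le> 4 * K" "b \<le> 4 * K" "0 < K"
    and "at_most_one_cluster {a, b}"
  shows "x \<noteq> y"
proof
  assume "x = y"
  have "card {a, b} < 4" "card {a, b, c} < 4" for c
    by (simp_all add: card_insert_if)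
  then obtain c d where "single c" "c \<notin> {a, b}" "single d" "d \<notin> {a, b, c}"
    using ex_fresh_single[OF _ _ assms(6)] by (meson finite.emptyI finite.insertI)
  then have cd: "single c" "single d" "distinct [a, b, c, d]"
    using assms(3) by auto
  then have "sgn (ori x y (p c) (p d)) = position_sign a b c d"
    using assms by (intro sgn_points_at) (auto simp: single_def points_at_def at_most_one_cluster_def)
  moreover have "ori x y (p c) (p d) = 0"
    using swap12[of x y "p c" "p d"] \<open>x = y\<close> by simp
  ultimately show False
    using position_sign_nonzero[OF cd(3)] by simp
qed

lemma p_neq_cluster: "single t \<Longrightarrow> j < K \<Longrightarrow> y \<in> C j \<Longrightarrow> p t \<noteq> y"
  using single_neq_cluster[of t j] points_at_single[of t]
  by (intro points_at_distinct[of _ t _ "4 * j + 2"]) (auto simp: single_def at_most_one_cluster_def)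

lemma strict_axis_order_cluster:
  assumes "j < K" "single a" "single b" "a \<noteq> b"
  shows "strict_axis_order (p a) (p b) (C j)"
proof -
  have "card {a, b} < 4" "0 < K"
    using assms(1) by (simp_all add: card_insert_if)
  then obtain c where c: "single c" "c \<notin> {a, b}"
    using ex_fresh_single[of "{a, b}"] by blast
  then have distinct: "distinct [a, b, c, 4 * j + 2]"
    using assms(2-4) single_neq_cluster by auto
  show ?thesis
  proof (rule strict_axis_orderI[where r = "p c"])
    fix y z assume yz: "y \<in> C j" "z \<in> C j"
    have "sgn (ori (p a) (p b) (p c) x) = position_sign a b c (4 * j + 2)" if "x \<in> C j" for x
      using assms(1-3) c(1) distinct that by (intro sgn_three_singles) auto
    then have "sgn (ori (p a) (p b) (p c) y) = sgn (ori (p a) (p b) (p c) z)"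
      "sgn (ori (p a) (p b) (p c) y) \<noteq> 0"
      using yz position_sign_nonzero[OF distinct] by auto
    then show "0 < ori (p a) (p b) (p c) y * ori (p a) (p b) (p c) z"
      by (auto simp: sgn_if zero_less_mult_iff split: if_splits)
    assume "y \<noteq> z"
    moreover have "p a \<noteq> p b"
      using assms by (intro points_at_distinct[of _ a _ b])
        (auto simp: single_def points_at_def at_most_one_cluster_def)
    ultimately have "distinct [p a, p b, y, z]"
      using assms(1-3) yz p_neq_cluster by simp
    moreover have "{p a, p b, y, z} \<subseteq> X"
      using assms yz C_subset_X p_in_X by blast
    ultimately show "ori (p a) (p b) y z \<noteq> 0"
      using nondegenerate_X unfolding nondegenerate_def by blast
  qed
qed

text \<open>The two single points adjacent to a cluster span a line that its points cross, so the sign of a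
  quadruple with two cluster points is interpolated from those with one.\<close>
lemma sgn_two_clusters:
  assumes ij: "i < K" "j < K" "i \<noteq> j" "x \<in> C i" "y \<in> C j"
    and ab: "single a" "single b" "a \<noteq> b" "{a, b} \<inter> {4 * i + 1, 4 * i + 3} = {}"
  shows "sgn (ori (p a) (p b) x y) = position_sign a b (4 * i + 2) (4 * j + 2)"
proof -
  let ?l = "4 * i + 1" and ?t = "4 * i + 2" and ?r = "4 * i + 3" and ?s = "4 * j + 2"
  have e: "e < ?l \<or> ?r < e" if "e \<in> {a, b, ?s}" for e
    using that ab single_neq_cluster[OF ab(1), of i] single_neq_cluster[OF ab(2), of i] ij(3) by auto
  have adjacent: "order_sign e u = order_sign e ?l" "order_sign u e = order_sign ?l e"
    if "e \<in> {a, b, ?s}" "u \<in> {?t, ?r}" for e u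
    using e[OF that(1)] that(2) by auto
  have lr: "single ?l" "single ?r" "?t \<le> 4 * K" "?s \<le> 4 * K"
    using ij by (auto simp: single_def)
  have distinct: "distinct [a, b, ?l, ?r, ?t, ?s]"
    using e[of a] e[of b] e[of ?s] ab(3) single_neq_cluster ab(1,2) by auto
  have at: "x \<in> points_at p C ?t" "y \<in> points_at p C ?s" "p ?r \<in> points_at p C ?r"
    using ij(4,5) lr(2) by simp_all
  have sgn_lr: "sgn (ori (p a) (p b) (p ?l) (p ?r)) = position_sign a b ?l ?r"
    by (rule sgn_three_singles[OF ab(1,2) lr(1) _ _ at(3)])
      (use lr(2) distinct in \<open>auto simp: single_def\<close>)
  have sgn_lx: "sgn (ori (p a) (p b) (p ?l) x) = position_sign a b ?l ?t"
    by (rule sgn_three_singles[OF ab(1,2) lr(1,3) _ at(1)]) (use distinct in auto)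
  have sgn_rx: "sgn (ori (p a) (p b) (p ?r) x) = position_sign a b ?r ?t"
    by (rule sgn_three_singles[OF ab(1,2) lr(2,3) _ at(1)]) (use distinct in auto)
  have sgn_ly: "sgn (ori (p a) (p b) (p ?l) y) = position_sign a b ?l ?s"
    by (rule sgn_three_singles[OF ab(1,2) lr(1,4) _ at(2)]) (use distinct in auto)
  have sgn_ry: "sgn (ori (p a) (p b) (p ?r) y) = position_sign a b ?r ?s"
    by (rule sgn_three_singles[OF ab(1,2) lr(2,4) _ at(2)]) (use distinct in auto)
  have "sgn (ori (p a) (p b) x y) = sgn (ori (p a) (p b) (p ?l) y)"
  proof (rule pluecker_sign)
    show "ori (p a) (p b) (p ?l) (p ?r) * ori (p a) (p b) x y =
      ori (p a) (p b) (p ?l) x * ori (p a) (p b) (p ?r) y +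
      ori (p a) (p b) (p ?l) y * ori (p a) (p b) x (p ?r)"
      using grassmann_pluecker[of "p a" "p b" "p ?l" "p ?r" x y] swap34[of "p a" "p b" x "p ?r"] by simp
    show "ori (p a) (p b) (p ?l) (p ?r) \<noteq> 0"
      using sgn_lr position_sign_nonzero[of a b ?l ?r] distinct by auto
    show "sgn (ori (p a) (p b) (p ?l) x) = sgn (ori (p a) (p b) (p ?l) (p ?r))"
      unfolding sgn_lx sgn_lr by (simp add: position_sign_def adjacent)
    show "sgn (ori (p a) (p b) x (p ?r)) = sgn (ori (p a) (p b) (p ?l) (p ?r))"
      using sgn_rx swap34[of "p a" "p b" "p ?r" x] unfolding sgn_lr
      by (simp add: position_sign_def adjacent sgn_minus)
    show "sgn (ori (p a) (p b) (p ?r) y) = sgn (ori (p a) (p b) (p ?l) y)"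
      unfolding sgn_ly sgn_ry by (simp add: position_sign_def adjacent)
  qed
  also have "\<dots> = position_sign a b ?t ?s"
    unfolding sgn_ly by (simp add: position_sign_def adjacent)
  finally show ?thesis .
qed

lemma sgn_concordant_pair:
  assumes ij: "i < K" "j < K" "i \<noteq> j" "x \<in> C i" "y \<in> C j"
    and singles: "single q" "single l" "single r" "distinct [q, l, r]"
    and cone: "{q, l, r} \<inter> {4 * i + 1, 4 * i + 3} = {}" "in_cone q (4 * j + 2) l r (4 * i + 2)"
    and concordant: "ori (p q) (p l) y z * ori (p q) (p r) y z > 0"
  shows "sgn (ori (p q) x y z) = sgn (ori (p q) (p l) y z)"
proof -
  have distinct: "distinct [q, l, r, 4 * j + 2]" "distinct [q, 4 * j + 2, l, r]"
    using singles single_neq_cluster[of q j] single_neq_cluster[of l j] single_neq_cluster[of r j]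
    by auto
  have "sgn (ori (p q) (p l) (p r) y) = position_sign q l r (4 * j + 2)"
    using ij(2,5) singles(1-3) distinct(1) by (intro sgn_three_singles) auto
  then have lr: "sgn (ori (p q) y (p l) (p r)) = position_sign q (4 * j + 2) l r"
    using cycle234[of "p q" y "p l" "p r"] position_sign_cycle234[of q "4 * j + 2" l r] by simp
  have two: "sgn (ori (p q) (p t) x y) = position_sign q t (4 * i + 2) (4 * j + 2)" if "t \<in> {l, r}" for t
    using ij singles cone(1) that by (intro sgn_two_clusters) auto
  have "sgn (ori (p q) y x z) = sgn (ori (p q) y (p l) z)"
  proof (rule pluecker_sign)
    show "ori (p q) y (p l) (p r) * ori (p q) y x z =
      ori (p q) y (p l) x * ori (p q) y (p r) z + ori (p q) y (p l) z * ori (p q) y x (p r)"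
      using grassmann_pluecker[of "p q" y "p l" "p r" x z] swap34[of "p q" y x "p r"] by simp
    show "ori (p q) y (p l) (p r) \<noteq> 0"
      using lr position_sign_nonzero[OF distinct(2)] by auto
    show "sgn (ori (p q) y (p l) x) = sgn (ori (p q) y (p l) (p r))"
      using two[of l] cone(2) cycle234[of "p q" y "p l" x]
        position_sign_cycle234[of q "4 * j + 2" l "4 * i + 2"] unfolding lr in_cone_def by simp
    show "sgn (ori (p q) y x (p r)) = sgn (ori (p q) y (p l) (p r))"
      using two[of r] cone(2) cycle234'[of "p q" y x "p r"] swap34[of "p q" "p r" y x]
        position_sign_cycle234[of q r "4 * j + 2" "4 * i + 2"]
        position_sign_swap(3)[of q r "4 * j + 2" "4 * i + 2"]
      unfolding lr in_cone_def by (simp add: sgn_minus)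
    show "sgn (ori (p q) y (p r) z) = sgn (ori (p q) y (p l) z)"
      using concordant swap23[of "p q" "p l" y z] swap23[of "p q" "p r" y z]
      by (auto simp: sgn_if zero_less_mult_iff)
  qed
  then show ?thesis
    using swap23[of "p q" x y z] swap23[of "p q" "p l" y z] by (simp add: sgn_minus)
qed

lemma sees_one_sided_cluster:
  assumes "j < K" "Z \<subseteq> C j"
    and singles: "single q" "single l" "single r" "distinct [q, l, r]"
    and concordant: "concordant (p q) (p l) (p q) (p r) Z"
    and F: "\<And>i. i \<in> F \<Longrightarrow> i < K \<and> i \<noteq> j \<and> {q, l, r} \<inter> {4 * i + 1, 4 * i + 3} = {} \<and>
      in_cone q (4 * j + 2) l r (4 * i + 2)"
  shows "sees_one_sided X (p q) (p l) Z (\<Union>i\<in>F. C i)"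
  unfolding sees_one_sided_def
proof (intro conjI ballI impI)
  show qX: "p q \<in> X"
    using p_in_X singles(1) by blast
  show "strict_axis_order (p q) (p l) Z"
    using strict_axis_order_cluster[OF assms(1) singles(1,2)] singles(4) assms(2)
      strict_axis_order_subset
    by auto
  show "ori (p q) x y z \<noteq> 0" if "x \<in> Z" "y \<in> Z" "z \<in> Z" "distinct [x, y, z]" for x y z
  proof -
    have "distinct [p q, x, y, z]" "{p q, x, y, z} \<subseteq> X"
      using that p_neq_cluster[OF singles(1) assms(1)] assms(2) qX C_subset_X[OF assms(1)] by auto
    then show ?thesis
      using nondegenerate_X unfolding nondegenerate_def by blast
  qed
  fix y z x assume yz: "y \<in> Z" "z \<in> Z" "axis_less (p q) (p l) y z" and "x \<in> (\<Union>i\<in>F. C i)"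
  then obtain i where i: "i \<in> F" "x \<in> C i" by blast
  have "y \<noteq> z"
    using yz(3) by (auto simp: axis_less_def)
  then have "ori (p q) (p l) y z * ori (p q) (p r) y z > 0"
    using concordant yz(1,2) by (simp add: concordant_def)
  then have "sgn (ori (p q) x y z) = sgn (ori (p q) (p l) y z)"
    using F[OF i(1)] i(2) subsetD[OF assms(2) yz(1)] assms(1) singles
    by (intro sgn_concordant_pair[of i j x y q l r z]) auto
  then show "ori (p q) x y z > 0"
    using yz(3) by (simp add: axis_less_def sgn_if split: if_splits)
qed

text \<open>By concordance, the direction of any two points of \<open>W\<close> avoids the cone spanned by \<open>m\<close>, \<open>u\<close>, \<open>w\<close>,
  \<open>M\<close>, which contains all other clusters. The sign with respect to the axis \<open>m u\<close> decides whether the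
  separating planes pass through \<open>m\<close> or through \<open>u\<close>.\<close>
lemma concordant_has_one_sided_part:
  assumes "j < K" "W \<subseteq> C j" "s\<^sup>2 \<le> card W"
    and singles: "single m" "single u" "single w" "single M"
    and pos: "m < u" "u < 4 * j + 2" "4 * j + 2 < w" "w \<le> M"
    and concordant: "concordant (p u) (p M) (p m) (p w) W"
    and F: "\<And>i. i \<in> F \<Longrightarrow> i < K \<and> i \<noteq> j \<and> {m, u, w, M} \<inter> {4 * i + 1, 4 * i + 3} = {} \<and>
      (m < 4 * i + 2 \<and> 4 * i + 2 < u \<or> w < 4 * i + 2 \<and> 4 * i + 2 < M)"
  shows "has_one_sided_part X s (C j) (\<Union>i\<in>F. C i)"
proof -
  have fin: "finite W"
    using assms(1,2) finite_C finite_subset by blast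
  have order: "strict_axis_order (p m) (p u) W" "strict_axis_order (p m) (p w) W"
    using strict_axis_order_cluster[OF assms(1)] strict_axis_order_subset[OF _ assms(2)] singles pos
    by auto
  have cone_m: "in_cone m (4 * j + 2) u w (4 * i + 2)"
    and cone_u: "in_cone u (4 * j + 2) m M (4 * i + 2)" if i: "i \<in> F" for i
  proof -
    consider "m < 4 * i + 2" "4 * i + 2 < u" | "w < 4 * i + 2" "4 * i + 2 < M"
      using F[OF i] by blast
    then show "in_cone m (4 * j + 2) u w (4 * i + 2)" "in_cone u (4 * j + 2) m M (4 * i + 2)"
      by (cases; use pos in \<open>simp add: in_cone_def position_sign_def\<close>)+
  qed
  obtain Z where Z: "Z \<subseteq> W" "card Z = s"
    and "concordant (p m) (p u) (p m) (p w) Z \<or> discordant (p m) (p u) (p m) (p w) Z"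
    using concordant_or_discordant_part[OF fin _ order, of s s] assms(3) by (auto simp: power2_eq_square)
  then consider (agree) "concordant (p m) (p u) (p m) (p w) Z"
    | (disagree) "discordant (p m) (p u) (p m) (p w) Z"
    by blast
  then have "\<exists>q r. sees_one_sided X q r Z (\<Union>i\<in>F. C i)"
  proof cases
    case agree
    have "sees_one_sided X (p m) (p u) Z (\<Union>i\<in>F. C i)"
      by (rule sees_one_sided_cluster[OF assms(1) _ singles(1-3) _ agree])
        (use Z(1) assms(2) pos F cone_m in auto)
    then show ?thesis by blast
  next
    case disagree
    have "concordant (p u) (p m) (p u) (p M) Z"
      unfolding concordant_def
    proof (intro ballI impI)
      fix y z assume yz: "y \<in> Z" "z \<in> Z" "y \<noteq> z"
      then have "ori (p u) (p M) y z * ori (p m) (p w) y z > 0"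
        using concordant Z(1) unfolding concordant_def by blast
      moreover have "ori (p m) (p u) y z * ori (p m) (p w) y z < 0"
        using disagree yz unfolding discordant_def by blast
      ultimately show "ori (p u) (p m) y z * ori (p u) (p M) y z > 0"
        using swap12[of "p u" "p m" y z] by (auto simp: zero_less_mult_iff mult_less_0_iff)
    qed
    then have "sees_one_sided X (p u) (p m) Z (\<Union>i\<in>F. C i)"
      by (rule sees_one_sided_cluster[OF assms(1) _ singles(2,1,4), rotated 2])
        (use Z(1) assms(2) pos F cone_u in auto)
    then show ?thesis by blast
  qed
  then show ?thesis
    unfolding has_one_sided_part_def using Z assms(2) by blast
qed

definition globally_concordant :: "nat \<Rightarrow> 'p set \<Rightarrow> bool" where
  "globally_concordant j = concordant (p (4 * j + 1)) (p (4 * K)) (p 0) (p (4 * j + 3))"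

definition globally_discordant :: "nat \<Rightarrow> 'p set \<Rightarrow> bool" where
  "globally_discordant j = discordant (p (4 * j + 1)) (p (4 * K)) (p 0) (p (4 * j + 3))"

definition left_concordant :: "nat \<Rightarrow> nat \<Rightarrow> nat \<Rightarrow> 'p set \<Rightarrow> bool" where
  "left_concordant j a b = concordant (p (4 * a)) (p (4 * b)) (p (4 * j + 1)) (p (4 * K))"

definition right_concordant :: "nat \<Rightarrow> nat \<Rightarrow> nat \<Rightarrow> 'p set \<Rightarrow> bool" where
  "right_concordant j a b = concordant (p (4 * a)) (p (4 * b)) (p 0) (p (4 * j + 3))"

lemma globally_concordant_has_one_sided_part:
  assumes "j < K" "W \<subseteq> C j" "s\<^sup>2 \<le> card W"
    and concordant: "globally_concordant j W"
  shows "has_one_sided_part X s (C j) (\<Union>i\<in>{..<K} - {j}. C i)"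
proof (rule concordant_has_one_sided_part[OF assms(1-3) _ _ _ _ _ _ _ _
      concordant[unfolded globally_concordant_def]])
  show "single 0" "single (4 * j + 1)" "single (4 * j + 3)" "single (4 * K)"
    using single_multiple[of 0] single_multiple[of K] single_neighbours[OF assms(1)] by auto
  show "i < K \<and> i \<noteq> j \<and> {0, 4 * j + 1, 4 * j + 3, 4 * K} \<inter> {4 * i + 1, 4 * i + 3} = {} \<and>
    (0 < 4 * i + 2 \<and> 4 * i + 2 < 4 * j + 1 \<or> 4 * j + 3 < 4 * i + 2 \<and> 4 * i + 2 < 4 * K)"
    if "i \<in> {..<K} - {j}" for i
    using that by auto
qed (use assms(1) in auto)

lemma left_concordant_has_one_sided_part:
  assumes "a \<le> j" "j < b" "b \<le> K" "W \<subseteq> C j" "s\<^sup>2 \<le> card W"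
    and "left_concordant j a b W"
  shows "has_one_sided_part X s (C j) (\<Union>i\<in>{a..<K} - {j..<b}. C i)"
proof -
  have j: "j < K"
    using assms(2,3) by simp
  have "concordant (p (4 * j + 1)) (p (4 * K)) (p (4 * a)) (p (4 * b)) W"
    using assms(6) concordant_commute unfolding left_concordant_def by blast
  then show ?thesis
  proof (rule concordant_has_one_sided_part[OF j assms(4,5), rotated 8])
    show "single (4 * a)" "single (4 * j + 1)" "single (4 * b)" "single (4 * K)"
      using single_multiple[of a] single_multiple[of b] single_multiple[of K]
        single_neighbours[OF j] assms by auto
    show "i < K \<and> i \<noteq> j \<and> {4 * a, 4 * j + 1, 4 * b, 4 * K} \<inter> {4 * i + 1, 4 * i + 3} = {} \<and>
      (4 * a < 4 * i + 2 \<and> 4 * i + 2 < 4 * j + 1 \<or> 4 * b < 4 * i + 2 \<and> 4 * i + 2 < 4 * K)"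
      if "i \<in> {a..<K} - {j..<b}" for i
      using that assms(2) by auto
  qed (use assms(1-3) in auto)
qed

lemma right_concordant_has_one_sided_part:
  assumes "0 < u" "u \<le> j" "j < b" "b \<le> K" "W \<subseteq> C j" "s\<^sup>2 \<le> card W"
    and concordant: "right_concordant j u b W"
  shows "has_one_sided_part X s (C j) (\<Union>i\<in>{..<b} - {u..j}. C i)"
proof -
  have j: "j < K"
    using assms(3,4) by simp
  show ?thesis
  proof (rule concordant_has_one_sided_part[OF j assms(5,6) _ _ _ _ _ _ _ _
        concordant[unfolded right_concordant_def]])
    show "single 0" "single (4 * u)" "single (4 * j + 3)" "single (4 * b)"
      using single_multiple[of 0] single_multiple[of u] single_multiple[of b]
        single_neighbours[OF j] assms by auto
    show "i < K \<and> i \<noteq> j \<and> {0, 4 * u, 4 * j + 3, 4 * b} \<inter> {4 * i + 1, 4 * i + 3} = {} \<and>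
      (0 < 4 * i + 2 \<and> 4 * i + 2 < 4 * u \<or> 4 * j + 3 < 4 * i + 2 \<and> 4 * i + 2 < 4 * b)"
      if "i \<in> {..<b} - {u..j}" for i
      using that assms(2,4) by auto
  qed (use assms(1-4) in auto)
qed

lemma one_sided_clusters_combine:
  assumes F: "F \<subseteq> {..<K}" "n \<le> card F * l" and s: "(2 * n + 2 * l) choose (2 * l) < s"
    and part: "\<And>j. j \<in> F \<Longrightarrow> \<exists>U. F - {j} \<subseteq> U \<and> has_one_sided_part X s (C j) (\<Union>i\<in>U. C i)"
  shows "cut_off_points X n"
proof (rule one_sided_parts_combine[OF _ F(2) finite_X _ s])
  show "finite F"
    using F(1) finite_subset by blast
  show "C j \<subseteq> X" if "j \<in> F" for j
    using that F(1) C_subset_X by blast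
  fix j assume "j \<in> F"
  then obtain U where "F - {j} \<subseteq> U" "has_one_sided_part X s (C j) (\<Union>i\<in>U. C i)"
    using part by blast
  then show "has_one_sided_part X s (C j) (\<Union>i\<in>F - {j}. C i)"
    by (meson UN_mono has_one_sided_part_mono order_refl)
qed

lemma cut_off_points_of_globally_concordant:
  assumes "F \<subseteq> {..<K}" "n \<le> card F * l" "(2 * n + 2 * l) choose (2 * l) < s"
    and "\<And>j. j \<in> F \<Longrightarrow> \<exists>W\<subseteq>C j. card W = s\<^sup>2 \<and> globally_concordant j W"
  shows "cut_off_points X n"
proof (rule one_sided_clusters_combine[OF assms(1-3)])
  fix j assume j: "j \<in> F"
  then obtain W where "W \<subseteq> C j" "card W = s\<^sup>2" "globally_concordant j W"
    using assms(4) by blast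
  then have "has_one_sided_part X s (C j) (\<Union>i\<in>{..<K} - {j}. C i)"
    using j assms(1) by (intro globally_concordant_has_one_sided_part[of j W]) auto
  then show "\<exists>U. F - {j} \<subseteq> U \<and> has_one_sided_part X s (C j) (\<Union>i\<in>U. C i)"
    using assms(1) by blast
qed

lemma cut_off_points_of_separated_clusters:
  assumes F: "F \<subseteq> {a..<K}" "n \<le> card F * l" and s: "(2 * n + 2 * l) choose (2 * l) < s"
    and separated: "separated_by (\<lambda>j b. \<exists>W\<subseteq>C j. card W = s\<^sup>2 \<and> left_concordant j a b W) K F"
  shows "cut_off_points X n"
proof (rule one_sided_clusters_combine[OF _ F(2) s])
  show "F \<subseteq> {..<K}"
    using F(1) by auto
  fix j assume j: "j \<in> F"
  then obtain b W where b: "j < b" "b \<le> K" "\<forall>i\<in>F. j < i \<longrightarrow> b \<le> i"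
    and W: "W \<subseteq> C j" "card W = s\<^sup>2" "left_concordant j a b W"
    using separated unfolding separated_by_def by blast
  have "has_one_sided_part X s (C j) (\<Union>i\<in>{a..<K} - {j..<b}. C i)"
    using j F(1) b(1,2) W by (intro left_concordant_has_one_sided_part[of a j b W]) auto
  moreover have "F - {j} \<subseteq> {a..<K} - {j..<b}"
    using F(1) b(3) by force
  ultimately show "\<exists>U. F - {j} \<subseteq> U \<and> has_one_sided_part X s (C j) (\<Union>i\<in>U. C i)"
    by blast
qed

lemma cut_off_points_of_nested_clusters:
  assumes F: "F \<subseteq> {..<K}" "n \<le> card F * l" and s: "(2 * n + 2 * l) choose (2 * l) < s"
    and nested: "nested_by (\<lambda>j u b. \<exists>W\<subseteq>C j. s\<^sup>2 \<le> card W \<and> right_concordant j u b W) \<beta> K F"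
  shows "cut_off_points X n"
proof (rule one_sided_clusters_combine[OF F s])
  fix j assume j: "j \<in> F"
  then obtain u b W where u: "\<beta> < u" "u \<le> j" and b: "b \<le> K" "\<forall>i\<in>F. i < b \<and> (i < j \<longrightarrow> i < u)"
    and W: "W \<subseteq> C j" "s\<^sup>2 \<le> card W" "right_concordant j u b W"
    using nested unfolding nested_by_def by blast
  have "has_one_sided_part X s (C j) (\<Union>i\<in>{..<b} - {u..j}. C i)"
    using j u b W by (intro right_concordant_has_one_sided_part[of u j b W]) auto
  moreover have "F - {j} \<subseteq> {..<b} - {u..j}"
    using b(2) by force
  ultimately show "\<exists>U. F - {j} \<subseteq> U \<and> has_one_sided_part X s (C j) (\<Union>i\<in>U. C i)"
    by blast
qed

text \<open>In a block of clusters without large globally concordant parts, each answer to a comparison of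
  the axis through \<open>4 * a\<close> and \<open>4 * b\<close> makes a cluster one-sided, either with respect to the clusters
  to the right of \<open>a\<close> or with respect to those to the left of \<open>b\<close>.\<close>
lemma left_or_right_concordant_part:
  assumes j: "a \<le> j" "j < b" "b \<le> K" and W: "W \<subseteq> C j" "s * t \<le> card W" "globally_discordant j W"
  shows "(\<exists>W'\<subseteq>W. card W' = s \<and> left_concordant j a b W') \<or>
    (\<exists>W'\<subseteq>W. card W' = t \<and> right_concordant j a b W')"
proof -
  have "j < K"
    using j by simp
  then have fin: "finite W"
    using W(1) finite_C finite_subset by blast
  have order: "strict_axis_order (p (4 * a)) (p (4 * b)) W"
    "strict_axis_order (p (4 * j + 1)) (p (4 * K)) W"
    using strict_axis_order_cluster[OF \<open>j < K\<close>] strict_axis_order_subset[OF _ W(1)]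
      single_multiple[of a] single_multiple[of b] single_multiple[of K] single_neighbours[OF \<open>j < K\<close>] j
    by auto
  have "right_concordant j a b W'"
    if "W' \<subseteq> W" "discordant (p (4 * a)) (p (4 * b)) (p (4 * j + 1)) (p (4 * K)) W'" for W'
    using discordant_trans[OF that(2)] discordant_subset[OF _ that(1)] W(3)
    unfolding globally_discordant_def right_concordant_def by blast
  then show ?thesis
    unfolding left_concordant_def using concordant_or_discordant_part[OF fin W(2) order] by blast
qed

lemma cut_off_points_of_discordant_block:
  assumes block: "\<beta> + stage_size k R \<le> K"
    and Z: "\<And>j. Z j \<subseteq> C j" "\<And>j. globally_discordant j (Z j)"
      "\<And>j. j \<in> {\<beta>..<\<beta> + stage_size k R} \<Longrightarrow> (s\<^sup>2) ^ R * s'\<^sup>2 \<le> card (Z j)"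
    and s: "(2 * n + 2 * l) choose (2 * l) < s" "n \<le> k * l"
    and s': "(2 * n + 2 * l') choose (2 * l') < s'" "n \<le> R * l'"
  shows "cut_off_points X n"
proof -
  have "(\<exists>W'\<subseteq>W. card W' = s\<^sup>2 \<and> left_concordant j a b W') \<or>
      (\<exists>W'\<subseteq>W. card W' = t \<and> right_concordant j a b W')"
    if "a \<le> j" "j < b" "b \<le> K" "W \<subseteq> Z j" "s\<^sup>2 * t \<le> card W" for j a b W t
  proof (rule left_or_right_concordant_part[OF that(1-3) _ that(5)])
    show "W \<subseteq> C j"
      using that(4) Z(1) by blast
    show "globally_discordant j W"
      using Z(2) discordant_subset that(4) unfolding globally_discordant_def by blast
  qed
  moreover have "0 < s\<^sup>2"
    using s(1) by simp
  ultimately have "(\<exists>a F. F \<subseteq> {a..<K} \<and> card F = k \<and>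
        separated_by (\<lambda>j b. \<exists>W\<subseteq>Z j. card W = s\<^sup>2 \<and> left_concordant j a b W) K F) \<or>
      (\<exists>F\<subseteq>{\<beta><..<\<beta> + stage_size k R}. card F = R \<and>
        nested_by (\<lambda>j u b. \<exists>W\<subseteq>Z j. s'\<^sup>2 \<le> card W \<and> right_concordant j u b W) \<beta> K F)"
    using block Z(3) by (intro query_game[where Z = Z]) auto
  then consider (left) a F where "F \<subseteq> {a..<K}" "card F = k"
      "separated_by (\<lambda>j b. \<exists>W\<subseteq>Z j. card W = s\<^sup>2 \<and> left_concordant j a b W) K F"
    | (right) F where "F \<subseteq> {\<beta><..<\<beta> + stage_size k R}" "card F = R"
      "nested_by (\<lambda>j u b. \<exists>W\<subseteq>Z j. s'\<^sup>2 \<le> card W \<and> right_concordant j u b W) \<beta> K F"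
    by blast
  then show ?thesis
  proof cases
    case left
    have "separated_by (\<lambda>j b. \<exists>W\<subseteq>C j. card W = s\<^sup>2 \<and> left_concordant j a b W) K F"
      using left(3) Z(1) unfolding separated_by_def by (meson order_trans)
    then show ?thesis
      using cut_off_points_of_separated_clusters[OF left(1) _ s(1)] left(2) s(2) by simp
  next
    case right
    have "nested_by (\<lambda>j u b. \<exists>W\<subseteq>C j. s'\<^sup>2 \<le> card W \<and> right_concordant j u b W) \<beta> K F"
      using right(3) Z(1) unfolding nested_by_def by (meson order_trans)
    moreover have "F \<subseteq> {..<K}"
      using right(1) block by auto
    ultimately show ?thesis
      using cut_off_points_of_nested_clusters[of F n l' s' \<beta>] right(2) s' by simp
  qed
qed

lemma cut_off_points_of_clusters:
  assumes K: "K = k * stage_size k R"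
    and size: "\<And>j. j < K \<Longrightarrow> s\<^sup>2 * ((s\<^sup>2) ^ R * s'\<^sup>2) \<le> card (C j)"
    and s: "(2 * n + 2 * l) choose (2 * l) < s" "n \<le> k * l"
    and s': "(2 * n + 2 * l') choose (2 * l') < s'" "n \<le> R * l'"
  shows "cut_off_points X n"
proof -
  let ?succeeds = "\<lambda>j. \<exists>W\<subseteq>C j. card W = s\<^sup>2 \<and> globally_concordant j W"
  consider (succeed) F where "F \<subseteq> {..<K}" "card F = k" "\<forall>j\<in>F. ?succeeds j"
    | (fail) \<beta> where "\<beta> + stage_size k R \<le> K" "\<forall>j\<in>{\<beta>..<\<beta> + stage_size k R}. \<not> ?succeeds j"
    using separated_set_or_block[of 0 k "stage_size k R" "\<lambda>j _. ?succeeds j"]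
    unfolding separated_by_def add_0 K[symmetric] atLeast0LessThan by blast
  then show ?thesis
  proof cases
    case succeed
    then show ?thesis
      using s cut_off_points_of_globally_concordant[of F n l s] by blast
  next
    case fail
    let ?B = "{\<beta>..<\<beta> + stage_size k R}"
    have "\<exists>Z\<subseteq>C j. globally_discordant j Z \<and> (j \<in> ?B \<longrightarrow> card Z = (s\<^sup>2) ^ R * s'\<^sup>2)" for j
    proof (cases "j \<in> ?B")
      case True
      then have j: "j < K"
        using fail(1) by auto
      have order: "strict_axis_order (p (4 * j + 1)) (p (4 * K)) (C j)"
        "strict_axis_order (p 0) (p (4 * j + 3)) (C j)"
        using strict_axis_order_cluster[OF j] single_neighbours[OF j]
          single_multiple[of 0] single_multiple[of K] j
        by auto
      have "\<not> ?succeeds j"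
        using fail(2) True by blast
      then show ?thesis
        using concordant_or_discordant_part[OF finite_C[OF j] size[OF j] order]
        unfolding globally_concordant_def globally_discordant_def by blast
    next
      case False
      then show ?thesis
        by (intro exI[of _ "{}"]) (auto simp: globally_discordant_def discordant_def)
    qed
    then obtain Z where "\<And>j. Z j \<subseteq> C j" "\<And>j. globally_discordant j (Z j)"
      "\<And>j. j \<in> ?B \<Longrightarrow> card (Z j) = (s\<^sup>2) ^ R * s'\<^sup>2"
      by metis
    then show ?thesis
      using cut_off_points_of_discordant_block[OF fail(1) _ _ _ s s', of Z] by simp
  qed
qed

end

section \<open>Existence of clusters\<close>

definition cluster_indices :: "nat \<Rightarrow> nat set \<Rightarrow> nat set" where
  "cluster_indices K H = (\<lambda>j. enumerate H (4 * j + 2)) ` {..<K}"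

lemma bij_betw_enumerate:
  assumes "card H = 4 * K + 1"
  shows "bij_betw (enumerate H) {..4 * K} H"
proof -
  have "finite H"
    using assms card.infinite by fastforce
  then show ?thesis
    using finite_bij_enumerate[of H] assms by (simp add: lessThan_Suc_atMost)
qed

lemma card_cluster_indices:
  assumes "card H = 4 * K + 1"
  shows "cluster_indices K H \<subseteq> H" "card (cluster_indices K H) = K"
proof -
  show "cluster_indices K H \<subseteq> H"
    using bij_betw_apply[OF bij_betw_enumerate[OF assms]] by (auto simp: cluster_indices_def)
  have "inj_on (\<lambda>j. enumerate H (4 * j + 2)) {..<K}"
  proof (rule inj_onI)
    fix i j assume "i \<in> {..<K}" "j \<in> {..<K}" "enumerate H (4 * i + 2) = enumerate H (4 * j + 2)"
    then show "i = j"
      using inj_onD[OF bij_betw_imp_inj_on[OF bij_betw_enumerate[OF assms]], of "4 * i + 2" "4 * j + 2"]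
      by simp
  qed
  then show "card (cluster_indices K H) = K"
    by (simp add: cluster_indices_def card_image)
qed

lemma enumerate_notin_cluster_indices:
  assumes "card H = 4 * K + 1" "t \<le> 4 * K" "t mod 4 \<noteq> 2"
  shows "enumerate H t \<in> H - cluster_indices K H"
proof -
  have "enumerate H t \<noteq> enumerate H (4 * j + 2)" if "j < K" for j
  proof -
    have "t \<noteq> 4 * j + 2"
      using assms(3) by presburger
    then show ?thesis
      using inj_onD[OF bij_betw_imp_inj_on[OF bij_betw_enumerate[OF assms(1)]], of t "4 * j + 2"]
        assms(2) that by auto
  qed
  then show ?thesis
    using bij_betw_apply[OF bij_betw_enumerate[OF assms(1)]] assms(2) by (auto simp: cluster_indices_def)
qed

context chirotope
begin

definition signed_ori :: "bool \<Rightarrow> 'p \<Rightarrow> 'p \<Rightarrow> 'p \<Rightarrow> 'p \<Rightarrow> real" where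
  "signed_ori \<sigma> = (if \<sigma> then ori else (\<lambda>a b c d. - ori a b c d))"

lemma chirotope_signed_ori: "chirotope (signed_ori \<sigma>)"
  using chirotope_uminus chirotope_axioms by (simp add: signed_ori_def)

lemma cut_off_points_signed_ori:
  "chirotope.cut_off_points (signed_ori \<sigma>) X n \<Longrightarrow> cut_off_points X n"
  using cut_off_points_uminus by (simp add: signed_ori_def split: if_splits)

definition homogeneous :: "bool \<Rightarrow> nat set \<Rightarrow> (nat \<Rightarrow> 'p) \<Rightarrow> bool" where
  "homogeneous \<sigma> H f \<longleftrightarrow> on_sorted_quadruples H (\<lambda>a b c d. signed_ori \<sigma> (f a) (f b) (f c) (f d) > 0)"

lemma ramsey_homogeneous:
  "\<exists>R. \<forall>X f. nondegenerate X \<longrightarrow> inj_on f {..<R} \<longrightarrow> f ` {..<R} \<subseteq> X \<longrightarrow>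
     (\<exists>H \<sigma>. H \<subseteq> {..<R} \<and> card H = L \<and> homogeneous \<sigma> H f)"
proof -
  obtain R where R: "\<forall>P :: nat \<Rightarrow> nat \<Rightarrow> nat \<Rightarrow> nat \<Rightarrow> bool. \<exists>H \<sigma>. H \<subseteq> {..<R} \<and> card H = L \<and>
      on_sorted_quadruples H (\<lambda>a b c d. P a b c d = \<sigma>)"
    using ramsey_sorted_quadruples[of L] by blast
  have "\<exists>H \<sigma>. H \<subseteq> {..<R} \<and> card H = L \<and> homogeneous \<sigma> H f"
    if X: "nondegenerate X" and f: "inj_on f {..<R}" "f ` {..<R} \<subseteq> X" for X f
  proof -
    obtain H \<sigma> where H: "H \<subseteq> {..<R}" "card H = L"
      and sign: "on_sorted_quadruples H (\<lambda>a b c d. (ori (f a) (f b) (f c) (f d) > 0) = \<sigma>)"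
      using R[THEN spec, of "\<lambda>a b c d. ori (f a) (f b) (f c) (f d) > 0"] by blast
    have "ori (f a) (f b) (f c) (f d) \<noteq> 0" if "{a, b, c, d} \<subseteq> H" "a < b" "b < c" "c < d" for a b c d
    proof -
      have "distinct [f a, f b, f c, f d]" "{f a, f b, f c, f d} \<subseteq> X"
        using that H(1) f by (auto dest!: inj_onD)
      then show ?thesis
        using X unfolding nondegenerate_def by blast
    qed
    then have "homogeneous \<sigma> H f"
      using sign unfolding homogeneous_def on_sorted_quadruples_def signed_ori_def
      by (auto simp: neq_iff)
    then show ?thesis using H by blast
  qed
  then show ?thesis by blast
qed

lemma homogeneous_enumerate:
  assumes "card H = 4 * K + 1" "homogeneous \<sigma> H f"
  shows "homogeneous \<sigma> {..4 * K} (f \<circ> enumerate H)"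
proof -
  have "finite H"
    using assms(1) card.infinite by fastforce
  then have "enumerate H a < enumerate H b" if "a < b" "b \<le> 4 * K" for a b
    using that assms(1) by (simp add: finite_enumerate_mono)
  then show ?thesis
    using assms(2) bij_betw_apply[OF bij_betw_enumerate[OF assms(1)]]
    unfolding homogeneous_def on_sorted_quadruples_def by simp
qed

definition homogeneous_clusters :: "bool \<Rightarrow> nat \<Rightarrow> (nat \<Rightarrow> 'p) \<Rightarrow> (nat \<Rightarrow> 'p set) \<Rightarrow> bool" where
  "homogeneous_clusters \<sigma> K p C \<longleftrightarrow> (\<forall>j<K. C j \<noteq> {} \<and> (\<forall>x\<in>C j.
     \<exists>f. homogeneous \<sigma> {..4 * K} f \<and> f (4 * j + 2) = x \<and> (\<forall>t\<le>4 * K. t mod 4 \<noteq> 2 \<longrightarrow> f t = p t)))"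

lemma homogeneous_clustersE:
  assumes "homogeneous_clusters \<sigma> K p C" "0 < K"
    and T: "T \<subseteq> {..4 * K}" "at_most_one_cluster T" "\<And>t. t \<in> T \<Longrightarrow> h t \<in> points_at p C t"
  obtains f where "homogeneous \<sigma> {..4 * K} f" "\<And>t. t \<in> T \<Longrightarrow> f t = h t"
proof -
  obtain j x where j: "j < K" "x \<in> C j" "\<And>t. t \<in> T \<Longrightarrow> t mod 4 = 2 \<Longrightarrow> t = 4 * j + 2 \<and> h t = x"
  proof (cases "\<exists>t\<in>T. t mod 4 = 2")
    case True
    then obtain t where t: "t \<in> T" "t mod 4 = 2" by blast
    then have t_eq: "t = 4 * (t div 4) + 2"
      by presburger
    show ?thesis
    proof (rule that[of "t div 4" "h t"])
      have "t \<le> 4 * K"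
        using t(1) T(1) by auto
      then show "t div 4 < K"
        using t(2) by presburger
      show "h t \<in> C (t div 4)"
        using T(3)[OF t(1)] t(2) by (simp add: points_at_def)
      show "u = 4 * (t div 4) + 2 \<and> h u = h t" if "u \<in> T" "u mod 4 = 2" for u
        using that T(2) t t_eq unfolding at_most_one_cluster_def by metis
    qed
  next
    case False
    then show ?thesis
      using that[of 0] assms(1,2) unfolding homogeneous_clusters_def by blast
  qed
  then obtain f where f: "homogeneous \<sigma> {..4 * K} f" "f (4 * j + 2) = x"
    "\<And>t. t \<le> 4 * K \<Longrightarrow> t mod 4 \<noteq> 2 \<Longrightarrow> f t = p t"
    using assms(1) unfolding homogeneous_clusters_def by blast
  have "f t = h t" if "t \<in> T" for t
  proof (cases "t mod 4 = 2")
    case True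
    then show ?thesis
      using j(3)[OF that] f(2) by auto
  next
    case False
    then show ?thesis
      using f(3)[of t] T(1) T(3)[OF that] that by (auto simp: points_at_def)
  qed
  then show ?thesis
    using that f(1) by blast
qed

lemma moment_clustersI:
  assumes "finite X" "nondegenerate X" and X: "\<And>t. t \<le> 4 * K \<Longrightarrow> points_at p C t \<subseteq> X"
    and "0 < K" "homogeneous_clusters \<sigma> K p C"
  shows "moment_clusters (signed_ori \<sigma>) X K p C"
proof -
  interpret signed: chirotope "signed_ori \<sigma>" by (rule chirotope_signed_ori)
  show ?thesis
  proof
    show "finite X" by fact
    show "signed.nondegenerate X"
      unfolding signed.nondegenerate_def using assms(2) by (simp add: nondegenerate_def signed_ori_def)
    show "points_at p C t \<subseteq> X" if "t \<le> 4 * K" for t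
      by (rule X[OF that])
    fix a b c d x y z w
    assume sorted: "a < b" "b < c" "c < d" "d \<le> 4 * K" and one: "at_most_one_cluster {a, b, c, d}"
      and pts: "x \<in> points_at p C a" "y \<in> points_at p C b" "z \<in> points_at p C c" "w \<in> points_at p C d"
    define h where "h = ((\<lambda>_. w)(a := x, b := y, c := z))"
    have "h t \<in> points_at p C t" if "t \<in> {a, b, c, d}" for t
      using that sorted pts by (auto simp: h_def)
    moreover have "{a, b, c, d} \<subseteq> {..4 * K}"
      using sorted by auto
    ultimately obtain f where f: "homogeneous \<sigma> {..4 * K} f" "\<And>t. t \<in> {a, b, c, d} \<Longrightarrow> f t = h t"
      using homogeneous_clustersE[OF assms(5,4) _ one] by blast
    have "f a = x" "f b = y" "f c = z" "f d = w"
      using sorted f(2) by (auto simp: h_def)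
    moreover have "signed_ori \<sigma> (f a) (f b) (f c) (f d) > 0"
      using f(1) sorted unfolding homogeneous_def on_sorted_quadruples_def by simp
    ultimately show "signed_ori \<sigma> x y z w > 0" by simp
  qed
qed

lemma moment_clusters_of_homogeneous_set:
  assumes X: "finite X" "nondegenerate X" and "0 < K" and H: "H \<subseteq> I" "card H = 4 * K + 1"
    and g: "g ` (I - cluster_indices K H) \<subseteq> X"
    and B: "\<And>v. v \<in> cluster_indices K H \<Longrightarrow> B v \<subseteq> X \<and> B v \<noteq> {}"
    and extend: "\<And>v x. v \<in> cluster_indices K H \<Longrightarrow> x \<in> B v \<Longrightarrow>
      \<exists>f. homogeneous \<sigma> H f \<and> f v = x \<and> (\<forall>i\<in>I - cluster_indices K H. f i = g i)"
  shows "moment_clusters (signed_ori \<sigma>) X K (g \<circ> enumerate H) (\<lambda>j. B (enumerate H (4 * j + 2)))"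
proof (rule moment_clustersI[OF X _ assms(3)])
  let ?e = "enumerate H"
  let ?p = "g \<circ> ?e" and ?C = "\<lambda>j. B (?e (4 * j + 2))"
  have cluster: "?e (4 * j + 2) \<in> cluster_indices K H" if "j < K" for j
    using that by (auto simp: cluster_indices_def)
  have single: "?e t \<in> I - cluster_indices K H" if "t \<le> 4 * K" "t mod 4 \<noteq> 2" for t
    using enumerate_notin_cluster_indices[OF H(2) that] H(1) by blast
  show "points_at ?p ?C t \<subseteq> X" if "t \<le> 4 * K" for t
  proof (cases "t mod 4 = 2")
    case True
    then have "t div 4 < K" "t = 4 * (t div 4) + 2"
      using that by presburger+
    then show ?thesis
      using B cluster by (metis points_at_cluster(1))
  next
    case False
    then show ?thesis
      using g single[OF that] by (auto simp: points_at_def)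
  qed
  have "\<exists>f. homogeneous \<sigma> {..4 * K} f \<and> f (4 * j + 2) = x \<and> (\<forall>t\<le>4 * K. t mod 4 \<noteq> 2 \<longrightarrow> f t = ?p t)"
    if jx: "j < K" "x \<in> ?C j" for j x
  proof -
    obtain f where f: "homogeneous \<sigma> H f" "f (?e (4 * j + 2)) = x"
      "\<forall>i\<in>I - cluster_indices K H. f i = g i"
      using extend[OF cluster[OF jx(1)] jx(2)] by blast
    then show ?thesis
      using homogeneous_enumerate[OF H(2) f(1)] single by (intro exI[of _ "f \<circ> ?e"]) simp
  qed
  then show "homogeneous_clusters \<sigma> K ?p ?C"
    using B cluster unfolding homogeneous_clusters_def by blast
qed

lemma moment_clusters_exist:
  assumes "0 < K"
  shows "\<exists>R D. \<forall>X s. finite X \<longrightarrow> nondegenerate X \<longrightarrow> 0 < s \<longrightarrow> R * s \<le> card X \<longrightarrow>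
    (\<exists>\<sigma> p C. moment_clusters (signed_ori \<sigma>) X K p C \<and> (\<forall>j<K. s \<le> D * card (C j)))"
proof -
  obtain R where ramsey: "\<forall>X f. nondegenerate X \<longrightarrow> inj_on f {..<R} \<longrightarrow> f ` {..<R} \<subseteq> X \<longrightarrow>
    (\<exists>H \<sigma>. H \<subseteq> {..<R} \<and> card H = 4 * K + 1 \<and> homogeneous \<sigma> H f)"
    using ramsey_homogeneous[of "4 * K + 1"] by blast
  define T where "T = {H. H \<subseteq> {..<R} \<and> card H = 4 * K + 1} \<times> (UNIV :: bool set)"
  have T: "finite T"
    by (simp add: T_def)
  let ?V = "\<lambda>t :: nat set \<times> bool. cluster_indices K (fst t)"
  have V: "?V t \<subseteq> {..<R} \<and> card (?V t) = K" if "t \<in> T" for t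
    using that card_cluster_indices[of "fst t" K] unfolding T_def by fastforce
  have "\<exists>\<sigma> p C. moment_clusters (signed_ori \<sigma>) X K p C \<and> (\<forall>j<K. s \<le> card T * card (C j))"
    if X: "finite X" "nondegenerate X" and s: "0 < s" "R * s \<le> card X" for X s
  proof -
    have type: "\<exists>t\<in>T. homogeneous (snd t) (fst t) f" if "inj_on f {..<R}" "f ` {..<R} \<subseteq> X" for f
      using ramsey[rule_format, OF X(2) that] by (auto simp: T_def)
    obtain t g B where t: "t \<in> T" and g: "g ` ({..<R} - ?V t) \<subseteq> X"
      and B: "\<forall>v\<in>?V t. B v \<subseteq> X \<and> card (B v) \<le> s"
      and extend: "\<forall>v\<in>?V t. \<forall>x\<in>B v.
        \<exists>f. homogeneous (snd t) (fst t) f \<and> f v = x \<and> (\<forall>i\<in>{..<R} - ?V t. f i = g i)"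
      and prod: "s ^ K \<le> card T * (\<Prod>v\<in>?V t. card (B v))"
      by (rule positive_fraction_selection[OF X(1) s(2,1) T type V]) (assumption | rule that)+
    have large: "s \<le> card T * card (B v)" if "v \<in> ?V t" for v
      using each_factor_large[of "?V t" "\<lambda>v. card (B v)" s v "card T"] V[OF t] B s(1) prod that
      by (metis finite_lessThan finite_subset)
    have "moment_clusters (signed_ori (snd t)) X K (g \<circ> enumerate (fst t))
        (\<lambda>j. B (enumerate (fst t) (4 * j + 2)))"
    proof (rule moment_clusters_of_homogeneous_set[OF X assms _ _ g])
      show "fst t \<subseteq> {..<R}" "card (fst t) = 4 * K + 1"
        using t by (auto simp: T_def)
      show "B v \<subseteq> X \<and> B v \<noteq> {}" if "v \<in> ?V t" for v
        using B large[OF that] s(1) that by (metis card.empty mult_0_right not_less)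
    qed (use extend in blast)
    then show ?thesis
      using large by (fastforce simp: cluster_indices_def)
  qed
  then show ?thesis by blast
qed

end

section \<open>Subexponentially many points suffice\<close>

lemma binomial_le_exp:
  fixes x :: real
  assumes "0 < x"
  shows "real (n choose k) \<le> exp (x * real n - ln x * real k)"
proof (cases "k \<le> n")
  case True
  then have "real (n choose k) * x ^ k \<le> (\<Sum>i\<le>n. real (n choose i) * x ^ i)"
    using assms by (intro member_le_sum[of k "{..n}" "\<lambda>i. real (n choose i) * x ^ i"]) auto
  also have "\<dots> = (1 + x) ^ n"
    using binomial_ring[of x 1 n] by (simp add: add.commute)
  also have "\<dots> \<le> exp x ^ n"
    using assms exp_ge_add_one_self[of x] by (intro power_mono) auto
  finally have "real (n choose k) \<le> exp x ^ n / x ^ k"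
    using assms by (simp add: field_simps)
  also have "\<dots> = exp (x * real n - ln x * real k)"
    using assms by (simp add: exp_diff mult.commute[of _ "real _"] exp_of_nat_mult)
  finally show ?thesis .
qed (simp add: binomial_eq_0)

text \<open>More than \<open>chain_bound n r\<close> points with convex or concave triples contain \<open>2 * n + 2\<close> of the one
  kind or at least \<open>2 * (n / r) + 2\<close> of the other.\<close>
definition chain_bound :: "nat \<Rightarrow> nat \<Rightarrow> nat" where
  "chain_bound n r = (2 * n + 2 * (n div r + 1)) choose (2 * (n div r + 1))"

lemma chain_bound_subexponential:
  fixes \<mu> :: real
  assumes "0 < \<mu>"
  shows "\<exists>r>0. \<forall>\<^sub>F n in sequentially. real (chain_bound n r) < 2 powr (\<mu> * real n)"
proof -
  define E where "E = \<mu> * ln 2"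
  define x where "x = min (1 / 2) (E / 8)"
  define d where "d = x - ln x"
  have E: "0 < E"
    using assms by (simp add: E_def)
  then have x: "0 < x" "x < 1" "x \<le> E / 8"
    by (auto simp: x_def)
  then have d: "0 < d"
    using ln_less_zero[of x] by (simp add: d_def)
  obtain r :: nat where r: "8 * d / E < real r"
    using reals_Archimedean2 by blast
  then have "0 < real r"
    using d E by (meson divide_pos_pos less_trans mult_pos_pos zero_less_numeral)
  then have d_r: "d / real r \<le> E / 8"
    using r E by (simp add: field_simps)
  have "\<forall>\<^sub>F n in sequentially. 4 * d / E < real n"
    using filterlim_real_sequentially by (simp add: filterlim_at_top_dense)
  then have "\<forall>\<^sub>F n in sequentially. real (chain_bound n r) < 2 powr (\<mu> * real n)"
  proof eventually_elim
    case (elim n)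
    define l where "l = n div r + 1"
    have l: "real l \<le> real n / real r + 1"
      using of_nat_div_le_of_nat[of n r, where ?'a = real] by (simp add: l_def)
    have "x * real (2 * n + 2 * l) - ln x * real (2 * l) = 2 * x * real n + 2 * d * real l"
      by (simp add: d_def algebra_simps)
    also have "\<dots> \<le> 2 * x * real n + 2 * d * (real n / real r + 1)"
      using l d by simp
    also have "\<dots> = (2 * x + 2 * (d / real r)) * real n + 2 * d"
      by (simp add: algebra_simps)
    also have "\<dots> \<le> (E / 4 + E / 4) * real n + 2 * d"
      using x(3) d_r by (intro add_right_mono mult_right_mono) linarith+
    also have "\<dots> < E * real n"
      using elim E by (simp add: field_simps)
    finally have "exp (x * real (2 * n + 2 * l) - ln x * real (2 * l)) < exp (E * real n)"
      by simp
    moreover have "real (chain_bound n r) \<le> exp (x * real (2 * n + 2 * l) - ln x * real (2 * l))"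
      unfolding chain_bound_def l_def using x(1) by (rule binomial_le_exp)
    moreover have "exp (E * real n) = 2 powr (\<mu> * real n)"
      by (simp add: powr_def E_def mult_ac)
    ultimately show ?case by linarith
  qed
  then show ?thesis
    using \<open>0 < real r\<close> by auto
qed

lemma (in chirotope) cut_off_points_of_large_set:
  assumes "0 < k" "0 < R"
  shows "\<exists>N. \<forall>X s n. finite X \<longrightarrow> nondegenerate X \<longrightarrow> N * s ^ (4 * R + 2) \<le> card X \<longrightarrow>
    chain_bound n k < s \<longrightarrow> chain_bound n R < s ^ R \<longrightarrow> cut_off_points X n"
proof -
  have "0 < stage_size k R"
    by (cases R) auto
  then have K: "0 < k * stage_size k R"
    using assms(1) by simp
  obtain R0 D where clusters: "\<And>X s. finite X \<Longrightarrow> nondegenerate X \<Longrightarrow> 0 < s \<Longrightarrow> R0 * s \<le> card X \<Longrightarrow>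
    \<exists>\<sigma> p C. moment_clusters (signed_ori \<sigma>) X (k * stage_size k R) p C \<and>
      (\<forall>j<k * stage_size k R. s \<le> D * card (C j))"
    using moment_clusters_exist[OF K] by blast
  have "cut_off_points X n"
    if X: "finite X" "nondegenerate X" "R0 * Suc D * s ^ (4 * R + 2) \<le> card X"
      and s: "chain_bound n k < s" "chain_bound n R < s ^ R" for X s n
  proof -
    have "0 < Suc D * s ^ (4 * R + 2)"
      using s(1) by simp
    moreover have "R0 * (Suc D * s ^ (4 * R + 2)) \<le> card X"
      using X(3) by (simp only: mult.assoc)
    ultimately obtain \<sigma> p C where mc: "moment_clusters (signed_ori \<sigma>) X (k * stage_size k R) p C"
      and C: "\<And>j. j < k * stage_size k R \<Longrightarrow> Suc D * s ^ (4 * R + 2) \<le> D * card (C j)"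
      using clusters[OF X(1,2)] by blast
    interpret mc: moment_clusters "signed_ori \<sigma>" X "k * stage_size k R" p C by (rule mc)
    have "mc.cut_off_points X n"
    proof (rule mc.cut_off_points_of_clusters[OF refl])
      show "s\<^sup>2 * ((s\<^sup>2) ^ R * (s ^ R)\<^sup>2) \<le> card (C j)" if "j < k * stage_size k R" for j
      proof -
        have "Suc D * s ^ (4 * R + 2) \<le> Suc D * card (C j)"
          using C[OF that] by simp
        then have "s ^ (4 * R + 2) \<le> card (C j)"
          by (simp only: Suc_mult_le_cancel1)
        moreover have "s\<^sup>2 * ((s\<^sup>2) ^ R * (s ^ R)\<^sup>2) = s ^ (4 * R + 2)"
          by (simp flip: power_mult power_add add: algebra_simps)
        ultimately show ?thesis by simp
      qed
      show "(2 * n + 2 * (n div k + 1)) choose (2 * (n div k + 1)) < s"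
        "(2 * n + 2 * (n div R + 1)) choose (2 * (n div R + 1)) < s ^ R"
        using s by (simp_all add: chain_bound_def)
      show "n \<le> k * (n div k + 1)" "n \<le> R * (n div R + 1)"
        using dividend_less_times_div[OF assms(1), of n] dividend_less_times_div[OF assms(2), of n]
        by (simp_all add: less_imp_le)
    qed
    then show ?thesis by (rule cut_off_points_signed_ori)
  qed
  then show ?thesis by blast
qed

lemma chain_bounds_subexponential:
  fixes \<delta> :: real
  assumes "0 < \<delta>"
  obtains k R where "0 < k" "0 < R"
    "\<And>N. \<forall>\<^sub>F n in sequentially. \<exists>s. chain_bound n k < s \<and> chain_bound n R < s ^ R \<and>
      real (N * s ^ (4 * R + 2)) \<le> 2 powr (\<delta> * real n)"
proof -
  obtain R where R: "0 < R" "\<forall>\<^sub>F n in sequentially. real (chain_bound n R) < 2 powr (\<delta> / 24 * real n)"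
    using chain_bound_subexponential[of "\<delta> / 24"] assms by auto
  define \<gamma> where "\<gamma> = \<delta> / (2 * real (4 * R + 2))"
  have \<gamma>: "0 < \<gamma>" "\<gamma> * real (4 * R + 2) = \<delta> / 2" "\<delta> / 24 \<le> \<gamma> / 2 * real R"
    using assms R(1) by (simp_all add: \<gamma>_def field_simps)
  obtain k where k: "0 < k" "\<forall>\<^sub>F n in sequentially. real (chain_bound n k) < 2 powr (\<gamma> / 2 * real n)"
    using chain_bound_subexponential[of "\<gamma> / 2"] \<gamma>(1) by auto
  have "\<forall>\<^sub>F n in sequentially. \<exists>s. chain_bound n k < s \<and> chain_bound n R < s ^ R \<and>
      real (N * s ^ (4 * R + 2)) \<le> 2 powr (\<delta> * real n)" for N
  proof -
    have "\<forall>\<^sub>F n in sequentially. 2 powr (\<gamma> / 2 * real n) \<le> real (nat \<lfloor>2 powr (\<gamma> * real n)\<rfloor>)"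
      using \<gamma>(1) by real_asymp
    moreover have "\<forall>\<^sub>F n in sequentially. real N \<le> 2 powr (\<delta> / 2 * real n)"
      using assms by real_asymp
    ultimately show ?thesis
      using R(2) k(2)
    proof eventually_elim
      case (elim n)
      define s where "s = nat \<lfloor>2 powr (\<gamma> * real n)\<rfloor>"
      have s_le: "real s \<le> 2 powr (\<gamma> * real n)" and s_ge: "2 powr (\<gamma> / 2 * real n) \<le> real s"
        using elim(1) by (simp_all add: s_def)
      have "real (s ^ (4 * R + 2)) \<le> (2 powr (\<gamma> * real n)) ^ (4 * R + 2)"
        unfolding of_nat_power using s_le by (rule power_mono) simp
      also have "\<dots> = 2 powr (\<gamma> * real (4 * R + 2) * real n)"
        by (subst powr_power) (simp, simp only: mult_ac)
      finally have "real (s ^ (4 * R + 2)) \<le> 2 powr (\<delta> / 2 * real n)"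
        by (simp only: \<gamma>(2))
      then have "real (N * s ^ (4 * R + 2)) \<le> 2 powr (\<delta> / 2 * real n) * 2 powr (\<delta> / 2 * real n)"
        unfolding of_nat_mult using elim(2) by (intro mult_mono) auto
      also have "\<dots> = 2 powr (\<delta> * real n)"
        by (simp flip: powr_add)
      finally have "real (N * s ^ (4 * R + 2)) \<le> 2 powr (\<delta> * real n)" .
      moreover have "2 powr (\<delta> / 24 * real n) \<le> 2 powr (\<gamma> / 2 * real n * real R)"
        using mult_right_mono[OF \<gamma>(3), of "real n"] by (simp add: mult_ac)
      then have "2 powr (\<delta> / 24 * real n) \<le> (2 powr (\<gamma> / 2 * real n)) ^ R"
        by (simp add: powr_powr flip: powr_realpow)
      then have "2 powr (\<delta> / 24 * real n) \<le> real (s ^ R)"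
        using power_mono[OF s_ge, of R] by simp
      then have "real (chain_bound n R) < real (s ^ R)"
        using elim(3) by linarith
      moreover have "real (chain_bound n k) < real s"
        using elim(4) s_ge by linarith
      ultimately show ?case
        unfolding of_nat_less_iff by (intro exI[of _ s] conjI)
    qed
  qed
  then show ?thesis
    using that k(1) R(1) by blast
qed

lemma (in chirotope) cut_off_points_subexponential:
  fixes \<delta> :: real
  assumes "0 < \<delta>"
  shows "\<forall>\<^sub>F n in sequentially. \<forall>X. finite X \<longrightarrow> nondegenerate X \<longrightarrow>
    2 powr (\<delta> * real n) \<le> real (card X) \<longrightarrow> cut_off_points X n"
proof -
  obtain k R where kR: "0 < k" "0 < R"
    and small: "\<And>N. \<forall>\<^sub>F n in sequentially. \<exists>s. chain_bound n k < s \<and> chain_bound n R < s ^ R \<and>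
      real (N * s ^ (4 * R + 2)) \<le> 2 powr (\<delta> * real n)"
    using chain_bounds_subexponential[OF assms] by blast
  obtain N where N: "\<And>X s n. finite X \<Longrightarrow> nondegenerate X \<Longrightarrow> N * s ^ (4 * R + 2) \<le> card X \<Longrightarrow>
    chain_bound n k < s \<Longrightarrow> chain_bound n R < s ^ R \<Longrightarrow> cut_off_points X n"
    using cut_off_points_of_large_set[OF kR] by blast
  show ?thesis
    using small[of N]
  proof eventually_elim
    case (elim n)
    then obtain s where s: "chain_bound n k < s" "chain_bound n R < s ^ R"
      "real (N * s ^ (4 * R + 2)) \<le> 2 powr (\<delta> * real n)" by blast
    show ?case
    proof (intro allI impI)
      fix X assume X: "finite X" "nondegenerate X" "2 powr (\<delta> * real n) \<le> real (card X)"
      then have "N * s ^ (4 * R + 2) \<le> card X"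
        using s(3) by linarith
      then show "cut_off_points X n"
        using N X(1,2) s(1,2) by blast
    qed
  qed
qed

section \<open>Positive fractions\<close>

fun triple_set :: "'a \<times> 'a \<times> 'a \<Rightarrow> 'a set" where
  "triple_set (a, b, c) = {a, b, c}"

definition map_triple :: "('a \<Rightarrow> 'b) \<Rightarrow> 'a \<times> 'a \<times> 'a \<Rightarrow> 'b \<times> 'b \<times> 'b" where
  "map_triple f = map_prod f (map_prod f f)"

lemma triple_set_map_triple: "triple_set (map_triple f t) = f ` triple_set t"
  by (cases t) (simp add: map_triple_def)

lemma map_triple_cong: "(\<And>a. a \<in> triple_set t \<Longrightarrow> f a = g a) \<Longrightarrow> map_triple f t = map_triple g t"
  by (cases t) (simp add: map_triple_def)

context chirotope
begin

lemma side_nonzero_imp_notin: "side t x \<noteq> 0 \<Longrightarrow> x \<notin> triple_set t"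
  by (cases t) auto

lemma cuts_off_points_imp:
  assumes "cuts_off I (\<lambda>i. {v i}) h"
  shows "inj_on v I" "\<And>i j. i \<in> I \<Longrightarrow> j \<in> I \<Longrightarrow> v i \<notin> triple_set (h j)"
proof -
  show "inj_on v I"
  proof (rule inj_onI, rule ccontr)
    fix i j assume "i \<in> I" "j \<in> I" "v i = v j" "i \<noteq> j"
    then have "side (h i) (v i) > 0" "side (h i) (v j) < 0"
      using assms unfolding cuts_off_def by blast+
    then show False
      using \<open>v i = v j\<close> by simp
  qed
  show "v i \<notin> triple_set (h j)" if "i \<in> I" "j \<in> I" for i j
  proof (rule side_nonzero_imp_notin, cases "i = j")
    case True
    then show "side (h j) (v i) \<noteq> 0"
      using assms that unfolding cuts_off_def by force
  next
    case False
    then show "side (h j) (v i) \<noteq> 0"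
      using assms that unfolding cuts_off_def by force
  qed
qed

lemma cut_off_points_preimage:
  assumes "cut_off_points (f ` I) n"
  obtains v h where "v ` {..<n} \<subseteq> I" "h ` {..<n} \<subseteq> I \<times> I \<times> I"
    "cuts_off {..<n} (\<lambda>i. {f (v i)}) (\<lambda>i. map_triple f (h i))"
proof -
  obtain v h where v: "v ` {..<n} \<subseteq> f ` I" and h: "h ` {..<n} \<subseteq> f ` I \<times> f ` I \<times> f ` I"
    and cuts: "cuts_off {..<n} (\<lambda>i. {v i}) h"
    using assms unfolding cut_off_points_def by blast
  define g where "g = inv_into I f"
  have g: "g x \<in> I" "f (g x) = x" if "x \<in> f ` I" for x
    using that by (simp_all add: g_def inv_into_into f_inv_into_f)
  show ?thesis
  proof (rule that[of "g \<circ> v" "map_triple g \<circ> h"])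
    show "(g \<circ> v) ` {..<n} \<subseteq> I"
      using v g(1) by auto
    show "(map_triple g \<circ> h) ` {..<n} \<subseteq> I \<times> I \<times> I"
      using h g(1) by (fastforce simp: map_triple_def)
    have "f ((g \<circ> v) i) = v i" "map_triple f ((map_triple g \<circ> h) i) = h i" if "i \<in> {..<n}" for i
    proof -
      show "f ((g \<circ> v) i) = v i"
        using that v g(2) by auto
      have "h i \<in> f ` I \<times> f ` I \<times> f ` I"
        using that h by blast
      then show "map_triple f ((map_triple g \<circ> h) i) = h i"
        using g(2) by (cases "h i") (simp add: map_triple_def)
    qed
    then show "cuts_off {..<n} (\<lambda>i. {f ((g \<circ> v) i)}) (\<lambda>i. map_triple f ((map_triple g \<circ> h) i))"
      using cuts unfolding cuts_off_def by simp
  qed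
qed

text \<open>A type \<open>t\<close> lists, for each cut off point, its index and those of the points spanning its plane.\<close>
definition cuts_off_indices :: "nat \<Rightarrow> (nat \<Rightarrow> 'i \<times> 'i \<times> 'i \<times> 'i) \<Rightarrow> ('i \<Rightarrow> 'p) \<Rightarrow> bool" where
  "cuts_off_indices m t f \<longleftrightarrow> cuts_off {..<m} (\<lambda>i. {f (fst (t i))}) (\<lambda>i. map_triple f (snd (t i)))"

definition cut_types :: "nat \<Rightarrow> nat \<Rightarrow> (nat \<Rightarrow> nat \<times> nat \<times> nat \<times> nat) set" where
  "cut_types S m = {t \<in> {..<m} \<rightarrow>\<^sub>E {..<S} \<times> {..<S} \<times> {..<S} \<times> {..<S}. \<exists>f. cuts_off_indices m t f}"

definition cut_off_indices :: "nat \<Rightarrow> (nat \<Rightarrow> 'i \<times> 'i \<times> 'i \<times> 'i) \<Rightarrow> 'i set" where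
  "cut_off_indices m t = (\<lambda>i. fst (t i)) ` {..<m}"

lemma finite_cut_types: "finite (cut_types S m)" and card_cut_types: "card (cut_types S m) \<le> (S ^ 4) ^ m"
proof -
  let ?F = "{..<m} \<rightarrow>\<^sub>E {..<S} \<times> {..<S} \<times> {..<S} \<times> {..<S}"
  have "finite ?F"
    by (intro finite_PiE) auto
  moreover have "card ?F = (S ^ 4) ^ m"
    by (simp add: card_PiE power4_eq_xxxx mult.assoc)
  moreover have "cut_types S m \<subseteq> ?F"
    by (auto simp: cut_types_def)
  ultimately show "finite (cut_types S m)" "card (cut_types S m) \<le> (S ^ 4) ^ m"
    using finite_subset card_mono by metis+
qed

lemma cut_type_exists:
  assumes "cut_off_points (f ` {..<S}) m"
  shows "\<exists>t\<in>cut_types S m. cuts_off_indices m t f"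
proof -
  obtain v h where v: "v ` {..<m} \<subseteq> {..<S}" and h: "h ` {..<m} \<subseteq> {..<S} \<times> {..<S} \<times> {..<S}"
    and cuts: "cuts_off {..<m} (\<lambda>i. {f (v i)}) (\<lambda>i. map_triple f (h i))"
    using assms by (rule cut_off_points_preimage)
  define t where "t = restrict (\<lambda>i. (v i, h i)) {..<m}"
  have "t \<in> {..<m} \<rightarrow>\<^sub>E {..<S} \<times> {..<S} \<times> {..<S} \<times> {..<S}"
    using v h by (auto simp: t_def)
  moreover have "cuts_off_indices m t f"
    using cuts by (simp add: cuts_off_indices_def t_def cuts_off_def)
  ultimately show ?thesis
    unfolding cut_types_def by blast
qed

lemma inj_on_cut_type:
  assumes "t \<in> cut_types S m"
  shows "inj_on (\<lambda>i. fst (t i)) {..<m}"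
proof -
  obtain f where "cuts_off_indices m t f"
    using assms by (auto simp: cut_types_def)
  then have "inj_on (\<lambda>i. f (fst (t i))) {..<m}"
    unfolding cuts_off_indices_def by (rule cuts_off_points_imp(1))
  then show ?thesis
    by (auto simp: inj_on_def)
qed

lemma card_cut_off_indices:
  assumes "t \<in> cut_types S m"
  shows "cut_off_indices m t \<subseteq> {..<S}" "card (cut_off_indices m t) = m"
proof -
  have "fst (t i) \<in> {..<S}" if "i \<in> {..<m}" for i
    using assms that by (auto simp: cut_types_def dest!: PiE_mem)
  then show "cut_off_indices m t \<subseteq> {..<S}"
    unfolding cut_off_indices_def by blast
  show "card (cut_off_indices m t) = m"
    using inj_on_cut_type[OF assms] by (simp add: cut_off_indices_def card_image)
qed

lemma spanning_indices_of_cut_type: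
  assumes t: "t \<in> cut_types S m" and i: "i < m"
  shows "triple_set (snd (t i)) \<subseteq> {..<S} - cut_off_indices m t"
proof -
  obtain f where "cuts_off_indices m t f"
    using t by (auto simp: cut_types_def)
  then have "f (fst (t j)) \<notin> triple_set (map_triple f (snd (t i)))" if "j < m" for j
    using cuts_off_points_imp(2) i that unfolding cuts_off_indices_def by fastforce
  then have "fst (t j) \<notin> triple_set (snd (t i))" if "j < m" for j
    using that by (auto simp: triple_set_map_triple)
  moreover have "t i \<in> {..<S} \<times> {..<S} \<times> {..<S} \<times> {..<S}"
    using t i by (auto simp: cut_types_def)
  then have "triple_set (snd (t i)) \<subseteq> {..<S}"
    by (cases "t i") auto
  ultimately show ?thesis
    by (auto simp: cut_off_indices_def)
qed

lemma cuts_off_of_cut_type: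
  assumes t: "t \<in> cut_types S m"
    and extend: "\<And>v x. v \<in> cut_off_indices m t \<Longrightarrow> x \<in> B v \<Longrightarrow>
      \<exists>f. cuts_off_indices m t f \<and> f v = x \<and> (\<forall>i\<in>{..<S} - cut_off_indices m t. f i = g i)"
  shows "cuts_off {..<m} (\<lambda>i. B (fst (t i))) (\<lambda>i. map_triple g (snd (t i)))"
proof -
  let ?h = "\<lambda>i. map_triple g (snd (t i))"
  have side: "if j = i then side (?h i) x > 0 else side (?h i) x < 0"
    if i: "i < m" and j: "j < m" "x \<in> B (fst (t j))" for i j x
  proof -
    have "fst (t j) \<in> cut_off_indices m t"
      using j(1) by (auto simp: cut_off_indices_def)
    then obtain f where f: "cuts_off_indices m t f" "f (fst (t j)) = x"
      "\<forall>i\<in>{..<S} - cut_off_indices m t. f i = g i"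
      using extend j(2) by blast
    have "map_triple f (snd (t i)) = ?h i"
      using spanning_indices_of_cut_type[OF t i] f(3) by (intro map_triple_cong) blast
    moreover have "side (map_triple f (snd (t i))) (f (fst (t i))) > 0"
      "j \<noteq> i \<Longrightarrow> side (map_triple f (snd (t i))) (f (fst (t j))) < 0"
      using f(1) i j(1) unfolding cuts_off_indices_def cuts_off_def by blast+
    ultimately show ?thesis
      using f(2) by auto
  qed
  show ?thesis
    unfolding cuts_off_def
  proof (intro ballI conjI)
    fix i assume i: "i \<in> {..<m}"
    show "side (?h i) x > 0" if "x \<in> B (fst (t i))" for x
      using side[of i i x] i that by simp
    show "side (?h i) x < 0" if "j \<in> {..<m} - {i}" "x \<in> B (fst (t j))" for j x
      using side[of i j x] i that by simp
  qed
qed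

text \<open>Fixing the points that span the planes, the cut off points vary independently.\<close>
lemma cut_off_sets_of_cut_off_points:
  assumes X: "finite X" "S * s \<le> card X" "0 < s"
    and cut: "\<And>Y. Y \<subseteq> X \<Longrightarrow> card Y = S \<Longrightarrow> cut_off_points Y m"
  shows "\<exists>B h. (\<forall>i<m. B i \<subseteq> X \<and> card (B i) \<le> s) \<and> cuts_off {..<m} B h \<and>
    s ^ m \<le> (S ^ 4) ^ m * (\<Prod>i<m. card (B i))"
proof -
  let ?V = "cut_off_indices m :: (nat \<Rightarrow> nat \<times> nat \<times> nat \<times> nat) \<Rightarrow> nat set"
  have type: "\<exists>t\<in>cut_types S m. cuts_off_indices m t f" if "inj_on f {..<S}" "f ` {..<S} \<subseteq> X" for f
    using that by (intro cut_type_exists cut) (auto simp: card_image)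
  have V: "?V t \<subseteq> {..<S} \<and> card (?V t) = m" if "t \<in> cut_types S m" for t
    using card_cut_off_indices[OF that] by simp
  obtain t g B where t: "t \<in> cut_types S m"
    and B: "\<forall>v\<in>?V t. B v \<subseteq> X \<and> card (B v) \<le> s"
    and extend: "\<forall>v\<in>?V t. \<forall>x\<in>B v. \<exists>f. cuts_off_indices m t f \<and> f v = x \<and> (\<forall>i\<in>{..<S} - ?V t. f i = g i)"
    and prod: "s ^ m \<le> card (cut_types S m) * (\<Prod>v\<in>?V t. card (B v))"
    by (rule positive_fraction_selection[OF X finite_cut_types type V]) (assumption | rule that)+
  have "cuts_off {..<m} (\<lambda>i. B (fst (t i))) (\<lambda>i. map_triple g (snd (t i)))"
    using extend by (intro cuts_off_of_cut_type[OF t]) blast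
  moreover have "\<forall>i<m. B (fst (t i)) \<subseteq> X \<and> card (B (fst (t i))) \<le> s"
    using B by (auto simp: cut_off_indices_def)
  moreover have "(\<Prod>v\<in>?V t. card (B v)) = (\<Prod>i<m. card (B (fst (t i))))"
    using inj_on_cut_type[OF t] unfolding cut_off_indices_def by (simp add: prod.reindex)
  then have "s ^ m \<le> (S ^ 4) ^ m * (\<Prod>i<m. card (B (fst (t i))))"
    using prod card_cut_types by (metis le_trans mult_le_mono1)
  ultimately show ?thesis
    by (intro exI[of _ "\<lambda>i. B (fst (t i))"] exI[of _ "\<lambda>i. map_triple g (snd (t i))"]) blast
qed

lemma positive_fraction_cut_off:
  assumes "finite X" and S: "0 < S" "S \<le> card X"
    and cut: "\<And>Y. Y \<subseteq> X \<Longrightarrow> card Y = S \<Longrightarrow> cut_off_points Y (2 * n)"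
  shows "\<exists>B h. (\<forall>i<n. B i \<subseteq> X \<and> card X \<le> 2 * S ^ 9 * card (B i)) \<and> cuts_off {..<n} B h"
proof -
  define s where "s = card X div S"
  have s: "0 < s" "S * s \<le> card X"
    using S by (simp_all add: s_def div_greater_zero_iff)
  obtain B h where B: "\<And>i. i < 2 * n \<Longrightarrow> B i \<subseteq> X \<and> card (B i) \<le> s"
    and cuts: "cuts_off {..<2 * n} B h"
    and prod: "s ^ (2 * n) \<le> (S ^ 4) ^ (2 * n) * (\<Prod>i<2 * n. card (B i))"
    using cut_off_sets_of_cut_off_points[OF assms(1) s(2,1) cut] by blast
  let ?G = "{i \<in> {..<2 * n}. s \<le> (S ^ 4)\<^sup>2 * card (B i)}"
  have "card {..<2 * n} \<le> 2 * card ?G"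
    by (rule half_of_factors_large) (use B s(1) S(1) prod in auto)
  then have "\<exists>f. inj_on f {..<n} \<and> f ` {..<n} \<subseteq> ?G"
    using card_le_inj[of "{..<n}" ?G] by auto
  then obtain f where f: "inj_on f {..<n}" "f ` {..<n} \<subseteq> ?G" by blast
  have "card X \<le> 2 * S ^ 9 * card (B (f i))" if "i < n" for i
  proof -
    have "card X \<le> S * (s + 1)"
      using dividend_less_times_div[OF S(1), of "card X"] by (simp add: s_def)
    also have "\<dots> \<le> S * (2 * s)"
      using s(1) by (intro mult_le_mono2) simp
    also have "\<dots> \<le> S * (2 * ((S ^ 4)\<^sup>2 * card (B (f i))))"
      using f(2) that by (intro mult_le_mono2) auto
    also have "\<dots> = 2 * S ^ 9 * card (B (f i))"
    proof -
      have "S ^ 9 = S * (S ^ 4)\<^sup>2"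
        by (simp add: eval_nat_numeral)
      then show ?thesis
        by (simp only: mult_ac)
    qed
    finally show ?thesis .
  qed
  moreover have "B (f i) \<subseteq> X" if "i < n" for i
    using B f(2) that by auto
  moreover have "cuts_off {..<n} (B \<circ> f) (h \<circ> f)"
    by (rule cuts_off_reindex[OF cuts f(1)]) (use f(2) in blast)
  ultimately show ?thesis
    by (intro exI[of _ "B \<circ> f"] exI[of _ "h \<circ> f"]) simp
qed

end

section \<open>Families in convex position\<close>

lemma family_convex_position_mono:
  assumes "family_convex_position I X" "J \<subseteq> I" "\<And>i. i \<in> J \<Longrightarrow> Y i \<subseteq> X i"
  shows "family_convex_position J Y"
  unfolding family_convex_position_def
proof
  fix i assume "i \<in> J"
  then have "convex hull (Y i) \<subseteq> convex hull (X i)"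
    "convex hull (\<Union>j\<in>J - {i}. Y j) \<subseteq> convex hull (\<Union>j\<in>I - {i}. X j)"
    using assms(2,3) by (intro hull_mono UN_mono; blast)+
  then show "convex hull (Y i) \<inter> convex hull (\<Union>j\<in>J - {i}. Y j) = {}"
    using assms(1,2) \<open>i \<in> J\<close> unfolding family_convex_position_def by blast
qed

lemma family_convex_position_linear_image:
  assumes "linear f" "family_convex_position I (\<lambda>i. f ` X i)"
  shows "family_convex_position I X"
  unfolding family_convex_position_def
proof (intro ballI equals0I)
  fix i z assume "i \<in> I" and z: "z \<in> convex hull (X i) \<inter> convex hull (\<Union>j\<in>I - {i}. X j)"
  have "f z \<in> f ` (convex hull (X i))" "f z \<in> f ` (convex hull (\<Union>j\<in>I - {i}. X j))"
    using z by auto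
  then have "f z \<in> convex hull (f ` X i)" "f z \<in> convex hull (\<Union>j\<in>I - {i}. f ` X j)"
    using assms(1) by (simp_all add: convex_hull_linear_image image_UN)
  then show False
    using assms(2) \<open>i \<in> I\<close> unfolding family_convex_position_def by blast
qed

lemma convex_position_iff:
  assumes "finite P"
  shows "convex_position P \<longleftrightarrow> (\<forall>x\<in>P. x \<notin> convex hull (P - {x}))"
proof
  assume "convex_position P"
  then obtain K where K: "polytope K" "P = {v. v extreme_point_of K}"
    unfolding convex_position_def by blast
  show "\<forall>x\<in>P. x \<notin> convex hull (P - {x})"
  proof
    fix x assume "x \<in> P"
    then have "convex (K - {x})"
      using extreme_point_of_stillconvex K polytope_imp_convex by blast
    moreover have "P - {x} \<subseteq> K - {x}"
      using K(2) by (auto simp: extreme_point_of_def)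
    ultimately have "convex hull (P - {x}) \<subseteq> K - {x}"
      by (rule hull_minimal[rotated])
    then show "x \<notin> convex hull (P - {x})" by blast
  qed
next
  assume "\<forall>x\<in>P. x \<notin> convex hull (P - {x})"
  then have "P = {v. v extreme_point_of (convex hull P)}"
    using extreme_point_of_convex_hull_convex_independent[OF finite_imp_compact[OF assms]] by blast
  then show "convex_position P"
    unfolding convex_position_def polytope_def using assms by blast
qed

lemma convex_position_subset:
  assumes "convex_position P" "finite P" "Q \<subseteq> P"
  shows "convex_position Q"
proof -
  have "convex hull (Q - {x}) \<subseteq> convex hull (P - {x})" for x
    using assms(3) by (intro hull_mono) blast
  then show ?thesis
    using assms finite_subset[OF assms(3,2)] by (auto simp: convex_position_iff)
qed

lemma family_convex_position_singletons_iff: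
  assumes "finite I"
  shows "family_convex_position I (\<lambda>i. {x i}) \<longleftrightarrow> inj_on x I \<and> convex_position (x ` I)"
proof -
  have family: "family_convex_position I (\<lambda>i. {x i}) \<longleftrightarrow> (\<forall>i\<in>I. x i \<notin> convex hull (x ` (I - {i})))"
    by (simp add: family_convex_position_def UNION_singleton_eq_range)
  have "inj_on x I" if "\<forall>i\<in>I. x i \<notin> convex hull (x ` (I - {i}))"
  proof (rule inj_onI, rule ccontr)
    fix i j assume ij: "i \<in> I" "j \<in> I" "x i = x j" "i \<noteq> j"
    then have "x i \<in> x ` (I - {i})" by auto
    then show False
      using that ij(1) hull_inc by metis
  qed
  moreover have "x ` (I - {i}) = x ` I - {x i}" if "inj_on x I" "i \<in> I" for i
    using that by (auto dest: inj_onD)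
  ultimately show ?thesis
    unfolding family using assms by (auto simp: convex_position_iff)
qed

definition has_convex_position_family :: "nat \<Rightarrow> real \<Rightarrow> 'a::euclidean_space set \<Rightarrow> bool" where
  "has_convex_position_family n \<epsilon> X \<longleftrightarrow>
     (\<exists>Y. (\<forall>i\<in>{1..n}. Y i \<subseteq> X \<and> \<epsilon> * real (card X) \<le> real (card (Y i))) \<and>
        family_convex_position {1..n} Y)"

lemma has_convex_position_family_mono:
  assumes "has_convex_position_family n' \<epsilon> X" "n \<le> n'"
  shows "has_convex_position_family n \<epsilon> X"
proof -
  obtain Y where "\<forall>i\<in>{1..n'}. Y i \<subseteq> X \<and> \<epsilon> * real (card X) \<le> real (card (Y i))"
    "family_convex_position {1..n'} Y"
    using assms(1) unfolding has_convex_position_family_def by blast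
  then show ?thesis
    using assms(2) family_convex_position_mono[of "{1..n'}" Y "{1..n}" Y]
    unfolding has_convex_position_family_def by (intro exI[of _ Y]) auto
qed

lemma has_convex_position_family_linear_image:
  assumes "linear f" "inj_on f X" "has_convex_position_family n \<epsilon> (f ` X)"
  shows "has_convex_position_family n \<epsilon> X"
proof -
  obtain B where B: "\<And>i. i \<in> {1..n} \<Longrightarrow> B i \<subseteq> f ` X \<and> \<epsilon> * real (card (f ` X)) \<le> real (card (B i))"
    and family: "family_convex_position {1..n} B"
    using assms(3) unfolding has_convex_position_family_def by blast
  define Y where "Y i = {x \<in> X. f x \<in> B i}" for i
  have image: "f ` Y i = B i" if "i \<in> {1..n}" for i
    using B[OF that] by (auto simp: Y_def)
  have "\<epsilon> * real (card X) \<le> real (card (Y i))" if "i \<in> {1..n}" for i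
  proof -
    have "inj_on f (Y i)"
      by (rule inj_on_subset[OF assms(2)]) (auto simp: Y_def)
    then have "card (Y i) = card (B i)" "card (f ` X) = card X"
      using card_image assms(2) image[OF that] by metis+
    then show ?thesis
      using B[OF that] by simp
  qed
  moreover have "family_convex_position {1..n} (\<lambda>i. f ` Y i)"
    by (rule family_convex_position_mono[OF family]) (simp_all add: image)
  then have "family_convex_position {1..n} Y"
    by (rule family_convex_position_linear_image[OF assms(1)])
  ultimately show ?thesis
    unfolding has_convex_position_family_def by (intro exI[of _ Y]) (auto simp: Y_def)
qed

lemma has_convex_position_family_of_points:
  assumes "finite X" "P \<subseteq> X" "convex_position P" "n \<le> card P" "\<epsilon> * real (card X) \<le> 1"
  shows "has_convex_position_family n \<epsilon> X"
proof -
  have "finite P"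
    using assms(1,2) finite_subset by blast
  obtain Q where Q: "Q \<subseteq> P" "card Q = n" "finite Q"
    using assms(4) by (meson obtain_subset_with_card_n)
  then obtain x where x: "bij_betw x {1..n} Q"
    using finite_same_card_bij[of "{1..n}" Q] by auto
  then have "family_convex_position {1..n} (\<lambda>i. {x i})"
    using convex_position_subset[OF assms(3) \<open>finite P\<close> Q(1)]
    by (simp add: family_convex_position_singletons_iff bij_betw_def)
  moreover have "x i \<in> X" if "i \<in> {1..n}" for i
    using x that Q(1) assms(2) by (meson bij_betwE subsetD)
  ultimately show ?thesis
    unfolding has_convex_position_family_def using assms(5)
    by (intro exI[of _ "\<lambda>i. {x i}"]) simp
qed

lemma convex_position_transversal:
  assumes "has_convex_position_family n \<epsilon> X" "0 < \<epsilon>" "0 < card X"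
  shows "\<exists>P\<subseteq>X. card P = n \<and> convex_position P"
proof -
  obtain Y where Y: "\<And>i. i \<in> {1..n} \<Longrightarrow> Y i \<subseteq> X \<and> \<epsilon> * real (card X) \<le> real (card (Y i))"
    and family: "family_convex_position {1..n} Y"
    using assms(1) unfolding has_convex_position_family_def by blast
  have "0 < \<epsilon> * real (card X)"
    using assms(2,3) by simp
  then have "\<exists>x. x \<in> Y i" if "i \<in> {1..n}" for i
    using Y[OF that] by (cases "Y i = {}") auto
  then obtain x where x: "\<And>i. i \<in> {1..n} \<Longrightarrow> x i \<in> Y i"
    by metis
  have "family_convex_position {1..n} (\<lambda>i. {x i})"
    by (rule family_convex_position_mono[OF family]) (use x in auto)
  then have "inj_on x {1..n}" "convex_position (x ` {1..n})"
    by (simp_all add: family_convex_position_singletons_iff)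
  moreover have "x ` {1..n} \<subseteq> X"
    using x Y by blast
  ultimately show ?thesis
    by (intro exI[of _ "x ` {1..n}"]) (simp add: card_image)
qed

section \<open>Positive fractions in three dimensions\<close>

definition orient3 :: "real ^ 3 \<Rightarrow> real ^ 3 \<Rightarrow> real ^ 3 \<Rightarrow> real ^ 3 \<Rightarrow> real" where
  "orient3 a b c d = cross3 (b - a) (c - a) \<bullet> (d - a)"

lemma orient3_components:
  "orient3 a b c d =
     ((b $ 2 - a $ 2) * (c $ 3 - a $ 3) - (b $ 3 - a $ 3) * (c $ 2 - a $ 2)) * (d $ 1 - a $ 1) +
     ((b $ 3 - a $ 3) * (c $ 1 - a $ 1) - (b $ 1 - a $ 1) * (c $ 3 - a $ 3)) * (d $ 2 - a $ 2) +
     ((b $ 1 - a $ 1) * (c $ 2 - a $ 2) - (b $ 2 - a $ 2) * (c $ 1 - a $ 1)) * (d $ 3 - a $ 3)"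
  by (simp add: orient3_def cross3_def inner_vec_def sum_3)

interpretation orient3: chirotope orient3
proof
  fix a b c d e f :: "real ^ 3"
  show "orient3 b a c d = - orient3 a b c d" "orient3 a c b d = - orient3 a b c d"
    "orient3 a b d c = - orient3 a b c d"
    unfolding orient3_components by algebra+
  show "orient3 a b c d * orient3 a b e f - orient3 a b c e * orient3 a b d f +
      orient3 a b c f * orient3 a b d e = 0"
    unfolding orient3_components by algebra
qed

lemma convex_side:
  "convex {x. orient3.side t x > 0}" "convex {x. orient3.side t x < 0}"
proof -
  obtain a b c where t: "t = (a, b, c)" by (cases t)
  have side: "orient3.side t x = cross3 (b - a) (c - a) \<bullet> x - cross3 (b - a) (c - a) \<bullet> a" for x
    by (simp add: t orient3_def inner_diff_right)
  show "convex {x. orient3.side t x > 0}" "convex {x. orient3.side t x < 0}"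
    using convex_halfspace_gt[of "cross3 (b - a) (c - a) \<bullet> a"]
      convex_halfspace_lt[of "cross3 (b - a) (c - a)"]
    by (simp_all add: side)
qed

lemma family_convex_position_of_cuts_off:
  assumes "orient3.cuts_off I B h"
  shows "family_convex_position I B"
  unfolding family_convex_position_def
proof
  fix i assume "i \<in> I"
  then have "B i \<subseteq> {x. orient3.side (h i) x > 0}" "(\<Union>j\<in>I - {i}. B j) \<subseteq> {x. orient3.side (h i) x < 0}"
    using assms unfolding orient3.cuts_off_def by blast+
  then have "convex hull (B i) \<subseteq> {x. orient3.side (h i) x > 0}"
    "convex hull (\<Union>j\<in>I - {i}. B j) \<subseteq> {x. orient3.side (h i) x < 0}"
    by (simp_all only: hull_minimal convex_side)
  then show "convex hull (B i) \<inter> convex hull (\<Union>j\<in>I - {i}. B j) = {}"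
    by force
qed

lemma nondegenerate_of_general_position:
  assumes "general_position X"
  shows "orient3.nondegenerate X"
  unfolding orient3.nondegenerate_def
proof (intro allI impI notI)
  fix a b c d assume X: "{a, b, c, d} \<subseteq> X" "distinct [a, b, c, d]" and "orient3 a b c d = 0"
  let ?A = "vector [d - a, b - a, c - a] :: real ^ 3 ^ 3"
  have "det ?A = 0"
    using \<open>orient3 a b c d = 0\<close> by (simp add: orient3_def dot_cross_det inner_commute)
  then obtain n where n: "n \<noteq> 0" "?A *v n = 0"
    using det_eq_0_rank[of ?A] matrix_nonfull_linear_equations_eq[of ?A] by auto
  have "?A $ i \<bullet> n = 0" for i
    using arg_cong[OF n(2), of "\<lambda>v. v $ i"] by (simp add: matrix_mult_dot)
  from this[of 1] this[of 2] this[of 3] have "{a, b, c, d} \<subseteq> {x. n \<bullet> x = n \<bullet> a}"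
    by (simp add: inner_diff_left inner_commute[of n])
  moreover have "card {a, b, c, d} = DIM(real ^ 3) + 1"
    using X(2) by simp
  ultimately show False
    using assms X(1) n(1) unfolding general_position_def by blast
qed

definition positive_fraction3 :: "nat \<Rightarrow> nat \<Rightarrow> bool" where
  "positive_fraction3 n t \<longleftrightarrow> (\<forall>X :: (real ^ 3) set. finite X \<longrightarrow> general_position X \<longrightarrow> 2 ^ t \<le> card X \<longrightarrow>
     has_convex_position_family n (1 / 2 ^ t) X)"

lemma positive_fraction3_mono: "positive_fraction3 n' t \<Longrightarrow> n \<le> n' \<Longrightarrow> positive_fraction3 n t"
  unfolding positive_fraction3_def using has_convex_position_family_mono by blast

lemma positive_fraction3_of_cut_off_points:
  assumes cut: "\<And>Y. finite Y \<Longrightarrow> orient3.nondegenerate Y \<Longrightarrow> card Y = 2 ^ \<sigma> \<Longrightarrow>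
      orient3.cut_off_points Y (2 * n)"
  shows "positive_fraction3 n (9 * \<sigma> + 1)"
  unfolding positive_fraction3_def
proof (intro allI impI)
  fix X :: "(real ^ 3) set" assume X: "finite X" "general_position X" "2 ^ (9 * \<sigma> + 1) \<le> card X"
  have "(2 :: nat) ^ \<sigma> \<le> 2 ^ (9 * \<sigma> + 1)"
    by (intro power_increasing) auto
  then have "2 ^ \<sigma> \<le> card X"
    using X(3) by linarith
  moreover have "orient3.cut_off_points Y (2 * n)" if "Y \<subseteq> X" "card Y = 2 ^ \<sigma>" for Y
    using that X(1) finite_subset
      orient3.nondegenerate_subset[OF nondegenerate_of_general_position[OF X(2)]]
    by (intro cut) auto
  ultimately obtain B h where B: "\<And>i. i < n \<Longrightarrow> B i \<subseteq> X \<and> card X \<le> 2 * (2 ^ \<sigma>) ^ 9 * card (B i)"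
    and cuts: "orient3.cuts_off {..<n} B h"
    using orient3.positive_fraction_cut_off[OF X(1), of "2 ^ \<sigma>" n] by auto
  let ?f = "\<lambda>i. i - 1 :: nat"
  have "orient3.cuts_off {1..n} (B \<circ> ?f) (h \<circ> ?f)"
    using cuts by (rule orient3.cuts_off_reindex) (auto simp: inj_on_def)
  then have "family_convex_position {1..n} (B \<circ> ?f)"
    by (rule family_convex_position_of_cuts_off)
  moreover have "B (i - 1) \<subseteq> X \<and> 1 / 2 ^ (9 * \<sigma> + 1) * real (card X) \<le> real (card (B (i - 1)))"
    if "i \<in> {1..n}" for i
  proof -
    have "2 * (2 ^ \<sigma>) ^ 9 = (2 :: nat) ^ (9 * \<sigma> + 1)"
      by (simp add: power_mult[symmetric] mult.commute)
    moreover have i: "i - 1 < n"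
      using that by auto
    ultimately have "card X \<le> 2 ^ (9 * \<sigma> + 1) * card (B (i - 1))"
      using B by metis
    then have "real (card X) \<le> real (2 ^ (9 * \<sigma> + 1) * card (B (i - 1)))"
      using of_nat_le_iff by blast
    then show ?thesis
      using B[OF i] by (simp add: field_simps)
  qed
  ultimately show "has_convex_position_family n (1 / 2 ^ (9 * \<sigma> + 1)) X"
    unfolding has_convex_position_family_def by (intro exI[of _ "B \<circ> ?f"]) simp
qed

lemma positive_fraction3_eventually:
  fixes \<delta> :: real
  assumes "0 < \<delta>"
  shows "\<forall>\<^sub>F n in sequentially. \<exists>t. real t \<le> \<delta> * real n \<and> positive_fraction3 n t"
proof -
  define \<eta> where "\<eta> = \<delta> / 36"
  have "0 < \<eta>"
    using assms by (simp add: \<eta>_def)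
  then have "\<forall>\<^sub>F n in sequentially. \<forall>m\<ge>n. \<forall>X. finite X \<longrightarrow> orient3.nondegenerate X \<longrightarrow>
      2 powr (\<eta> * real m) \<le> real (card X) \<longrightarrow> orient3.cut_off_points X m"
    using orient3.cut_off_points_subexponential eventually_all_ge_at_top by blast
  moreover have "\<forall>\<^sub>F n in sequentially. 20 / \<delta> < real n"
    using filterlim_real_sequentially by (simp add: filterlim_at_top_dense)
  ultimately show ?thesis
  proof eventually_elim
    case (elim n)
    define \<sigma> where "\<sigma> = nat \<lceil>\<eta> * real (2 * n)\<rceil>"
    have "orient3.cut_off_points Y (2 * n)"
      if "finite Y" "orient3.nondegenerate Y" "card Y = 2 ^ \<sigma>" for Y
    proof -
      have "2 powr (\<eta> * real (2 * n)) \<le> 2 powr real \<sigma>"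
        unfolding \<sigma>_def by (intro powr_mono) linarith+
      also have "\<dots> = real (card Y)"
        using that(3) by (simp add: powr_realpow)
      finally show ?thesis
        using elim(1)[rule_format, of "2 * n"] that(1,2) by simp
    qed
    then have "positive_fraction3 n (9 * \<sigma> + 1)"
      by (rule positive_fraction3_of_cut_off_points)
    moreover have "real \<sigma> \<le> \<eta> * real (2 * n) + 1"
      using \<open>0 < \<eta>\<close> unfolding \<sigma>_def by (simp add: of_nat_nat)
    then have "real (9 * \<sigma> + 1) \<le> \<delta> * real n"
      using elim(2) assms by (simp add: \<eta>_def field_simps)
    ultimately show ?case by blast
  qed
qed

lemma positive_fraction3_exists: "\<exists>t. positive_fraction3 n t"
proof -
  have "\<forall>\<^sub>F m in sequentially. \<exists>t. positive_fraction3 m t"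
    using positive_fraction3_eventually[of 1] by (auto elim: eventually_mono)
  then obtain N where "\<forall>m\<ge>N. \<exists>t. positive_fraction3 m t"
    unfolding eventually_sequentially by blast
  then show ?thesis
    using positive_fraction3_mono max.cobounded1 max.cobounded2 by meson
qed

definition fraction_exponent :: "nat \<Rightarrow> nat" where
  "fraction_exponent n = (LEAST t. positive_fraction3 n t)"

lemma positive_fraction3_fraction_exponent: "positive_fraction3 n (fraction_exponent n)"
  unfolding fraction_exponent_def using positive_fraction3_exists by (rule LeastI_ex)

lemma fraction_exponent_sublinear: "(\<lambda>n. real (fraction_exponent n)) \<in> o(\<lambda>n. real n)"
proof (rule landau_o.smallI)
  fix c :: real assume "0 < c"
  from positive_fraction3_eventually[OF this]
  show "\<forall>\<^sub>F n in sequentially. norm (real (fraction_exponent n)) \<le> c * norm (real n)"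
  proof eventually_elim
    case (elim n)
    then obtain t where t: "real t \<le> c * real n" "positive_fraction3 n t" by blast
    have "fraction_exponent n \<le> t"
      unfolding fraction_exponent_def using t(2) by (rule Least_le)
    then show ?case
      using t(1) by simp
  qed
qed

section \<open>The Erdos-Szekeres number\<close>

lemma general_position_subset:
  fixes X :: "'a::euclidean_space set"
  assumes "general_position X" "Y \<subseteq> X" "DIM('a) + 1 \<le> card Y"
  shows "general_position Y"
  using assms unfolding general_position_def by (meson order_trans)

lemma ES_property:
  fixes X :: "'a::euclidean_space set"
  assumes N: "DIM('a) + 1 \<le> N"
      "\<And>X :: 'a set. finite X \<Longrightarrow> card X = N \<Longrightarrow> general_position X \<Longrightarrow> \<exists>P\<subseteq>X. card P = n \<and> convex_position P"
    and X: "finite X" "general_position X" "ES TYPE('a) n \<le> card X"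
  shows "\<exists>P\<subseteq>X. card P = n \<and> convex_position P"
proof -
  let ?works = "\<lambda>N. DIM('a) + 1 \<le> N \<and> (\<forall>X :: 'a set. finite X \<and> card X = N \<and> general_position X \<longrightarrow>
    (\<exists>P\<subseteq>X. card P = n \<and> convex_position P))"
  have "?works N"
    using N by blast
  then have ES: "?works (ES TYPE('a) n)"
    unfolding ES_def by (rule LeastI)
  obtain Z where Z: "Z \<subseteq> X" "card Z = ES TYPE('a) n" "finite Z"
    using X(3) by (meson obtain_subset_with_card_n)
  then have "general_position Z"
    using ES general_position_subset[OF X(2)] by simp
  then show ?thesis
    using ES Z by (meson order_trans)
qed

lemma ES3_property:
  fixes X :: "(real ^ 3) set"
  assumes "finite X" "general_position X" "ES TYPE(real ^ 3) n \<le> card X"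
  shows "\<exists>P\<subseteq>X. card P = n \<and> convex_position P"
proof (rule ES_property[OF _ _ assms])
  fix Y :: "(real ^ 3) set"
  assume Y: "finite Y" "card Y = 4 + 2 ^ fraction_exponent n" "general_position Y"
  then have "has_convex_position_family n (1 / 2 ^ fraction_exponent n) Y"
    using positive_fraction3_fraction_exponent unfolding positive_fraction3_def by simp
  then show "\<exists>P\<subseteq>Y. card P = n \<and> convex_position P"
    by (rule convex_position_transversal) (simp_all add: Y(2))
qed simp

section \<open>Generic projections\<close>

lemma ex_notin_lowdim_sets:
  fixes \<S> :: "'a::euclidean_space set set"
  assumes "finite \<S>" "\<And>S. S \<in> \<S> \<Longrightarrow> dim S < DIM('a)"
  shows "\<exists>r. \<forall>S\<in>\<S>. r \<notin> S"
proof -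
  have "negligible (\<Union>\<S>)"
    using assms by (intro negligible_Union negligible_lowdim)
  then have "\<Union>\<S> \<noteq> UNIV"
    using non_negligible_UNIV by metis
  then show ?thesis by blast
qed

lemma subspace_Int_span_insert:
  assumes U: "subspace U" and W: "subspace W" "U \<inter> W \<subseteq> {0}"
    and r: "r \<notin> {x + y |x y. x \<in> U \<and> y \<in> W}"
  shows "U \<inter> span (insert r W) \<subseteq> {0}"
proof
  fix x assume x: "x \<in> U \<inter> span (insert r W)"
  then obtain k where k: "x - k *\<^sub>R r \<in> W"
    using W(1) by (auto simp: span_breakdown_eq span_eq_iff[THEN iffD2])
  have "k = 0"
  proof (rule ccontr)
    assume "k \<noteq> 0"
    then have "r = inverse k *\<^sub>R x + (- inverse k) *\<^sub>R (x - k *\<^sub>R r)"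
      by (simp add: scaleR_diff_right)
    moreover have "inverse k *\<^sub>R x \<in> U"
      using x U by (simp add: subspace_mul)
    moreover have "(- inverse k) *\<^sub>R (x - k *\<^sub>R r) \<in> W"
      using W(1) k by (rule subspace_mul)
    ultimately show False
      using r by blast
  qed
  then show "x \<in> {0}"
    using x k W(2) by auto
qed

lemma ex_subspace_avoiding:
  fixes \<U> :: "'a::euclidean_space set set"
  assumes "finite \<U>" "\<And>U. U \<in> \<U> \<Longrightarrow> subspace U \<and> dim U + m \<le> DIM('a)" "m \<le> DIM('a)"
  shows "\<exists>W. subspace W \<and> dim W = m \<and> (\<forall>U\<in>\<U>. U \<inter> W \<subseteq> {0})"
  using assms(2,3)
proof (induction m)
  case 0
  show ?case
    by (intro exI[of _ "{0}"]) (simp add: subspace_0)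
next
  case (Suc m)
  have "\<exists>W. subspace W \<and> dim W = m \<and> (\<forall>U\<in>\<U>. U \<inter> W \<subseteq> {0})"
    using Suc.prems by (intro Suc.IH) force+
  then obtain W where W: "subspace W" "dim W = m" "\<And>U. U \<in> \<U> \<Longrightarrow> U \<inter> W \<subseteq> {0}" by blast
  define plus_W where "plus_W U = {x + y |x y. x \<in> U \<and> y \<in> W}" for U
  have "\<exists>r. \<forall>S\<in>insert W (plus_W ` \<U>). r \<notin> S"
  proof (rule ex_notin_lowdim_sets)
    fix S assume "S \<in> insert W (plus_W ` \<U>)"
    then consider (base) "S = W" | (sum) U where "U \<in> \<U>" "S = plus_W U" by blast
    then show "dim S < DIM('a)"
    proof cases
      case sum
      then show ?thesis
        using dim_sums_Int[of U W] Suc.prems(1)[OF sum(1)] W(1,2) by (simp add: plus_W_def)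
    qed (use W(2) Suc.prems(2) in simp)
  qed (use assms(1) in simp)
  then obtain r where r: "r \<notin> W" "\<And>U. U \<in> \<U> \<Longrightarrow> r \<notin> plus_W U" by blast
  have "dim (span (insert r W)) = Suc m"
    using r(1) W(1,2) by (simp add: dim_insert span_eq_iff[THEN iffD2])
  moreover have "U \<inter> span (insert r W) \<subseteq> {0}" if "U \<in> \<U>" for U
    using Suc.prems(1)[OF that] W(1) W(3)[OF that] r(2)[OF that]
    unfolding plus_W_def by (intro subspace_Int_span_insert) auto
  ultimately show ?case
    by (intro exI[of _ "span (insert r W)"]) (simp add: subspace_span)
qed

lemma affine_independent_if_general_position:
  fixes X :: "'a::euclidean_space set"
  assumes "finite X" "general_position X" "Q \<subseteq> X" "card Q \<le> DIM('a) + 1"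
  shows "\<not> affine_dependent Q"
proof -
  have "DIM('a) + 1 \<le> card X"
    using assms(1,2) unfolding general_position_def by blast
  then obtain S where S: "Q \<subseteq> S" "S \<subseteq> X" "card S = DIM('a) + 1"
    using exists_subset_between[OF assms(4) _ assms(3,1)] by blast
  have "finite S"
    using S(2) assms(1) finite_subset by blast
  have "\<not> aff_dim S < int DIM('a)"
  proof
    assume "aff_dim S < int DIM('a)"
    then obtain a b where "a \<noteq> 0" "S \<subseteq> {x. a \<bullet> x = b}"
      by (rule aff_lowdim_subset_hyperplane)
    then show False
      using assms(2) S(2,3) unfolding general_position_def by blast
  qed
  then have "aff_dim S = int (card S) - 1"
    using aff_dim_le_card[OF \<open>finite S\<close>] S(3) by simp
  then have "\<not> affine_dependent S"
    using \<open>finite S\<close> by (simp add: affine_independent_iff_card)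
  then show ?thesis
    using S(1) by (rule affine_independent_subset)
qed

definition orthogonal_to_differences :: "'a::euclidean_space set \<Rightarrow> 'a set" where
  "orthogonal_to_differences Q = {z. \<forall>x\<in>Q. \<forall>y\<in>Q. z \<bullet> (x - y) = 0}"

lemma subspace_orthogonal_to_differences: "subspace (orthogonal_to_differences Q)"
  unfolding orthogonal_to_differences_def subspace_def by (auto simp: inner_add_left)

lemma dim_orthogonal_to_differences:
  fixes Q :: "'a::euclidean_space set"
  assumes "\<not> affine_dependent Q" "Q \<noteq> {}"
  shows "dim (orthogonal_to_differences Q) + card Q \<le> DIM('a) + 1"
proof -
  obtain q where "q \<in> Q"
    using assms(2) by blast
  let ?D = "span ((\<lambda>x. x - q) ` Q)"
  have "aff_dim Q = int (dim ?D)"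
    using aff_dim_eq_dim_subtract[of q Q] hull_inc[OF \<open>q \<in> Q\<close>] by simp
  then have "card Q = dim ?D + 1"
    using assms(1) by (simp add: affine_independent_iff_card)
  moreover have "orthogonal_to_differences Q \<subseteq> {y \<in> UNIV. \<forall>x\<in>?D. orthogonal x y}"
  proof
    fix z assume z: "z \<in> orthogonal_to_differences Q"
    have "orthogonal z y" if "y \<in> (\<lambda>x. x - q) ` Q" for y
      using that z \<open>q \<in> Q\<close> by (auto simp: orthogonal_to_differences_def orthogonal_def)
    then have "orthogonal z x" if "x \<in> ?D" for x
      using orthogonal_to_span[OF that] by blast
    then show "z \<in> {y \<in> UNIV. \<forall>x\<in>?D. orthogonal x y}"
      by (simp add: orthogonal_commute)
  qed
  then have "dim (orthogonal_to_differences Q) \<le> dim {y \<in> UNIV. \<forall>x\<in>?D. orthogonal x y}"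
    by (rule dim_subset)
  moreover have "dim {y \<in> UNIV. \<forall>x\<in>?D. orthogonal x y} + dim ?D = dim (UNIV :: 'a set)"
    by (rule dim_subspace_orthogonal_to_vectors) auto
  ultimately show ?thesis by simp
qed

lemma ex_generic_subspace:
  fixes X :: "'a::euclidean_space set"
  assumes X: "finite X" "general_position X" and "m \<le> DIM('a)"
  shows "\<exists>W. subspace W \<and> dim W = m \<and>
    (\<forall>Q\<subseteq>X. card Q = m + 1 \<longrightarrow> orthogonal_to_differences Q \<inter> W \<subseteq> {0})"
proof -
  let ?\<U> = "orthogonal_to_differences ` {Q. Q \<subseteq> X \<and> card Q = m + 1}"
  have "\<exists>W. subspace W \<and> dim W = m \<and> (\<forall>U\<in>?\<U>. U \<inter> W \<subseteq> {0})"
  proof (rule ex_subspace_avoiding[OF _ _ assms(3)])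
    show "finite ?\<U>"
      using X(1) by simp
    fix U assume "U \<in> ?\<U>"
    then obtain Q where Q: "Q \<subseteq> X" "card Q = m + 1" "U = orthogonal_to_differences Q" by blast
    then have "\<not> affine_dependent Q" "Q \<noteq> {}"
      using affine_independent_if_general_position[OF X Q(1)] assms(3) by auto
    then show "subspace U \<and> dim U + m \<le> DIM('a)"
      using dim_orthogonal_to_differences[of Q] Q(2,3) subspace_orthogonal_to_differences by simp
  qed
  then show ?thesis by blast
qed

lemma inj_on_if_no_hyperplane:
  fixes f :: "'a \<Rightarrow> 'b::euclidean_space"
  assumes "finite X" "DIM('b) + 1 \<le> card X"
    and no_hyperplane: "\<And>Q a b. Q \<subseteq> X \<Longrightarrow> card Q = DIM('b) + 1 \<Longrightarrow> a \<noteq> 0 \<Longrightarrow> \<not> f ` Q \<subseteq> {z. a \<bullet> z = b}"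
  shows "inj_on f X"
proof (rule inj_onI, rule ccontr)
  fix x y assume xy: "x \<in> X" "y \<in> X" "f x = f y" "x \<noteq> y"
  have "card {x, y} \<le> DIM('b) + 1"
    using xy(4) DIM_positive[where 'a = 'b] by simp
  then obtain Q where Q: "{x, y} \<subseteq> Q" "Q \<subseteq> X" "card Q = DIM('b) + 1"
    using exists_subset_between[OF _ assms(2) _ assms(1), of "{x, y}"] xy(1,2) by blast
  have "finite Q"
    using Q(2) assms(1) finite_subset by blast
  have "f y \<in> f ` (Q - {y})"
    using Q(1) xy(3,4) by (intro image_eqI[of _ f x]) auto
  then have "f ` Q \<subseteq> f ` (Q - {y})" by blast
  then have "card (f ` Q) \<le> DIM('b)"
    using Q(1,3) \<open>finite Q\<close> card_mono[of "f ` (Q - {y})" "f ` Q"] card_image_le[of "Q - {y}" f] by simp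
  then have "aff_dim (f ` Q) < int DIM('b)"
    using aff_dim_le_card[of "f ` Q"] \<open>finite Q\<close> by simp
  then obtain a b where "a \<noteq> 0" "f ` Q \<subseteq> {z. a \<bullet> z = b}"
    by (rule aff_lowdim_subset_hyperplane)
  then show False
    using no_hyperplane Q(2,3) by blast
qed

lemma general_position_image:
  fixes f :: "'a \<Rightarrow> 'b::euclidean_space"
  assumes "DIM('b) + 1 \<le> card X" "inj_on f X"
    and no_hyperplane: "\<And>Q a b. Q \<subseteq> X \<Longrightarrow> card Q = DIM('b) + 1 \<Longrightarrow> a \<noteq> 0 \<Longrightarrow> \<not> f ` Q \<subseteq> {z. a \<bullet> z = b}"
  shows "general_position (f ` X)"
  unfolding general_position_def
proof (intro conjI impI notI)
  show "DIM('b) + 1 \<le> card (f ` X)"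
    using assms(1,2) by (simp add: card_image)
  assume "\<exists>S a b. S \<subseteq> f ` X \<and> card S = DIM('b) + 1 \<and> a \<noteq> 0 \<and> S \<subseteq> {z. a \<bullet> z = b}"
  then obtain S a b where S: "S \<subseteq> f ` X" "card S = DIM('b) + 1" "a \<noteq> 0" "S \<subseteq> {z. a \<bullet> z = b}" by blast
  then obtain Q where "Q \<subseteq> X" "inj_on f Q" "S = f ` Q"
    by (meson subset_image_inj)
  then show False
    using no_hyperplane[of Q a b] S by (simp add: card_image)
qed

text \<open>The projection is the adjoint of an isometric embedding onto a subspace that contains no nonzero
  vector orthogonal to all differences of \<open>DIM('b) + 1\<close> points of \<open>X\<close>.\<close>
lemma generic_projection:
  fixes X :: "'a::euclidean_space set"
  assumes dim: "DIM('b::euclidean_space) \<le> DIM('a)" and X: "finite X" "general_position X"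
  shows "\<exists>f :: 'a \<Rightarrow> 'b. linear f \<and> inj_on f X \<and> general_position (f ` X)"
proof -
  obtain W where W: "subspace W" "dim W = DIM('b)"
    and avoid: "\<And>Q. Q \<subseteq> X \<Longrightarrow> card Q = DIM('b) + 1 \<Longrightarrow> orthogonal_to_differences Q \<inter> W \<subseteq> {0}"
    using ex_generic_subspace[OF X dim] by blast
  obtain g :: "'b \<Rightarrow> 'a" where g: "linear g" "g ` UNIV = W" "\<And>a. norm (g a) = norm a"
    using isometry_subspaces[of "UNIV :: 'b set" W] W by auto
  have no_hyperplane: "\<not> adjoint g ` Q \<subseteq> {z. a \<bullet> z = b}"
    if Q: "Q \<subseteq> X" "card Q = DIM('b) + 1" and "a \<noteq> 0" for Q a b
  proof
    assume "adjoint g ` Q \<subseteq> {z. a \<bullet> z = b}"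
    then have "g a \<bullet> x = b" if "x \<in> Q" for x
      using that by (auto simp: adjoint_works[OF g(1), symmetric])
    then have "g a \<in> orthogonal_to_differences Q \<inter> W"
      using g(2) by (auto simp: orthogonal_to_differences_def inner_diff_right)
    then have "g a = 0"
      using avoid[OF Q] by blast
    then show False
      using g(3)[of a] \<open>a \<noteq> 0\<close> by simp
  qed
  have card: "DIM('b) + 1 \<le> card X"
    using X dim unfolding general_position_def by auto
  have "inj_on (adjoint g) X"
    using X(1) card no_hyperplane by (rule inj_on_if_no_hyperplane)
  moreover from this have "general_position (adjoint g ` X)"
    using no_hyperplane by (rule general_position_image[OF card])
  ultimately show ?thesis
    using adjoint_linear[OF g(1)] by blast
qed

lemma positive_fraction_erdos_szekeres:
  fixes X :: "'a::euclidean_space set"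
  assumes "3 \<le> DIM('a)" "finite X" "general_position X" "n \<le> m" "ES TYPE(real ^ 3) m \<le> card X"
  shows "has_convex_position_family n (1 / 2 ^ fraction_exponent n) X"
proof -
  obtain f :: "'a \<Rightarrow> real ^ 3" where f: "linear f" "inj_on f X" "general_position (f ` X)"
    using generic_projection[where 'b = "real ^ 3", OF _ assms(2,3)] assms(1) by auto
  have fX: "finite (f ` X)" "card (f ` X) = card X"
    using assms(2) card_image[OF f(2)] by simp_all
  have "has_convex_position_family n (1 / 2 ^ fraction_exponent n) (f ` X)"
  proof (cases "2 ^ fraction_exponent n \<le> card X")
    case True
    then show ?thesis
      using positive_fraction3_fraction_exponent fX f(3) unfolding positive_fraction3_def by simp
  next
    case False
    obtain P where P: "P \<subseteq> f ` X" "card P = m" "convex_position P"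
      using ES3_property[OF fX(1) f(3)] fX(2) assms(5) by auto
    have "real (card X) < 2 ^ fraction_exponent n"
      using False by (metis not_le of_nat_less_numeral_power_cancel_iff)
    then show ?thesis
      using P assms(4) fX by (intro has_convex_position_family_of_points[of _ P]) simp_all
  qed
  then show ?thesis
    by (rule has_convex_position_family_linear_image[OF f(1,2)])
qed

theorem theorem1p3:
  assumes "CARD('d::finite) \<ge> 3"
  shows "\<exists>\<epsilon>::nat \<Rightarrow> real.
    (\<forall>n\<ge>3. \<epsilon> n > 0) \<and>
    (\<lambda>n. log 2 (1 / \<epsilon> n)) \<in> o(\<lambda>n. real n) \<and>
    (\<forall>n\<ge>3. \<forall>\<X>::(real ^ 'd) set.
       finite \<X> \<and> general_position \<X> \<and> card \<X> \<ge> ES TYPE(real ^ 3) (8 * n) \<longrightarrow>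
       (\<exists>X::nat \<Rightarrow> (real ^ 'd) set.
          (\<forall>i\<in>{1..n}. X i \<subseteq> \<X>) \<and>
          family_convex_position {1..n} X \<and>
          (\<forall>i\<in>{1..n}. real (card (X i)) \<ge> \<epsilon> n * real (card \<X>))))"
proof -
  define \<epsilon> :: "nat \<Rightarrow> real" where "\<epsilon> n = 1 / 2 ^ fraction_exponent n" for n
  have "\<forall>n\<ge>3. \<epsilon> n > 0"
    by (simp add: \<epsilon>_def)
  moreover have "(\<lambda>n. log 2 (1 / \<epsilon> n)) \<in> o(\<lambda>n. real n)"
    using fraction_exponent_sublinear by (simp add: \<epsilon>_def log_nat_power)
  moreover have "\<exists>X. (\<forall>i\<in>{1..n}. X i \<subseteq> \<X>) \<and> family_convex_position {1..n} X \<and>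
      (\<forall>i\<in>{1..n}. real (card (X i)) \<ge> \<epsilon> n * real (card \<X>))"
    if "finite \<X>" "general_position \<X>" "card \<X> \<ge> ES TYPE(real ^ 3) (8 * n)"
    for n and \<X> :: "(real ^ 'd) set"
  proof -
    have "has_convex_position_family n (\<epsilon> n) \<X>"
      unfolding \<epsilon>_def using assms that
      by (intro positive_fraction_erdos_szekeres[where m = "8 * n"]) auto
    then obtain X where "\<forall>i\<in>{1..n}. X i \<subseteq> \<X> \<and> \<epsilon> n * real (card \<X>) \<le> real (card (X i))"
      "family_convex_position {1..n} X"
      unfolding has_convex_position_family_def by (elim exE conjE)
    then show ?thesis
      by (intro exI[of _ X]) simp
  qed
  ultimately show ?thesis by blast
qed

end
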